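(* For any $n\ge 1$, a $GBS_n$ group $G$ has a finite index subgroup $H$ possessing a product acylindrical action if and only if the monodromy of $G$ is finite.
   Context: Let $n\ge 1$. A generalised rank $n$ Baumslag-Solitar group ($GBS_n$ group) is a group $G$ which is the fundamental group of a finite (connected) graph of groups in which all vertex and edge groups are isomorphic to $\mathbb{Z}^n$; a $GBS_n$ group is understood to come with such a decomposition. $G$ then acts without edge inversions and cocompactly on the Bass-Serre tree $T$ of the decomposition, which is locally finite. Modular homomorphism and monodromy: choose a base vertex $v_0$ of $T$, a finite index subgroup $A\cong\mathbb{Z}^n$ of $\mathrm{Stab}_G(v_0)\cong\mathbb{Z}^n$ (called a base $\mathbb{Z}^n$-subgroup of $G$) and an ordered basis $a_1,\ldots,a_n$ of $A$. For any $g\in G$ the subgroups $A$ and $g^{-1}Ag$ are commensurable, so there is $m>0$ such that $\langle a_1^m,\ldots,a_n^m\rangle$ is a finite index subgroup of $A\cap g^{-1}Ag$. Hence there are unique integers $g_{ij}$ with $g a_j^m g^{-1}=a_1^{g_{1j}}\cdots a_n^{g_{nj}}$ for each $j$. The modular homomorphism $\mathcal{M}:G\to GL(n,\mathbb{Q})$ sends $g$ to the matrix with $(i,j)$ entry $g_{ij}/m$. This is independent of $m$, is a homomorphism, and changing the choices of $v_0$, $A$ and basis changes $\mathcal{M}$ only by conjugation in $GL(n,\mathbb{Q})$. The monodromy of $G$ is the image $\mathcal{M}(G)$. A hyperbolic space is a geodesic metric space which is $\delta$-hyperbolic (in the sense of Gromov) for some $\delta\ge 0$; it need not be proper. An isometric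 action of a group $H$ on a metric space $X$ is acylindrical if for every $\epsilon\ge 0$ there are $N,R$ such that for all $x,y\in X$ with $d(x,y)\ge R$, the set $\{h\in H : d(x,h(x))\le\epsilon \text{ and } d(y,h(y))\le\epsilon\}$ has cardinality at most $N$. An isometric action of $H$ on $P=X_1\times\cdots\times X_r$ (with the $\ell_1$ product metric) preserves factors if the image of $H$ in $\mathrm{Isom}(P)$ lies in $\mathrm{Isom}(X_1)\times\cdots\times\mathrm{Isom}(X_r)$, so each $h\in H$ acts as $(h_1,\ldots,h_r)$ with $h_i\in\mathrm{Isom}(X_i)$. An isometry $f$ of a hyperbolic space $X$ is loxodromic if $k\mapsto f^k(x)$ is a quasi-isometric embedding of $\mathbb{Z}$ into $X$ for some (equivalently any) $x\in X$. A product acylindrical action of a group $H$ is an isometric action of $H$ on a finite product $P=X_1\times\cdots\times X_r$ ($r\ge1$) of hyperbolic spaces, with the $\ell_1$ product metric, which is acylindrical as an action on $P$, preserves the factors of $P$, and is such that there is an element $h=(h_1,\ldots,h_r)$ in $H$ where some $h_i$ acts loxodromically on $X_i$. *)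

theory Defs
  imports "HOL-Analysis.Analysis" "HOL-Algebra.Group_Action"
    "HOL-Algebra.FiniteProduct" "HOL-Algebra.Generated_Groups" "HOL-Algebra.Product_Groups" "Graph_Theory.Graph_Theory"
begin

text \<open>
  Graphs are graphs in the sense of Serre: every arc \<open>e\<close> comes with a distinct reverse
  arc \<open>rev_arc e\<close> (\<open>bidirected_digraph\<close>), and the edge group of \<open>e\<close> is also that of its
  reverse.  The monomorphism \<open>emb e\<close> goes from the edge group into the vertex group at the
  \<^emph>\<open>head\<close> of \<open>e\<close>; the one at the tail is \<open>emb (rev_arc e)\<close>.
\<close>

record ('v, 'e, 'g, 'h) graph_of_groups =
  base_graph :: "('v, 'e) pre_digraph"
  rev_arc :: "'e \<Rightarrow> 'e"
  vgroup :: "'v \<Rightarrow> 'g monoid"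
  egroup :: "'e \<Rightarrow> 'h monoid"
  emb :: "'e \<Rightarrow> 'h \<Rightarrow> 'g"

abbreviation gverts :: "('v, 'e, 'g, 'h) graph_of_groups \<Rightarrow> 'v set" where
  "gverts \<Gamma> \<equiv> verts (base_graph \<Gamma>)"

abbreviation garcs :: "('v, 'e, 'g, 'h) graph_of_groups \<Rightarrow> 'e set" where
  "garcs \<Gamma> \<equiv> arcs (base_graph \<Gamma>)"

abbreviation gtail :: "('v, 'e, 'g, 'h) graph_of_groups \<Rightarrow> 'e \<Rightarrow> 'v" where
  "gtail \<Gamma> \<equiv> tail (base_graph \<Gamma>)"

abbreviation ghead :: "('v, 'e, 'g, 'h) graph_of_groups \<Rightarrow> 'e \<Rightarrow> 'v" where
  "ghead \<Gamma> \<equiv> head (base_graph \<Gamma>)"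

definition finite_connected_graph_of_groups :: "('v, 'e, 'g, 'h) graph_of_groups \<Rightarrow> bool" where
  "finite_connected_graph_of_groups \<Gamma> \<longleftrightarrow>
     fin_digraph (base_graph \<Gamma>) \<and>
     bidirected_digraph (base_graph \<Gamma>) (rev_arc \<Gamma>) \<and>
     Digraph_Component.connected (base_graph \<Gamma>) \<and>
     (\<forall>v\<in>gverts \<Gamma>. group (vgroup \<Gamma> v)) \<and>
     (\<forall>e\<in>garcs \<Gamma>. group (egroup \<Gamma> e) \<and>
        egroup \<Gamma> (rev_arc \<Gamma> e) = egroup \<Gamma> e \<and>
        emb \<Gamma> e \<in> hom (egroup \<Gamma> e) (vgroup \<Gamma> (ghead \<Gamma> e)) \<and>
        inj_on (emb \<Gamma> e) (carrier (egroup \<Gamma> e)))"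

definition Zn :: "('n::finite \<Rightarrow> int) monoid" where
  "Zn = product_group UNIV (\<lambda>_. integer_group)"

text \<open>The rank \<open>n\<close> of a \<open>GBS\<^sub>n\<close> group is \<open>CARD('n)\<close>, so \<open>n \<ge> 1\<close> automatically.\<close>

definition gbs_graph :: "'n::finite itself \<Rightarrow> ('v, 'e, 'g, 'h) graph_of_groups \<Rightarrow> bool" where
  "gbs_graph _ \<Gamma> \<longleftrightarrow>
     finite_connected_graph_of_groups \<Gamma> \<and>
     (\<forall>v\<in>gverts \<Gamma>. vgroup \<Gamma> v \<cong> (Zn :: ('n \<Rightarrow> int) monoid)) \<and>
     (\<forall>e\<in>garcs \<Gamma>. egroup \<Gamma> e \<cong> (Zn :: ('n \<Rightarrow> int) monoid))"

text \<open>
  Serre's group \<open>F(\<Gamma>)\<close>: generated by all vertex groups together with the arcs, subject to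
  \<open>e\<^sup>-\<^sup>1 = rev_arc e\<close> and \<open>e (emb e x) e\<^sup>-\<^sup>1 = emb (rev_arc e) x\<close> for \<open>x\<close> in the edge group
  of \<open>e\<close>.  It is realised as the set of words in these generators modulo the congruence
  generated by the relations.
\<close>

datatype ('v, 'e, 'g) letter = Vtx 'v 'g | Edg 'e

definition letters :: "('v, 'e, 'g, 'h) graph_of_groups \<Rightarrow> ('v, 'e, 'g) letter set" where
  "letters \<Gamma> = {Vtx v x | v x. v \<in> gverts \<Gamma> \<and> x \<in> carrier (vgroup \<Gamma> v)} \<union> Edg ` garcs \<Gamma>"

inductive word_eq ::
  "('v, 'e, 'g, 'h) graph_of_groups \<Rightarrow> ('v, 'e, 'g) letter list \<Rightarrow> ('v, 'e, 'g) letter list \<Rightarrow> bool"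
  for \<Gamma> where
  refl: "w \<in> lists (letters \<Gamma>) \<Longrightarrow> word_eq \<Gamma> w w"
| sym: "word_eq \<Gamma> w w' \<Longrightarrow> word_eq \<Gamma> w' w"
| trans: "word_eq \<Gamma> w w' \<Longrightarrow> word_eq \<Gamma> w' w'' \<Longrightarrow> word_eq \<Gamma> w w''"
| cong: "word_eq \<Gamma> w w' \<Longrightarrow> p \<in> lists (letters \<Gamma>) \<Longrightarrow> q \<in> lists (letters \<Gamma>) \<Longrightarrow>
    word_eq \<Gamma> (p @ w @ q) (p @ w' @ q)"
| vertex_mult: "v \<in> gverts \<Gamma> \<Longrightarrow> x \<in> carrier (vgroup \<Gamma> v) \<Longrightarrow> y \<in> carrier (vgroup \<Gamma> v) \<Longrightarrow>
    word_eq \<Gamma> [Vtx v x, Vtx v y] [Vtx v (x \<otimes>\<^bsub>vgroup \<Gamma> v\<^esub> y)]"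
| vertex_one: "v \<in> gverts \<Gamma> \<Longrightarrow> word_eq \<Gamma> [Vtx v \<one>\<^bsub>vgroup \<Gamma> v\<^esub>] []"
| edge_inv: "e \<in> garcs \<Gamma> \<Longrightarrow> word_eq \<Gamma> [Edg e, Edg (rev_arc \<Gamma> e)] []"
| edge_conj: "e \<in> garcs \<Gamma> \<Longrightarrow> x \<in> carrier (egroup \<Gamma> e) \<Longrightarrow>
    word_eq \<Gamma> [Edg e, Vtx (ghead \<Gamma> e) (emb \<Gamma> e x), Edg (rev_arc \<Gamma> e)]
              [Vtx (gtail \<Gamma> e) (emb \<Gamma> (rev_arc \<Gamma> e) x)]"

definition word_class ::
  "('v, 'e, 'g, 'h) graph_of_groups \<Rightarrow> ('v, 'e, 'g) letter list \<Rightarrow> ('v, 'e, 'g) letter list set" where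
  "word_class \<Gamma> w = {w'. word_eq \<Gamma> w w'}"

definition path_group ::
  "('v, 'e, 'g, 'h) graph_of_groups \<Rightarrow> ('v, 'e, 'g) letter list set monoid" where
  "path_group \<Gamma> =
     \<lparr>carrier = word_class \<Gamma> ` lists (letters \<Gamma>),
      monoid.mult = \<lambda>X Y. \<Union>x\<in>X. \<Union>y\<in>Y. word_class \<Gamma> (x @ y),
      one = word_class \<Gamma> []\<rparr>"

text \<open>
  \<open>path_word \<Gamma> u w v\<close>: the word \<open>w\<close> reads \<open>x\<^sub>0 e\<^sub>1 x\<^sub>1 \<dots> e\<^sub>k x\<^sub>k\<close> along a path of arcs from
  \<open>u\<close> to \<open>v\<close>, with each \<open>x\<^sub>i\<close> a (possibly empty) product of elements of the vertex group
  at the vertex reached after \<open>e\<^sub>i\<close>.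
\<close>

fun path_word ::
  "('v, 'e, 'g, 'h) graph_of_groups \<Rightarrow> 'v \<Rightarrow> ('v, 'e, 'g) letter list \<Rightarrow> 'v \<Rightarrow> bool" where
  "path_word \<Gamma> u [] v \<longleftrightarrow> u \<in> gverts \<Gamma> \<and> u = v"
| "path_word \<Gamma> u (Vtx t x # w) v \<longleftrightarrow> t = u \<and> x \<in> carrier (vgroup \<Gamma> u) \<and> path_word \<Gamma> u w v"
| "path_word \<Gamma> u (Edg e # w) v \<longleftrightarrow> e \<in> garcs \<Gamma> \<and> gtail \<Gamma> e = u \<and> path_word \<Gamma> (ghead \<Gamma> e) w v"

definition path_classes ::
  "('v, 'e, 'g, 'h) graph_of_groups \<Rightarrow> 'v \<Rightarrow> 'v \<Rightarrow> ('v, 'e, 'g) letter list set set" where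
  "path_classes \<Gamma> u v = word_class \<Gamma> ` {w. path_word \<Gamma> u w v}"

definition fundamental_group ::
  "('v, 'e, 'g, 'h) graph_of_groups \<Rightarrow> 'v \<Rightarrow> ('v, 'e, 'g) letter list set monoid" where
  "fundamental_group \<Gamma> P = (path_group \<Gamma>)\<lparr>carrier := path_classes \<Gamma> P P\<rparr>"

text \<open>
  With respect to the base point \<open>P\<close>, the vertices of the Bass--Serre tree lying over \<open>v\<close>
  are the cosets \<open>g G\<^sub>v\<close> in \<open>F(\<Gamma>)\<close>, where \<open>g\<close> is represented by a path from \<open>P\<close> to \<open>v\<close>; the
  fundamental group acts by left multiplication.  The edges of the tree are not needed
  to speak about vertex stabilisers.
\<close>

definition vertex_subgroup ::
  "('v, 'e, 'g, 'h) graph_of_groups \<Rightarrow> 'v \<Rightarrow> ('v, 'e, 'g) letter list set set" where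
  "vertex_subgroup \<Gamma> v = (\<lambda>x. word_class \<Gamma> [Vtx v x]) ` carrier (vgroup \<Gamma> v)"

type_synonym ('v, 'e, 'g) tree_vertex = "'v \<times> ('v, 'e, 'g) letter list set set"

definition tree_vertices ::
  "('v, 'e, 'g, 'h) graph_of_groups \<Rightarrow> 'v \<Rightarrow> ('v, 'e, 'g) tree_vertex set" where
  "tree_vertices \<Gamma> P =
     {(v, g <#\<^bsub>path_group \<Gamma>\<^esub> vertex_subgroup \<Gamma> v) | v g. v \<in> gverts \<Gamma> \<and> g \<in> path_classes \<Gamma> P v}"

definition tree_action ::
  "('v, 'e, 'g, 'h) graph_of_groups \<Rightarrow> ('v, 'e, 'g) letter list set \<Rightarrow>
     ('v, 'e, 'g) tree_vertex \<Rightarrow> ('v, 'e, 'g) tree_vertex" where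
  "tree_action \<Gamma> h = (\<lambda>(v, C). (v, h <#\<^bsub>path_group \<Gamma>\<^esub> C))"

definition tree_stabilizer ::
  "('v, 'e, 'g, 'h) graph_of_groups \<Rightarrow> 'v \<Rightarrow> ('v, 'e, 'g) tree_vertex \<Rightarrow>
     ('v, 'e, 'g) letter list set set" where
  "tree_stabilizer \<Gamma> P v0 = stabilizer (fundamental_group \<Gamma> P) (tree_action \<Gamma>) v0"

definition finite_index_subgroup :: "'a set \<Rightarrow> 'a monoid \<Rightarrow> bool" where
  "finite_index_subgroup H G \<longleftrightarrow> subgroup H G \<and> finite (rcosets\<^bsub>G\<^esub> H)"

definition base_Zn_subgroup ::
  "'n::finite itself \<Rightarrow> ('v, 'e, 'g, 'h) graph_of_groups \<Rightarrow> 'v \<Rightarrow> ('v, 'e, 'g) tree_vertex \<Rightarrow>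
     ('v, 'e, 'g) letter list set set \<Rightarrow> bool" where
  "base_Zn_subgroup _ \<Gamma> P v0 A \<longleftrightarrow>
     v0 \<in> tree_vertices \<Gamma> P \<and>
     finite_index_subgroup A ((fundamental_group \<Gamma> P)\<lparr>carrier := tree_stabilizer \<Gamma> P v0\<rparr>) \<and>
     (fundamental_group \<Gamma> P)\<lparr>carrier := A\<rparr> \<cong> (Zn :: ('n \<Rightarrow> int) monoid)"

text \<open>
  \<open>a\<^sub>1\<^bsup>k\<^sub>1\<^esup> \<cdots> a\<^sub>n\<^bsup>k\<^sub>n\<^esup>\<close>, formed in the abelian subgroup \<open>A\<close> of \<open>G\<close>.
\<close>

definition int_comb :: "'a monoid \<Rightarrow> 'a set \<Rightarrow> ('n::finite \<Rightarrow> 'a) \<Rightarrow> ('n \<Rightarrow> int) \<Rightarrow> 'a" where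
  "int_comb G A a k = finprod (G\<lparr>carrier := A\<rparr>) (\<lambda>i. a i [^]\<^bsub>G\<^esub> k i) UNIV"

definition ordered_basis :: "'a monoid \<Rightarrow> 'a set \<Rightarrow> ('n::finite \<Rightarrow> 'a) \<Rightarrow> bool" where
  "ordered_basis G A a \<longleftrightarrow> range a \<subseteq> A \<and> bij_betw (int_comb G A a) UNIV A"

definition modular_hom :: "'a monoid \<Rightarrow> 'a set \<Rightarrow> ('n::finite \<Rightarrow> 'a) \<Rightarrow> 'a \<Rightarrow> rat^'n^'n" where
  "modular_hom G A a g =
     (THE M. \<exists>(m::nat) (c :: 'n \<Rightarrow> 'n \<Rightarrow> int). m > 0 \<and>
        finite_index_subgroup (generate G (range (\<lambda>j. a j [^]\<^bsub>G\<^esub> m)))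
          (G\<lparr>carrier := A \<inter> (\<lambda>x. inv\<^bsub>G\<^esub> g \<otimes>\<^bsub>G\<^esub> x \<otimes>\<^bsub>G\<^esub> g) ` A\<rparr>) \<and>
        (\<forall>j. g \<otimes>\<^bsub>G\<^esub> a j [^]\<^bsub>G\<^esub> m \<otimes>\<^bsub>G\<^esub> inv\<^bsub>G\<^esub> g = int_comb G A a (\<lambda>i. c i j)) \<and>
        M = (\<chi> i j. of_int (c i j) / of_nat m))"

definition monodromy :: "'a monoid \<Rightarrow> 'a set \<Rightarrow> ('n::finite \<Rightarrow> 'a) \<Rightarrow> (rat^'n^'n) set" where
  "monodromy G A a = modular_hom G A a ` carrier G"

definition geodesic_space :: "'x metric \<Rightarrow> bool" where
  "geodesic_space X \<longleftrightarrow>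
     (\<forall>x\<in>mspace X. \<forall>y\<in>mspace X. \<exists>\<gamma> :: real \<Rightarrow> 'x.
        \<gamma> ` {0..mdist X x y} \<subseteq> mspace X \<and> \<gamma> 0 = x \<and> \<gamma> (mdist X x y) = y \<and>
        (\<forall>s\<in>{0..mdist X x y}. \<forall>t\<in>{0..mdist X x y}. mdist X (\<gamma> s) (\<gamma> t) = \<bar>s - t\<bar>))"

definition Gromov_product :: "'x metric \<Rightarrow> 'x \<Rightarrow> 'x \<Rightarrow> 'x \<Rightarrow> real" where
  "Gromov_product X w x y = (mdist X x w + mdist X y w - mdist X x y) / 2"

definition Gromov_hyperbolic :: "real \<Rightarrow> 'x metric \<Rightarrow> bool" where
  "Gromov_hyperbolic \<delta> X \<longleftrightarrow>
     (\<forall>w\<in>mspace X. \<forall>x\<in>mspace X. \<forall>y\<in>mspace X. \<forall>z\<in>mspace X.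
        Gromov_product X w x z \<ge> min (Gromov_product X w x y) (Gromov_product X w y z) - \<delta>)"

text \<open>
  Nonemptiness is the usual convention for metric spaces.  It matters: an empty factor would
  make the product empty and every action on it vacuously acylindrical.
\<close>

definition hyperbolic_space :: "'x metric \<Rightarrow> bool" where
  "hyperbolic_space X \<longleftrightarrow> mspace X \<noteq> {} \<and> geodesic_space X \<and> (\<exists>\<delta>\<ge>0. Gromov_hyperbolic \<delta> X)"

text \<open>Isometries are surjective; they are extensional outside \<open>mspace X\<close>, as elements of
  \<open>BijGroup (mspace X)\<close>.\<close>

definition Isom :: "'x metric \<Rightarrow> ('x \<Rightarrow> 'x) set" where
  "Isom X = {f \<in> Bij (mspace X). \<forall>x\<in>mspace X. \<forall>y\<in>mspace X. mdist X (f x) (f y) = mdist X x y}"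

definition isometric_action :: "'a monoid \<Rightarrow> 'x metric \<Rightarrow> ('a \<Rightarrow> 'x \<Rightarrow> 'x) \<Rightarrow> bool" where
  "isometric_action H X \<phi> \<longleftrightarrow> group_action H (mspace X) \<phi> \<and> \<phi> ` carrier H \<subseteq> Isom X"

text \<open>The cardinality bound is about elements of \<open>H\<close>, not about their images in \<open>Isom X\<close>.\<close>

definition acylindrical :: "'a monoid \<Rightarrow> 'x metric \<Rightarrow> ('a \<Rightarrow> 'x \<Rightarrow> 'x) \<Rightarrow> bool" where
  "acylindrical H X \<phi> \<longleftrightarrow>
     (\<forall>\<epsilon>\<ge>0. \<exists>(N::nat) (R::real). \<forall>x\<in>mspace X. \<forall>y\<in>mspace X. mdist X x y \<ge> R \<longrightarrow>
        finite {h \<in> carrier H. mdist X x (\<phi> h x) \<le> \<epsilon> \<and> mdist X y (\<phi> h y) \<le> \<epsilon>} \<and>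
        card {h \<in> carrier H. mdist X x (\<phi> h x) \<le> \<epsilon> \<and> mdist X y (\<phi> h y) \<le> \<epsilon>} \<le> N)"

definition loxodromic :: "'x metric \<Rightarrow> ('x \<Rightarrow> 'x) \<Rightarrow> bool" where
  "loxodromic X f \<longleftrightarrow> f \<in> Isom X \<and>
     (\<exists>x\<in>mspace X. \<exists>L\<ge>1. \<exists>C\<ge>0. \<forall>k l :: int.
        \<bar>real_of_int (k - l)\<bar> / L - C
          \<le> mdist X ((f [^]\<^bsub>BijGroup (mspace X)\<^esub> k) x) ((f [^]\<^bsub>BijGroup (mspace X)\<^esub> l) x) \<and>
        mdist X ((f [^]\<^bsub>BijGroup (mspace X)\<^esub> k) x) ((f [^]\<^bsub>BijGroup (mspace X)\<^esub> l) x)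
          \<le> L * \<bar>real_of_int (k - l)\<bar> + C)"

definition l1_product :: "nat \<Rightarrow> (nat \<Rightarrow> 'x metric) \<Rightarrow> (nat \<Rightarrow> 'x) metric" where
  "l1_product r X =
     metric (\<Pi>\<^sub>E i\<in>{..<r}. mspace (X i), \<lambda>x y. \<Sum>i<r. mdist (X i) (x i) (y i))"

lemma Metric_space_l1_product:
  fixes X :: "nat \<Rightarrow> 'x metric"
  shows "Metric_space (\<Pi>\<^sub>E i\<in>{..<r}. mspace (X i)) (\<lambda>x y. \<Sum>i<r. mdist (X i) (x i) (y i))"
proof
  fix x y z :: "nat \<Rightarrow> 'x"
  show "0 \<le> (\<Sum>i<r. mdist (X i) (x i) (y i))"
    by (simp add: sum_nonneg)
  show "(\<Sum>i<r. mdist (X i) (x i) (y i)) = (\<Sum>i<r. mdist (X i) (y i) (x i))"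
    by (simp add: mdist_commute)
  assume x: "x \<in> (\<Pi>\<^sub>E i\<in>{..<r}. mspace (X i))" and y: "y \<in> (\<Pi>\<^sub>E i\<in>{..<r}. mspace (X i))"
  have "(\<Sum>i<r. mdist (X i) (x i) (y i)) = 0 \<longleftrightarrow> (\<forall>i\<in>{..<r}. mdist (X i) (x i) (y i) = 0)"
    by (rule sum_nonneg_eq_0_iff) auto
  also have "\<dots> \<longleftrightarrow> (\<forall>i\<in>{..<r}. x i = y i)"
    using x y by (auto simp: PiE_iff)
  also have "\<dots> \<longleftrightarrow> x = y"
    using x y by (auto intro: PiE_ext)
  finally show "(\<Sum>i<r. mdist (X i) (x i) (y i)) = 0 \<longleftrightarrow> x = y" .
  assume z: "z \<in> (\<Pi>\<^sub>E i\<in>{..<r}. mspace (X i))"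
  have "(\<Sum>i<r. mdist (X i) (x i) (z i))
      \<le> (\<Sum>i<r. mdist (X i) (x i) (y i) + mdist (X i) (y i) (z i))"
    using x y z by (intro sum_mono mdist_triangle) (auto simp: PiE_iff)
  then show "(\<Sum>i<r. mdist (X i) (x i) (z i))
      \<le> (\<Sum>i<r. mdist (X i) (x i) (y i)) + (\<Sum>i<r. mdist (X i) (y i) (z i))"
    by (simp add: sum.distrib)
qed

lemma mspace_l1_product [simp]: "mspace (l1_product r X) = (\<Pi>\<^sub>E i\<in>{..<r}. mspace (X i))"
  and mdist_l1_product [simp]:
    "mdist (l1_product r X) = (\<lambda>x y. \<Sum>i<r. mdist (X i) (x i) (y i))"
  by (simp_all add: l1_product_def Metric_space_l1_product
      Metric_space.mspace_metric Metric_space.mdist_metric)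

text \<open>\<open>f\<close> acts on the product as \<open>(f\<^sub>0, \<dots>, f\<^sub>r\<^sub>-\<^sub>1)\<close>.\<close>

definition acts_as ::
  "nat \<Rightarrow> (nat \<Rightarrow> 'x metric) \<Rightarrow> ((nat \<Rightarrow> 'x) \<Rightarrow> (nat \<Rightarrow> 'x)) \<Rightarrow> (nat \<Rightarrow> 'x \<Rightarrow> 'x) \<Rightarrow> bool" where
  "acts_as r X f fs \<longleftrightarrow>
     (\<forall>i<r. fs i \<in> Isom (X i)) \<and> (\<forall>x\<in>mspace (l1_product r X). \<forall>i<r. f x i = fs i (x i))"

definition preserves_factors ::
  "'a monoid \<Rightarrow> nat \<Rightarrow> (nat \<Rightarrow> 'x metric) \<Rightarrow> ('a \<Rightarrow> (nat \<Rightarrow> 'x) \<Rightarrow> (nat \<Rightarrow> 'x)) \<Rightarrow> bool" where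
  "preserves_factors H r X \<phi> \<longleftrightarrow> (\<forall>h\<in>carrier H. \<exists>fs. acts_as r X (\<phi> h) fs)"

definition product_acylindrical_action ::
  "'a monoid \<Rightarrow> nat \<Rightarrow> (nat \<Rightarrow> 'x metric) \<Rightarrow> ('a \<Rightarrow> (nat \<Rightarrow> 'x) \<Rightarrow> (nat \<Rightarrow> 'x)) \<Rightarrow> bool" where
  "product_acylindrical_action H r X \<phi> \<longleftrightarrow>
     r \<ge> 1 \<and> (\<forall>i<r. hyperbolic_space (X i)) \<and>
     isometric_action H (l1_product r X) \<phi> \<and>
     acylindrical H (l1_product r X) \<phi> \<and>
     preserves_factors H r X \<phi> \<and>
     (\<exists>h\<in>carrier H. \<exists>fs. acts_as r X (\<phi> h) fs \<and> (\<exists>i<r. loxodromic (X i) (fs i)))"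

text \<open>
  HOL cannot quantify existentially over types, so the type \<open>'x\<close> supplying the points of the
  factors \<open>X\<^sub>i\<close> (subsets of \<open>'x\<close>) is a parameter.  It should be used at types with at
  least continuum many elements, for instance \<open>'x + real\<close> with \<open>'x\<close> arbitrary: this
  contains every metric space over any type \<open>'x\<close>, and also has room for an action whenever
  a countable group has one at all.
\<close>

definition has_product_acylindrical_action :: "'x itself \<Rightarrow> 'a monoid \<Rightarrow> bool" where
  "has_product_acylindrical_action _ H \<longleftrightarrow>
     (\<exists>r (X :: nat \<Rightarrow> 'x metric) \<phi>. product_acylindrical_action H r X \<phi>)"

end

theory Submission
  imports Defs
begin

text \<open>
  Choosing coordinates, every vertex group becomes a lattice in \<open>\<rat>\<^sup>n\<close>, and an arc \<open>e\<close> a rational matrix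
  intertwining its two embeddings.  Letting vertex elements act by translations and arcs by their
  matrices gives an affine representation of \<open>F(\<Gamma>)\<close>, whose linear part is conjugate to the modular
  homomorphism.

  Suppose a finite index subgroup \<open>H\<close> has a product acylindrical action.  By the four point
  condition the stable translation length on the \<open>i\<close>-th factor, restricted to a base
  \<open>\<int>\<^sup>n\<close>-subgroup, is \<open>\<bar>\<beta>\<^sub>i\<bar>\<close> for an additive \<open>\<beta>\<^sub>i\<close>.  If some \<open>k \<noteq> 0\<close> were killed by all \<open>\<beta>\<^sub>i\<close>,
  then, \<open>H\<close> commensurating the base subgroup, arbitrarily many multiples \<open>s\<close> of \<open>k\<close> and their
  conjugates under a power \<open>g\<close> of a loxodromic element have zero translation length on every factor,
  and commuting finite sets of such elements move some point \<open>x\<close> a bounded amount.  So \<open>s\<close> moves both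
  \<open>x\<close> and the distant \<open>g x\<close> little, contradicting acylindricity.  Hence the \<open>\<beta>\<^sub>i\<close> are
  jointly injective on \<open>\<rat>\<^sup>n\<close>, and as translation lengths are invariant under conjugation, every
  column of the modular matrix of an element of \<open>H\<close> has one of at most \<open>2\<^sup>r\<close> values, \<open>r\<close> being
  the number of factors.

  Conversely, if the monodromy is finite, its kernel has finite index and acts on \<open>\<rat>\<^sup>n\<close> by
  translations.  Its diagonal action on the Bass--Serre tree and \<open>n\<close> real lines is uniformly proper,
  so acylindrical, and base elements act loxodromically on some line.
\<close>

section \<open>Translation lengths in hyperbolic spaces\<close>

text \<open>An element of the base subgroup with zero translation length need not be elliptic: the
  factors are not proper, it may act parabolically with unbounded orbits, and no point need be moved
  little by infinitely many such elements. What survives is a bound for finite commuting sets that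
  depends on \<delta> alone. This dictates the order of choices: the displacement bound from the
  \<delta>'s, \<open>N\<close> and \<open>R\<close> from acylindricity, the power \<open>g\<close>
  from \<open>R\<close>, and only then \<open>N + 1\<close> elements with their conjugates, to which
  the same bound still applies.

  For the converse, neither the tree nor the lines alone would do: vertex groups fix vertices of the
  tree, and elements moving along the tree may translate by zero. Distances and finiteness in the
  tree are needed, while its vertices are given as cosets only. Normal forms supply both: a set of
  lists closed under prefixes carries an explicit metric, and the letters act on it by explicit
  rules.\<close>

lemma (in group) inv_cancel_left [simp]:
  assumes "x \<in> carrier G" "y \<in> carrier G"
  shows "inv x \<otimes> (x \<otimes> y) = y" "x \<otimes> (inv x \<otimes> y) = y"
  using assms by (simp_all add: m_assoc[symmetric])

lemma (in group) conj_pow: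
  assumes "g \<in> carrier G" "h \<in> carrier G"
  shows "(h \<otimes> g \<otimes> inv h) [^] (n::nat) = h \<otimes> g [^] n \<otimes> inv h"
proof (induction n)
  case (Suc n)
  have "(h \<otimes> g [^] n \<otimes> inv h) \<otimes> (h \<otimes> g \<otimes> inv h) = h \<otimes> g [^] n \<otimes> (inv h \<otimes> h) \<otimes> g \<otimes> inv h"
    using assms by (simp add: m_assoc)
  also have "\<dots> = h \<otimes> (g [^] n \<otimes> g) \<otimes> inv h"
    using assms by (simp add: m_assoc)
  finally show ?case using Suc by simp
qed (use assms in simp)

text \<open>The Gromov product inequality with its halves cleared. Only sums over opposite pairs
  remain, so any pairing of the four points can serve as diagonals and no base point is
  distinguished.\<close>

lemma four_point:
  assumes "Gromov_hyperbolic \<delta> X" "w \<in> mspace X" "x \<in> mspace X" "y \<in> mspace X" "z \<in> mspace X"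
  shows "mdist X x z + mdist X w y \<le>
    max (mdist X x y + mdist X z w) (mdist X y z + mdist X x w) + 2 * \<delta>"
proof -
  have "Gromov_product X w x z \<ge> min (Gromov_product X w x y) (Gromov_product X w y z) - \<delta>"
    using assms unfolding Gromov_hyperbolic_def by blast
  then show ?thesis
    unfolding Gromov_product_def
    by (simp add: min_def max_def mdist_commute field_simps split: if_splits)
qed

text \<open>The maps are constrained on \<open>mspace X\<close> only. The extensionality that
  \<open>Isom\<close> demands is supplied by \<open>restrict\<close> when an action in the sense of
  \<open>isometric_action\<close> is built.\<close>

locale isom_action = group G for G (structure) +
  fixes X :: "'x metric" and \<psi> :: "'a \<Rightarrow> 'x \<Rightarrow> 'x"
  assumes act_closed: "g \<in> carrier G \<Longrightarrow> x \<in> mspace X \<Longrightarrow> \<psi> g x \<in> mspace X"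
    and act_mult: "g \<in> carrier G \<Longrightarrow> h \<in> carrier G \<Longrightarrow> x \<in> mspace X \<Longrightarrow> \<psi> (g \<otimes> h) x = \<psi> g (\<psi> h x)"
    and act_one: "x \<in> mspace X \<Longrightarrow> \<psi> \<one> x = x"
    and act_isom: "g \<in> carrier G \<Longrightarrow> x \<in> mspace X \<Longrightarrow> y \<in> mspace X \<Longrightarrow>
      mdist X (\<psi> g x) (\<psi> g y) = mdist X x y"
    and nonempty: "mspace X \<noteq> {}"
begin

definition disp :: "'x \<Rightarrow> 'a \<Rightarrow> real" where
  "disp x g = mdist X x (\<psi> g x)"

text \<open>Along powers of two the quotients decrease, so that the limit exists.\<close>

definition tlen :: "'a \<Rightarrow> real" where
  "tlen g = lim (\<lambda>k. disp (SOME x. x \<in> mspace X) (g [^] (2 ^ k :: nat)) / 2 ^ k)"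

lemma disp_nonneg [simp]: "0 \<le> disp x g"
  by (simp add: disp_def)

lemma dist_act_act:
  assumes "g \<in> carrier G" "h \<in> carrier G" "x \<in> mspace X"
  shows "mdist X (\<psi> g x) (\<psi> h x) = disp x (inv g \<otimes> h)"
proof -
  have "mdist X (\<psi> g x) (\<psi> h x) = mdist X (\<psi> (inv g) (\<psi> g x)) (\<psi> (inv g) (\<psi> h x))"
    using assms by (simp add: act_isom act_closed)
  also have "\<dots> = disp x (inv g \<otimes> h)"
    using assms by (simp add: disp_def act_one flip: act_mult)
  finally show ?thesis .
qed

lemma disp_mult_le:
  assumes "g \<in> carrier G" "h \<in> carrier G" "x \<in> mspace X"
  shows "disp x (g \<otimes> h) \<le> disp x g + disp x h"
proof -
  have "mdist X x (\<psi> (g \<otimes> h) x) \<le> mdist X x (\<psi> g x) + mdist X (\<psi> g x) (\<psi> g (\<psi> h x))"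
    using assms by (simp add: act_mult act_closed mdist_triangle)
  then show ?thesis
    using assms by (simp add: disp_def act_isom act_closed)
qed

lemma disp_inv:
  assumes "g \<in> carrier G" "x \<in> mspace X"
  shows "disp x (inv g) = disp x g"
  using dist_act_act[of g \<one> x] assms by (simp add: act_one disp_def mdist_commute)

lemma disp_base_change:
  assumes "g \<in> carrier G" "x \<in> mspace X" "y \<in> mspace X"
  shows "disp x g \<le> disp y g + 2 * mdist X x y"
proof -
  have "mdist X x (\<psi> g x) \<le> mdist X x y + mdist X y (\<psi> g x)"
    using assms by (simp add: act_closed mdist_triangle)
  moreover have "mdist X y (\<psi> g x) \<le> mdist X y (\<psi> g y) + mdist X (\<psi> g y) (\<psi> g x)"
    using assms by (intro mdist_triangle) (simp_all add: act_closed)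
  moreover have "mdist X (\<psi> g y) (\<psi> g x) = mdist X x y"
    using assms by (simp add: act_isom mdist_commute)
  ultimately show ?thesis by (simp add: disp_def)
qed

lemma disp_pow_double:
  assumes "g \<in> carrier G" "x \<in> mspace X"
  shows "disp x (g [^] (2 ^ Suc k :: nat)) / 2 ^ Suc k \<le> disp x (g [^] (2 ^ k :: nat)) / 2 ^ k"
proof -
  have "g [^] (2 ^ Suc k :: nat) = g [^] (2 ^ k :: nat) \<otimes> g [^] (2 ^ k :: nat)"
    using assms by (simp add: nat_pow_mult mult_2)
  then show ?thesis
    using disp_mult_le[of "g [^] (2 ^ k :: nat)" "g [^] (2 ^ k :: nat)" x] assms
    by (simp add: field_simps)
qed

lemma disp_decseq:
  assumes "g \<in> carrier G" "x \<in> mspace X"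
  shows "decseq (\<lambda>k. disp x (g [^] (2 ^ k :: nat)) / 2 ^ k)"
  using disp_pow_double[OF assms] by (rule decseq_SucI)

text \<open>A change of base point alters every displacement by at most twice the distance of the
  two points, which vanishes after division by \<open>2 ^ k\<close>. Hence the point chosen in
  \<open>tlen\<close> does not matter.\<close>

lemma tlen_tendsto:
  assumes g: "g \<in> carrier G" and x: "x \<in> mspace X"
  shows "(\<lambda>k. disp x (g [^] (2 ^ k :: nat)) / 2 ^ k) \<longlonglongrightarrow> tlen g"
proof -
  let ?y = "SOME x. x \<in> mspace X"
  let ?f = "\<lambda>x k. disp x (g [^] (2 ^ k :: nat)) / 2 ^ k"
  have y: "?y \<in> mspace X" using nonempty some_in_eq by blast
  obtain l where "?f ?y \<longlonglongrightarrow> l"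
    by (rule decseq_convergent[OF disp_decseq[OF g y], of 0]) auto
  then have L: "?f ?y \<longlonglongrightarrow> tlen g"
    by (simp add: tlen_def limI)
  have "(\<lambda>k. 2 * mdist X x ?y * (1/2) ^ k) \<longlonglongrightarrow> 2 * mdist X x ?y * 0"
    by (intro tendsto_intros) auto
  then have z: "(\<lambda>k. 2 * mdist X x ?y * (1/2) ^ k) \<longlonglongrightarrow> 0" by simp
  have "(\<lambda>k. ?f x k - ?f ?y k) \<longlonglongrightarrow> 0"
  proof (rule Lim_null_comparison[OF _ z], intro always_eventually allI)
    fix k
    have "\<bar>disp x (g [^] (2 ^ k :: nat)) - disp ?y (g [^] (2 ^ k :: nat))\<bar> \<le> 2 * mdist X x ?y"
      using disp_base_change[of "g [^] (2 ^ k :: nat)" x ?y]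
        disp_base_change[of "g [^] (2 ^ k :: nat)" ?y x] g x y
      by (simp add: mdist_commute abs_le_iff)
    then have "\<bar>disp x (g [^] (2 ^ k :: nat)) - disp ?y (g [^] (2 ^ k :: nat))\<bar> / 2 ^ k \<le> 2 * mdist X x ?y / 2 ^ k"
      by (intro divide_right_mono) auto
    then show "norm (?f x k - ?f ?y k) \<le> 2 * mdist X x ?y * (1/2) ^ k"
      by (simp add: power_one_over abs_divide flip: diff_divide_distrib)
  qed
  from tendsto_add[OF this L] show ?thesis by simp
qed

text \<open>The quotients decrease, and the one at 0 is the displacement itself.\<close>

lemma tlen_le:
  assumes "g \<in> carrier G" "x \<in> mspace X"
  shows "tlen g \<le> disp x g"
  using decseq_ge[OF disp_decseq[OF assms] tlen_tendsto[OF assms], of 0] assms by simp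

lemma tlen_nonneg:
  assumes "g \<in> carrier G"
  shows "0 \<le> tlen g"
proof -
  obtain x where x: "x \<in> mspace X" using nonempty by blast
  show ?thesis
    by (rule LIMSEQ_le_const[OF tlen_tendsto[OF assms x]]) auto
qed

lemma disp_conj:
  assumes "g \<in> carrier G" "h \<in> carrier G" "x \<in> mspace X"
  shows "disp x (h \<otimes> g \<otimes> inv h) = disp (\<psi> (inv h) x) g"
proof -
  have "disp x (h \<otimes> g \<otimes> inv h) = mdist X (\<psi> (inv h) x) (\<psi> (inv h) (\<psi> (h \<otimes> g \<otimes> inv h) x))"
    using assms by (simp add: disp_def act_isom act_closed)
  also have "\<psi> (inv h) (\<psi> (h \<otimes> g \<otimes> inv h) x) = \<psi> g (\<psi> (inv h) x)"
    using assms by (simp flip: act_mult add: m_assoc)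
  finally show ?thesis by (simp add: disp_def)
qed

lemma tlen_conj:
  assumes "g \<in> carrier G" "h \<in> carrier G"
  shows "tlen (h \<otimes> g \<otimes> inv h) = tlen g"
proof -
  obtain x where x: "x \<in> mspace X" using nonempty by blast
  have "(\<lambda>k. disp (\<psi> (inv h) x) (g [^] (2 ^ k :: nat)) / 2 ^ k) \<longlonglongrightarrow> tlen (h \<otimes> g \<otimes> inv h)"
    using tlen_tendsto[OF _ x, of "h \<otimes> g \<otimes> inv h"] assms
    by (simp add: conj_pow disp_conj x)
  moreover have "(\<lambda>k. disp (\<psi> (inv h) x) (g [^] (2 ^ k :: nat)) / 2 ^ k) \<longlonglongrightarrow> tlen g"
    using assms x by (intro tlen_tendsto) (auto simp: act_closed)
  ultimately show ?thesis by (rule LIMSEQ_unique)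
qed

lemma tlen_inv:
  assumes "g \<in> carrier G"
  shows "tlen (inv g) = tlen g"
proof -
  obtain x where x: "x \<in> mspace X" using nonempty by blast
  have "(\<lambda>k. disp x (g [^] (2 ^ k :: nat)) / 2 ^ k) \<longlonglongrightarrow> tlen (inv g)"
    using tlen_tendsto[OF inv_closed x] assms
    by (simp add: nat_pow_inv disp_inv x)
  then show ?thesis using tlen_tendsto[OF assms x] LIMSEQ_unique by blast
qed

lemma tlen_double:
  assumes "g \<in> carrier G"
  shows "tlen (g \<otimes> g) = 2 * tlen g"
proof -
  obtain x where x: "x \<in> mspace X" using nonempty by blast
  have eq: "(g \<otimes> g) [^] (2 ^ k :: nat) = g [^] (2 ^ Suc k :: nat)" for k
    using assms nat_pow_pow[of g 2 "2 ^ k"] by (simp add: numeral_2_eq_2)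
  have "(\<lambda>k. 2 * (disp x (g [^] (2 ^ Suc k :: nat)) / 2 ^ Suc k)) \<longlonglongrightarrow> 2 * tlen g"
    by (intro tendsto_intros LIMSEQ_Suc[OF tlen_tendsto[OF assms x]])
  then have "(\<lambda>k. disp x ((g \<otimes> g) [^] (2 ^ k :: nat)) / 2 ^ k) \<longlonglongrightarrow> 2 * tlen g"
    unfolding eq by simp
  then show ?thesis
    using tlen_tendsto[OF _ x, of "g \<otimes> g"] assms LIMSEQ_unique by blast
qed

text \<open>This makes some power of a loxodromic element translate by any prescribed amount; powers
  of two are those that the defining limit controls directly.\<close>

lemma tlen_pow2:
  assumes "g \<in> carrier G"
  shows "tlen (g [^] (2 ^ k :: nat)) = 2 ^ k * tlen g"
proof (induction k)
  case (Suc k)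
  have "g [^] (2 ^ Suc k :: nat) = g [^] (2 ^ k :: nat) \<otimes> g [^] (2 ^ k :: nat)"
    using assms by (simp add: nat_pow_mult mult_2)
  then show ?case using tlen_double[of "g [^] (2 ^ k :: nat)"] Suc assms by simp
qed (use assms in simp)

lemma tlen_mult_le:
  assumes g: "g \<in> carrier G" and h: "h \<in> carrier G" and c: "g \<otimes> h = h \<otimes> g"
  shows "tlen (g \<otimes> h) \<le> tlen g + tlen h"
proof -
  obtain x where x: "x \<in> mspace X" using nonempty by blast
  have gh: "g \<otimes> h \<in> carrier G" using g h by simp
  show ?thesis
  proof (rule LIMSEQ_le[OF tlen_tendsto[OF gh x] tendsto_add[OF tlen_tendsto[OF g x] tlen_tendsto[OF h x]]],
      intro exI allI impI)
    fix k :: nat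
    show "disp x ((g \<otimes> h) [^] (2 ^ k :: nat)) / 2 ^ k
      \<le> disp x (g [^] (2 ^ k :: nat)) / 2 ^ k + disp x (h [^] (2 ^ k :: nat)) / 2 ^ k"
      using disp_mult_le[of "g [^] (2 ^ k :: nat)" "h [^] (2 ^ k :: nat)" x] g h x
      by (simp add: pow_mult_distrib[OF c g h] add_divide_distrib[symmetric] divide_right_mono)
  qed
qed

text \<open>The four point condition for the parallelogram \<open>x, g x, g h x, h x\<close>.\<close>

lemma disp_parallelogram:
  assumes hyp: "Gromov_hyperbolic \<delta> X"
    and g: "g \<in> carrier G" and h: "h \<in> carrier G" and c: "g \<otimes> h = h \<otimes> g" and x: "x \<in> mspace X"
  shows "disp x (g \<otimes> h) + disp x (inv h \<otimes> g) \<le> 2 * max (disp x g) (disp x h) + 2 * \<delta>"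
    and "2 * disp x g \<le> max (2 * disp x h) (disp x (g \<otimes> h) + disp x (inv h \<otimes> g)) + 2 * \<delta>"
proof -
  let ?a = "\<psi> g x" and ?b = "\<psi> h x" and ?c = "\<psi> (g \<otimes> h) x"
  have in_X: "?a \<in> mspace X" "?b \<in> mspace X" "?c \<in> mspace X"
    using g h x by (auto simp: act_closed)
  have ac: "mdist X ?a ?c = disp x h"
    using g h x by (simp add: dist_act_act)
  have bc: "mdist X ?b ?c = disp x g"
    using g h x by (simp add: dist_act_act c)
  have ba: "mdist X ?b ?a = disp x (inv h \<otimes> g)"
    using g h x by (simp add: dist_act_act)
  note d = ac bc ba mdist_commute[of X ?c ?a] mdist_commute[of X ?c ?b] mdist_commute[of X ?a ?b]
    mdist_commute[of X ?a x] mdist_commute[of X ?b x] mdist_commute[of X ?c x]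
  show "disp x (g \<otimes> h) + disp x (inv h \<otimes> g) \<le> 2 * max (disp x g) (disp x h) + 2 * \<delta>"
    using four_point[OF hyp in_X(1) x in_X(2) in_X(3)] unfolding d
    by (auto simp add: disp_def[symmetric] max_def split: if_splits)
  show "2 * disp x g \<le> max (2 * disp x h) (disp x (g \<otimes> h) + disp x (inv h \<otimes> g)) + 2 * \<delta>"
    using four_point[OF hyp in_X(3) x in_X(2) in_X(1)] unfolding d
    by (auto simp add: disp_def[symmetric] max_def split: if_splits)
qed

text \<open>The powers of \<open>g\<close> and \<open>h\<close> with exponent \<open>2 ^ k\<close>
  span parallelograms as well, and division by \<open>2 ^ k\<close> makes the additive error vanish
  in the limit.\<close>

lemma tlen_parallelogram:
  assumes hyp: "Gromov_hyperbolic \<delta> X"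
    and g: "g \<in> carrier G" and h: "h \<in> carrier G" and c: "g \<otimes> h = h \<otimes> g"
  shows "tlen (g \<otimes> h) + tlen (inv h \<otimes> g) \<le> 2 * max (tlen g) (tlen h)"
    and "2 * tlen g \<le> max (2 * tlen h) (tlen (g \<otimes> h) + tlen (inv h \<otimes> g))"
proof -
  obtain x where x: "x \<in> mspace X" using nonempty by blast
  define F where "F = (\<lambda>u k. disp x (u [^] (2 ^ k :: nat)) / 2 ^ k)"
  have F: "F u \<longlonglongrightarrow> tlen u" if "u \<in> carrier G" for u
    using tlen_tendsto[OF that x] by (simp add: F_def)
  have z: "(\<lambda>k. 2 * \<delta> * (1/2) ^ k) \<longlonglongrightarrow> 0"
    using tendsto_mult[OF tendsto_const[of "2 * \<delta>"] LIMSEQ_power_zero[of "1/2::real"]] by simp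
  have ic: "inv h \<otimes> g = g \<otimes> inv h"
    using g h c by (metis inv_solve_left inv_solve_right m_closed m_assoc inv_closed)
  have pw: "(g \<otimes> h) [^] n = g [^] n \<otimes> h [^] n" "(inv h \<otimes> g) [^] n = inv (h [^] n) \<otimes> g [^] n"
    "g [^] n \<otimes> h [^] n = h [^] n \<otimes> g [^] n" for n :: nat
  proof -
    show "(g \<otimes> h) [^] n = g [^] n \<otimes> h [^] n" using pow_mult_distrib[OF c g h] .
    show "(inv h \<otimes> g) [^] n = inv (h [^] n) \<otimes> g [^] n"
      using pow_mult_distrib[OF ic inv_closed[OF h] g] h by (simp add: nat_pow_inv)
    show "g [^] n \<otimes> h [^] n = h [^] n \<otimes> g [^] n"
      using pow_mult_distrib[OF c g h] pow_mult_distrib[OF c[symmetric] h g] c by metis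
  qed
  have 1: "F (g \<otimes> h) k + F (inv h \<otimes> g) k \<le> 2 * max (F g k) (F h k) + 2 * \<delta> * (1/2) ^ k"
    and 2: "2 * F g k \<le> max (2 * F h k) (F (g \<otimes> h) k + F (inv h \<otimes> g) k) + 2 * \<delta> * (1/2) ^ k" for k
  proof -
    note d = disp_parallelogram[OF hyp _ _ pw(3)[of "2 ^ k"] x]
    show "F (g \<otimes> h) k + F (inv h \<otimes> g) k \<le> 2 * max (F g k) (F h k) + 2 * \<delta> * (1/2) ^ k"
      using divide_right_mono[OF d(1), of "2 ^ k"] g h
      by (simp only: F_def pw max_divide_distrib_right[of "2 ^ k", symmetric] power_one_over)
        (simp add: add_divide_distrib max_divide_distrib_right)
    show "2 * F g k \<le> max (2 * F h k) (F (g \<otimes> h) k + F (inv h \<otimes> g) k) + 2 * \<delta> * (1/2) ^ k"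
      using divide_right_mono[OF d(2), of "2 ^ k"] g h
      by (simp add: F_def pw(1,2) add_divide_distrib max_divide_distrib_right power_one_over)
  qed
  show "tlen (g \<otimes> h) + tlen (inv h \<otimes> g) \<le> 2 * max (tlen g) (tlen h)"
  proof -
    have l: "(\<lambda>k. F (g \<otimes> h) k + F (inv h \<otimes> g) k) \<longlonglongrightarrow> tlen (g \<otimes> h) + tlen (inv h \<otimes> g)"
      using g h by (intro tendsto_intros F) auto
    have r: "(\<lambda>k. 2 * max (F g k) (F h k) + 2 * \<delta> * (1/2) ^ k) \<longlonglongrightarrow> 2 * max (tlen g) (tlen h) + 0"
      using g h by (intro tendsto_intros z tendsto_max F) auto
    show ?thesis using LIMSEQ_le[OF l r] 1 by auto
  qed
  show "2 * tlen g \<le> max (2 * tlen h) (tlen (g \<otimes> h) + tlen (inv h \<otimes> g))"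
  proof -
    have l: "(\<lambda>k. 2 * F g k) \<longlonglongrightarrow> 2 * tlen g"
      using g h by (intro tendsto_intros F) auto
    have r: "(\<lambda>k. max (2 * F h k) (F (g \<otimes> h) k + F (inv h \<otimes> g) k) + 2 * \<delta> * (1/2) ^ k)
       \<longlonglongrightarrow> max (2 * tlen h) (tlen (g \<otimes> h) + tlen (inv h \<otimes> g)) + 0"
      using g h by (intro tendsto_intros z tendsto_max F) auto
    show ?thesis using LIMSEQ_le[OF l r] 2 by auto
  qed
qed

text \<open>If the bound failed, the displacements of successive powers would grow by more than
  \<open>tlen g\<close> at every step, although \<open>tlen g\<close> is their rate of
  growth.\<close>

lemma disp_square_le:
  assumes hyp: "Gromov_hyperbolic \<delta> X" and g: "g \<in> carrier G" and x: "x \<in> mspace X"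
  shows "disp x (g \<otimes> g) \<le> disp x g + tlen g + 2 * \<delta>"
proof (rule ccontr)
  define \<eta> where "\<eta> = disp x (g \<otimes> g) - disp x g - 2 * \<delta>"
  define a where "a n = disp x (g [^] (n::nat))" for n
  assume "\<not> ?thesis"
  then have \<eta>: "\<eta> > tlen g" by (simp add: \<eta>_def)
  then have "\<eta> > 0" using tlen_nonneg[OF g] by simp
  \<comment> \<open>The four points are x, g x, g^2 x and g^(n+2) x. As \<eta> is positive, once
    \<open>a (Suc n)\<close> exceeds \<open>a n\<close> the maximum can only be
    \<open>a (Suc (Suc n))\<close>, which drives the induction in \<open>inc\<close>.\<close>
  have step: "a (Suc n) + \<eta> \<le> max (a n) (a (Suc (Suc n)))" for n
  proof -
    have "mdist X (\<psi> g x) (\<psi> (g [^] Suc (Suc n)) x) = a (Suc n)"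
      using dist_act_act[of g "g [^] Suc (Suc n)" x] g x
      by (simp only: a_def nat_pow_Suc2[of g "Suc n"] inv_cancel_left nat_pow_closed m_closed simp_thms)
    moreover have "mdist X (\<psi> (g \<otimes> g) x) (\<psi> (g [^] Suc (Suc n)) x) = a n"
    proof -
      have "inv (g \<otimes> g) \<otimes> g [^] Suc (Suc n) = inv (g \<otimes> g) \<otimes> ((g \<otimes> g) \<otimes> g [^] n)"
        using g by (metis nat_pow_Suc2 m_assoc nat_pow_closed)
      also have "\<dots> = g [^] n" using g by simp
      finally show ?thesis
        using dist_act_act[of "g \<otimes> g" "g [^] Suc (Suc n)" x] g x by (simp add: a_def)
    qed
    moreover have "mdist X (\<psi> g x) (\<psi> (g \<otimes> g) x) = disp x g"
      using dist_act_act[of g "g \<otimes> g" x] g x by simp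
    moreover have "mdist X x (\<psi> (g [^] Suc (Suc n)) x) = a (Suc (Suc n))"
      by (simp add: a_def disp_def)
    ultimately show ?thesis
      using four_point[OF hyp act_closed[OF g x] x act_closed[of "g [^] Suc (Suc n)" x]
          act_closed[of "g \<otimes> g" x]] g x
      using four_point[OF hyp act_closed[of "g [^] Suc (Suc n)" x] x act_closed[OF g x]
          act_closed[of "g \<otimes> g" x]]
      by (simp add: \<eta>_def disp_def[symmetric] mdist_commute max_def split: if_splits)
  qed
  have inc: "a (Suc n) \<ge> a n + \<eta>" for n
  proof (induction n)
    case 0
    have "a 0 = 0" using x g by (simp add: a_def disp_def act_one)
    \<comment> \<open>Four equal points in \<open>four_point\<close> yield \<delta> \<ge> 0.\<close>
    moreover have "a 1 \<ge> \<eta>"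
      using disp_mult_le[OF g g x] four_point[OF hyp x x x x] x g by (simp add: a_def \<eta>_def)
    ultimately show ?case by simp
  next
    case (Suc n)
    then show ?case using step[of n] \<open>\<eta> > 0\<close> by (auto simp: max_def split: if_splits)
  qed
  have lin: "a n \<ge> n * \<eta>" for n
  proof (induction n)
    case (Suc n)
    then show ?case using inc[of n] by (simp add: algebra_simps)
  qed (simp add: a_def)
  have "\<eta> \<le> tlen g"
  proof (rule LIMSEQ_le_const[OF tlen_tendsto[OF g x]], intro exI allI impI)
    fix k :: nat
    show "\<eta> \<le> disp x (g [^] (2 ^ k :: nat)) / 2 ^ k"
      using lin[of "2 ^ k"] by (simp add: a_def field_simps)
  qed
  then show False using \<eta> by simp
qed

text \<open>Put r = 4 * \<delta> + 1. If \<open>t\<close> moves \<open>x\<close> much less than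
  \<open>s\<close> does, a step of length r adds at most 2 r. Otherwise the vanishing translation
  lengths force t x and t^-1 x to lie roughly in the direction of s x, so the step towards s x
  shortens both d(y, t x) and d(x, t y) by about r, hence the displacement of \<open>t\<close> by
  about 2 r. The four point conditions lose 6 * \<delta> in total, and 2 r exceeds this by at least
  2. The threshold 20 * \<delta> + 6 keeps \<open>disp x t\<close> above 2 r + 3 * \<delta> in this
  case.\<close>

lemma disp_along_geodesic_le:
  assumes hyp: "Gromov_hyperbolic \<delta> X" and "\<delta> \<ge> 0"
    and x: "x \<in> mspace X" and y: "y \<in> mspace X"
    and s: "s \<in> carrier G" and t: "t \<in> carrier G" and c: "s \<otimes> t = t \<otimes> s"
    and tl: "tlen s = 0" "tlen t = 0"
    and le: "disp x t \<le> disp x s" and large: "disp x s > 20 * \<delta> + 6"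
    and xy: "mdist X x y = 4 * \<delta> + 1" and ysx: "mdist X y (\<psi> s x) = disp x s - (4 * \<delta> + 1)"
  shows "disp y t \<le> disp x s - 2"
proof (cases "disp x t \<le> disp x s - 2 * (4 * \<delta> + 1) - 2")
  case True
  then show ?thesis
    using disp_base_change[OF t y x] xy by (simp add: mdist_commute)
next
  case False
  let ?r = "4 * \<delta> + 1"
  have ci: "inv t \<otimes> s = s \<otimes> inv t"
    using s t c by (metis inv_solve_left inv_solve_right m_closed m_assoc inv_closed)
  have st: "s \<otimes> t \<in> carrier G" and its: "inv t \<otimes> s \<in> carrier G" using s t by auto
  have prods: "(s \<otimes> t) \<otimes> (inv t \<otimes> s) = s \<otimes> s" "(inv t \<otimes> s) \<otimes> (s \<otimes> t) = s \<otimes> s"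
      "inv (inv t \<otimes> s) \<otimes> (s \<otimes> t) = t \<otimes> t" "inv (s \<otimes> t) \<otimes> (inv t \<otimes> s) = inv (t \<otimes> t)"
  proof -
    show "(s \<otimes> t) \<otimes> (inv t \<otimes> s) = s \<otimes> s" using s t by (simp add: m_assoc)
    have "(inv t \<otimes> s) \<otimes> (s \<otimes> t) = s \<otimes> (inv t \<otimes> (t \<otimes> s))"
      using s t by (simp add: ci c m_assoc)
    then show "(inv t \<otimes> s) \<otimes> (s \<otimes> t) = s \<otimes> s" using s t by simp
    show "inv (inv t \<otimes> s) \<otimes> (s \<otimes> t) = t \<otimes> t"
    proof -
      have "inv (inv t \<otimes> s) \<otimes> (s \<otimes> t) = inv s \<otimes> (t \<otimes> s \<otimes> t)"
        using s t by (simp add: inv_mult_group m_assoc)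
      also have "\<dots> = t \<otimes> t" using s t by (simp add: m_assoc flip: c)
      finally show ?thesis .
    qed
    then show "inv (s \<otimes> t) \<otimes> (inv t \<otimes> s) = inv (t \<otimes> t)"
      using s t inv_mult_group[of "inv (inv t \<otimes> s)" "s \<otimes> t"] by simp
  qed
  have c': "(s \<otimes> t) \<otimes> (inv t \<otimes> s) = (inv t \<otimes> s) \<otimes> (s \<otimes> t)" by (simp only: prods)
  have sq: "disp x (s \<otimes> s) \<le> disp x s + 2 * \<delta>" "disp x (t \<otimes> t) \<le> disp x t + 2 * \<delta>"
    using disp_square_le[OF hyp _ x] s t tl by force+
  have p: "disp x (s \<otimes> t) + disp x (inv t \<otimes> s) \<le> 2 * disp x s + 2 * \<delta>"
    using disp_parallelogram(1)[OF hyp s t c x] le by (simp add: max_def split: if_splits)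
  \<comment> \<open>The parallelogram with sides s t and t^-1 s has the diagonals s^2 and t^2, and
    these are short by \<open>sq\<close>, where the vanishing of \<open>tlen\<close> enters.\<close>
  have q: "2 * disp x (s \<otimes> t) \<le> max (2 * disp x (inv t \<otimes> s)) (disp x (s \<otimes> s) + disp x (t \<otimes> t)) + 2 * \<delta>"
    using disp_parallelogram(2)[OF hyp st its c' x] by (simp only: prods)
  have q': "2 * disp x (inv t \<otimes> s) \<le> max (2 * disp x (s \<otimes> t)) (disp x (s \<otimes> s) + disp x (t \<otimes> t)) + 2 * \<delta>"
    using disp_parallelogram(2)[OF hyp its st c'[symmetric] x] t
    by (simp only: prods disp_inv x m_closed)
  have D: "disp x (s \<otimes> t) \<le> disp x s + 3 * \<delta>" "disp x (inv t \<otimes> s) \<le> disp x s + 3 * \<delta>"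
    using p q q' sq le \<open>\<delta> \<ge> 0\<close> by (auto simp: max_def split: if_splits)
  have in_X: "\<psi> s x \<in> mspace X" "\<psi> t x \<in> mspace X" "\<psi> (inv t) x \<in> mspace X" "\<psi> t y \<in> mspace X"
    using s t x y by (auto simp: act_closed)
  have e1: "mdist X (\<psi> s x) (\<psi> t x) = disp x (inv t \<otimes> s)"
    using dist_act_act[OF t s x] by (simp add: mdist_commute)
  have e2: "mdist X (\<psi> s x) (\<psi> (inv t) x) = disp x (s \<otimes> t)"
    using dist_act_act[of "inv t" s x] s t x c by (simp add: mdist_commute)
  have e3: "mdist X x (\<psi> t x) = disp x t" "mdist X x (\<psi> (inv t) x) = disp x t" "mdist X x (\<psi> s x) = disp x s"
    using disp_inv[OF t x] by (simp_all add: disp_def)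
  have e4: "mdist X y (\<psi> (inv t) x) = mdist X x (\<psi> t y)"
    using act_isom[OF t y in_X(3)] t x by (simp add: mdist_commute act_one flip: act_mult)
  have e5: "mdist X (\<psi> t x) (\<psi> t y) = ?r" using act_isom[OF t x y] xy by simp
  \<comment> \<open>Since \<open>y\<close> lies on a geodesic from x to s x, the first alternative
    of the maximum is the claim; by \<open>D\<close> and the lower bound on \<open>disp x t\<close>
    the second alternative is no larger.\<close>
  have y1: "mdist X y (\<psi> t x) \<le> disp x t - ?r + 2 * \<delta>"
    using four_point[OF hyp x y in_X(1) in_X(2)] ysx xy D False large e1 e3 \<open>\<delta> \<ge> 0\<close>
    by (simp add: max_def mdist_commute split: if_splits)
  have y2: "mdist X x (\<psi> t y) \<le> disp x t - ?r + 2 * \<delta>"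
    using four_point[OF hyp x y in_X(1) in_X(3)] ysx xy D False large e2 e3 e4 \<open>\<delta> \<ge> 0\<close>
    by (simp add: max_def mdist_commute split: if_splits)
  \<comment> \<open>The quadrilateral x, y, t y, t x. If its two sides of length r realize the
    maximum, the lower bound on \<open>disp x t\<close> already gives the claim; otherwise
    \<open>y1\<close> and \<open>y2\<close> do.\<close>
  have "mdist X y (\<psi> t y) + mdist X (\<psi> t x) x \<le>
      max (mdist X y x + mdist X (\<psi> t y) (\<psi> t x)) (mdist X x (\<psi> t y) + mdist X y (\<psi> t x)) + 2 * \<delta>"
    by (rule four_point[OF hyp in_X(2) y x in_X(4)])
  then have "disp y t + disp x t \<le> max (2 * ?r) (mdist X y (\<psi> t x) + mdist X x (\<psi> t y)) + 2 * \<delta>"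
    using e5 xy by (simp only: disp_def mdist_commute[of X "\<psi> t x" x] mdist_commute[of X y x]
        mdist_commute[of X "\<psi> t y" "\<psi> t x"] mult_2 add.commute[of "mdist X x (\<psi> t y)"])
  then show ?thesis
    using y1 y2 False large le \<open>\<delta> \<ge> 0\<close> by (simp add: max_def split: if_splits)
qed

text \<open>At an almost minimal point of the maximal displacement of \<open>S\<close>, moving a fixed distance along
  a geodesic towards a farthest translate would decrease that displacement if it were large.\<close>

lemma small_common_displacement:
  assumes hyp: "Gromov_hyperbolic \<delta> X" and "\<delta> \<ge> 0" and geo: "geodesic_space X"
    and S: "finite S" "S \<subseteq> carrier G"
    and c: "\<And>s t. s \<in> S \<Longrightarrow> t \<in> S \<Longrightarrow> s \<otimes> t = t \<otimes> s"
    and tl: "\<And>s. s \<in> S \<Longrightarrow> tlen s = 0"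
  shows "\<exists>x\<in>mspace X. \<forall>s\<in>S. disp x s \<le> 20 * \<delta> + 6"
proof (cases "S = {}")
  case True
  then show ?thesis using nonempty by auto
next
  case False
  define D where "D x = Max ((\<lambda>s. disp x s) ` S)" for x
  have D_ge: "disp x s \<le> D x" if "s \<in> S" for x s
    unfolding D_def using S that by (intro Max_ge) auto
  have D_at: "\<exists>s\<in>S. D x = disp x s" for x
    using Max_in[of "(\<lambda>s. disp x s) ` S"] S(1) False unfolding D_def by blast
  have D_nonneg: "0 \<le> D x" for x using D_at[of x] by auto
  define L where "L = Inf (D ` mspace X)"
  have bdd: "bdd_below (D ` mspace X)" using D_nonneg by (intro bdd_belowI[of _ 0]) auto
  have L_le: "L \<le> D y" if "y \<in> mspace X" for y
    unfolding L_def using that bdd by (intro cInf_lower) auto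
  have "\<exists>d\<in>D ` mspace X. d < L + 1"
    using cInf_lessD[of "D ` mspace X" "L + 1"] nonempty by (auto simp: L_def)
  then obtain x where x: "x \<in> mspace X" "D x < L + 1" by auto
  have "D x \<le> 20 * \<delta> + 6"
  proof (rule ccontr)
    assume big: "\<not> D x \<le> 20 * \<delta> + 6"
    obtain s where s: "s \<in> S" "D x = disp x s" using D_at by blast
    have large: "disp x s > 20 * \<delta> + 6" using big s by simp
    have sG: "s \<in> carrier G" using s S by auto
    obtain \<gamma> where \<gamma>: "\<gamma> ` {0..disp x s} \<subseteq> mspace X" "\<gamma> 0 = x" "\<gamma> (disp x s) = \<psi> s x"
      "\<And>u v. u \<in> {0..disp x s} \<Longrightarrow> v \<in> {0..disp x s} \<Longrightarrow> mdist X (\<gamma> u) (\<gamma> v) = \<bar>u - v\<bar>"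
      using geo x act_closed[OF sG x(1)] unfolding geodesic_space_def disp_def by metis
    define y where "y = \<gamma> (4 * \<delta> + 1)"
    have I: "0 \<in> {0..disp x s}" "4 * \<delta> + 1 \<in> {0..disp x s}" "disp x s \<in> {0..disp x s}"
      using large \<open>\<delta> \<ge> 0\<close> by auto
    have y: "y \<in> mspace X" "mdist X x y = 4 * \<delta> + 1" "mdist X y (\<psi> s x) = disp x s - (4 * \<delta> + 1)"
      using \<gamma>(1) I \<gamma>(4)[OF I(1,2)] \<gamma>(4)[OF I(2,3)] \<open>\<delta> \<ge> 0\<close>
      by (auto simp: y_def \<gamma>(2,3))
    obtain t where t: "t \<in> S" "D y = disp y t" using D_at by blast
    have "disp y t \<le> disp x s - 2"
      using disp_along_geodesic_le[OF hyp \<open>\<delta> \<ge> 0\<close> x(1) y(1) sG, of t] t(1) S c[of s t] s tl D_ge[of t x] large y(2,3)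
      by auto
    \<comment> \<open>The gain of 2 exceeds the tolerance 1 with which \<open>x\<close> approximates
      the infimum \<open>L\<close>.\<close>
    then show False using L_le[OF y(1)] x s t by simp
  qed
  then show ?thesis using x(1) D_ge order_trans by blast
qed

end

text \<open>A function \<open>f\<close> satisfying the two inequalities satisfies \<open>f (x + y), f (x - y) \<in> {f x + f y, \<bar>f x - f y\<bar>}\<close>,
  so that \<open>f\<^sup>2\<close> obeys the parallelogram law; \<open>\<beta>\<close> is obtained by polarization.\<close>

lemma abs_additive_of_parallelogram:
  fixes f :: "'a::ab_group_add \<Rightarrow> real"
  assumes f_nonneg: "\<And>x. 0 \<le> f x" and f_minus: "\<And>x. f (- x) = f x" and f_double: "\<And>x. f (x + x) = 2 * f x"
    and f_sub: "\<And>x y. f (x + y) \<le> f x + f y"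
    and p1: "\<And>x y. f (x + y) + f (x - y) \<le> 2 * max (f x) (f y)"
    and p2: "\<And>x y. 2 * f x \<le> max (2 * f y) (f (x + y) + f (x - y))"
  obtains \<beta> :: "'a \<Rightarrow> real" where "\<And>x y. \<beta> (x + y) = \<beta> x + \<beta> y" "\<And>x. f x = \<bar>\<beta> x\<bar>"
proof -
  have f_diff: "f (x - y) \<le> f x + f y" for x y using f_sub[of x "- y"] f_minus[of y] by simp
  have f_swap: "f (x - y) = f (y - x)" for x y using f_minus[of "x - y"] by simp
  \<comment> \<open>The lower bound is \<open>p1\<close> for x + y and x - y, whose sum and
    difference are 2 x and 2 y.\<close>
  have big: "max (f (x + y)) (f (x - y)) = f x + f y" for x y
  proof -
    have e: "(x + y) + (x - y) = x + x" "(x + y) - (x - y) = y + y" "(x - y) + (x + y) = x + x"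
      "(x - y) - (x + y) = - (y + y)" by (simp_all add: algebra_simps)
    show ?thesis
      using p1[of "x + y" "x - y"] f_sub[of x y] f_diff[of x y]
      unfolding e f_double f_minus by (simp add: max_def split: if_splits)
  qed
  have sum: "f (x + y) + f (x - y) = 2 * max (f x) (f y)" for x y
    using p1[of x y] p2[of x y] p2[of y x] big[of x y] f_nonneg[of x] f_nonneg[of y] f_nonneg[of "x + y"] f_nonneg[of "x - y"] f_sub[of x y] f_diff[of x y]
    unfolding add.commute[of y x] f_swap[of y x]
    by (simp add: max_def split: if_splits)
  have cases: "f (x + y) = f x + f y \<and> f (x - y) = \<bar>f x - f y\<bar> \<or> f (x - y) = f x + f y \<and> f (x + y) = \<bar>f x - f y\<bar>" for x y
    using big[of x y] sum[of x y] by (simp add: max_def split: if_splits)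
  define q where "q x = (f x)\<^sup>2" for x
  have par: "q (x + y) + q (x - y) = 2 * q x + 2 * q y" for x y
    using cases[of x y] unfolding q_def by (auto simp: power2_eq_square algebra_simps)
  have q0: "q 0 = 0" using f_double[of 0] by (simp add: q_def)
  have qm: "q (- x) = q x" for x by (simp add: q_def f_minus)
  define b where "b x y = q (x + y) - q (x - y)" for x y
  \<comment> \<open>As in the Jordan-von Neumann theorem: \<open>A\<close> is the parallelogram law
    taken at x + z and at x - z, and additivity follows by adding \<open>A\<close> to its version
    with \<open>x\<close> and \<open>y\<close> exchanged.\<close>
  have b_add: "b (x + y) z = b x z + b y z" for x y z
  proof -
    have A: "b (x + y) z + b (x - y) z = 2 * b x z" for x y
    proof -
      have "q ((x + z) + y) + q ((x + z) - y) = 2 * q (x + z) + 2 * q y"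
        "q ((x - z) + y) + q ((x - z) - y) = 2 * q (x - z) + 2 * q y"
        by (rule par)+
      moreover have "(x + z) + y = (x + y) + z" "(x + z) - y = (x - y) + z"
        "(x - z) + y = (x + y) - z" "(x - z) - y = (x - y) - z" by (simp_all add: algebra_simps)
      ultimately show ?thesis unfolding b_def by simp
    qed
    have b0: "b 0 z = 0" unfolding b_def by (simp add: qm)
    have neg: "b (- y) z = - b y z" for y using A[of 0 y] b0 by simp
    have "b (x + y) z + b (x - y) z = 2 * b x z" by (rule A)
    moreover have "b (y + x) z + b (y - x) z = 2 * b y z" by (rule A)
    moreover have "b (y - x) z = - b (x - y) z" using neg[of "x - y"] by simp
    ultimately show ?thesis by (simp add: add.commute)
  qed
  show ?thesis
  proof (cases "\<forall>x. f x = 0")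
    case True
    then show ?thesis by (intro that[of "\<lambda>_. 0"]) auto
  next
    case False
    then obtain z where z: "f z > 0" using f_nonneg by (metis order_le_less)
    show ?thesis
    \<comment> \<open>By \<open>cases\<close>, \<open>b x z\<close> is 4 f x f z up to sign, so
      division by 4 f z at some z with f z > 0 leaves f x up to sign.\<close>
    proof (rule that[of "\<lambda>x. b x z / (4 * f z)"])
      show "b (x + y) z / (4 * f z) = b x z / (4 * f z) + b y z / (4 * f z)" for x y
        by (simp add: b_add add_divide_distrib)
      show "f x = \<bar>b x z / (4 * f z)\<bar>" for x
      proof -
        have "b x z = 4 * f x * f z \<or> b x z = - (4 * f x * f z)"
          using cases[of x z] unfolding b_def q_def by (auto simp: power2_eq_square algebra_simps)
        then have "\<bar>b x z\<bar> = 4 * f x * f z" using f_nonneg z by (auto simp: abs_mult)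
        then show ?thesis using z by (simp add: abs_divide)
      qed
    qed
  qed
qed

section \<open>Realization of a rooted tree\<close>

text \<open>Length of the longest common prefix: in a rooted tree, the height at which the paths
  from the root to two vertices part.\<close>

fun lcp :: "'a list \<Rightarrow> 'a list \<Rightarrow> nat" where
  "lcp (x # xs) (y # ys) = (if x = y then Suc (lcp xs ys) else 0)"
| "lcp _ _ = 0"

lemma lcp_Nil [simp]: "lcp [] q = 0" "lcp p [] = 0"
  by (cases q; simp) (cases p; simp)

lemma lcp_commute: "lcp p q = lcp q p"
  by (induction p q rule: lcp.induct) auto

lemma lcp_le_length: "lcp p q \<le> length p" "lcp p q \<le> length q"
  by (induction p q rule: lcp.induct) auto

lemma lcp_self [simp]: "lcp p p = length p"
  by (induction p) auto

lemma lcp_take: "lcp (take k p) q = min k (lcp p q)"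
proof (induction p q arbitrary: k rule: lcp.induct)
  case (1 x xs y ys)
  then show ?case by (cases k) auto
qed auto

text \<open>Agreement of initial segments is transitive. The hyperbolicity of the tree rests on this
  ultrametric inequality.\<close>

lemma lcp_ultra: "min (lcp p q) (lcp q r) \<le> lcp p r"
proof (induction p q arbitrary: r rule: lcp.induct)
  case (1 x xs y ys)
  then show ?case by (cases r) (auto simp: min_le_iff_disj)
qed auto

lemma lcp_eq_length: "lcp p q = length p \<Longrightarrow> take (length p) q = p"
proof (induction p q rule: lcp.induct)
  case (1 x xs y ys)
  then show ?case by (auto split: if_splits)
qed auto

lemma eq_if_lcp_eq_lengths: "lcp p q = length p \<Longrightarrow> length q = length p \<Longrightarrow> p = q"
  using lcp_eq_length[of p q] by simp

text \<open>The path metric: down from \<open>p\<close> to the branching vertex, then out to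
  \<open>q\<close>.\<close>

definition vdist :: "'a list \<Rightarrow> 'a list \<Rightarrow> real" where
  "vdist p q = real (length p) + real (length q) - 2 * real (lcp p q)"

text \<open>A set \<open>V\<close> of lists closed under prefixes is the vertex set of a rooted tree.  The point at
  height \<open>r\<close> of its realization below the vertex \<open>p\<close>, on the edge ending at \<open>p\<close>, is \<open>(p, r)\<close>.\<close>

definition tree_points :: "'a list set \<Rightarrow> ('a list \<times> real) set" where
  "tree_points V = {(p, r). p \<in> V \<and> 0 \<le> r \<and> length p = nat \<lceil>r\<rceil>}"

text \<open>The Gromov product at the root, that is, the height where the segments from the root to
  \<open>x\<close> and \<open>y\<close> part. The lists run to the far ends of the edges containing
  the points, so their common prefix has to be capped by both heights.\<close>

definition meet :: "'a list \<times> real \<Rightarrow> 'a list \<times> real \<Rightarrow> real" where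
  "meet x y = min (min (snd x) (snd y)) (real (lcp (fst x) (fst y)))"

definition tdist :: "'a list \<times> real \<Rightarrow> 'a list \<times> real \<Rightarrow> real" where
  "tdist x y = snd x + snd y - 2 * meet x y"

definition vpoint :: "'a list \<Rightarrow> 'a list \<times> real" where
  "vpoint p = (p, real (length p))"

lemma tdist_vpoint: "tdist (vpoint p) (vpoint q) = vdist p q"
  using lcp_le_length[of p q] by (auto simp: tdist_def vpoint_def vdist_def meet_def min_def)

lemma vpoint_in [simp]: "vpoint p \<in> tree_points V \<longleftrightarrow> p \<in> V"
  by (simp add: vpoint_def tree_points_def)

lemma meet_ultra: "min (meet x y) (meet y z) \<le> meet x z"
  using lcp_ultra[of "fst x" "fst y" "fst z"] unfolding meet_def
  by (auto simp: min_le_iff_disj)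

lemma meet_commute: "meet x y = meet y x"
  by (simp add: meet_def lcp_commute min.commute)

lemma meet_le: "meet x y \<le> snd x" "meet x y \<le> snd y"
  by (auto simp: meet_def)

lemma tdist_triangle: "tdist x z \<le> tdist x y + tdist y z"
proof -
  have "meet x y + meet y z \<le> snd y + meet x z"
    using meet_ultra[of x y z] meet_le[of x y] meet_le[of y z]
    by (auto simp: min_def split: if_splits)
  then show ?thesis by (simp add: tdist_def)
qed

lemma tdist_eq_0:
  assumes "x \<in> tree_points V" "y \<in> tree_points V" "tdist x y = 0"
  shows "x = y"
proof -
  obtain p r q s where xy: "x = (p, r)" "y = (q, s)" by (cases x; cases y)
  have "meet x y = r" "r = s"
    using assms(3) meet_le[of x y] by (auto simp: xy tdist_def)
  then have le: "r \<le> real (lcp p q)" by (auto simp: xy meet_def)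
  have len: "length p = nat \<lceil>r\<rceil>" "length q = nat \<lceil>r\<rceil>"
    using assms \<open>r = s\<close> by (auto simp: xy tree_points_def)
  have "lcp p q = length p" using le lcp_le_length(1)[of p q] len(1) by linarith
  then show ?thesis using eq_if_lcp_eq_lengths[of p q] len \<open>r = s\<close> by (simp add: xy)
qed

lemma Metric_space_tree: "Metric_space (tree_points V) tdist"
proof
  fix x y z :: "'a list \<times> real"
  show "0 \<le> tdist x y" using meet_le[of x y] by (simp add: tdist_def)
  show "tdist x y = tdist y x" by (simp add: tdist_def meet_commute)
  assume x: "x \<in> tree_points V" and y: "y \<in> tree_points V"
  have "tdist x x = 0" using x by (auto simp: tree_points_def tdist_def meet_def)
  then show "tdist x y = 0 \<longleftrightarrow> x = y" using tdist_eq_0[OF x y] by auto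
  show "tdist x z \<le> tdist x y + tdist y z" by (rule tdist_triangle)
qed

text \<open>The heights contribute equally to all three sums, so only the meets matter and
  \<open>meet_ultra\<close> decides. This is hyperbolicity with \<delta> = 0.\<close>

lemma tdist_four_point:
  "tdist x z + tdist w y \<le> max (tdist x y + tdist z w) (tdist y z + tdist x w)"
proof -
  have "min (meet x y + meet z w) (meet y z + meet x w) \<le> meet x z + meet w y"
    using meet_ultra[of x y z] meet_ultra[of x w z] meet_ultra[of w x y] meet_ultra[of w z y]
    unfolding meet_commute[of y x] meet_commute[of w x] meet_commute[of z y] meet_commute[of w z]
      meet_commute[of y w] meet_commute[of z x]
    by (auto simp: min_def split: if_splits)
  then show ?thesis by (auto simp: tdist_def min_def max_def split: if_splits)
qed

text \<open>The point at height \<open>u\<close> on the segment from the root to \<open>p\<close>;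
  the ceiling is the list length that \<open>tree_points\<close> prescribes at this height.\<close>

definition anc :: "'a list \<Rightarrow> real \<Rightarrow> 'a list \<times> real" where
  "anc p u = (take (nat \<lceil>u\<rceil>) p, u)"

lemma tdist_anc:
  assumes "0 \<le> u" "0 \<le> v"
  shows "tdist (anc p u) (anc q v) = u + v - 2 * min (min u v) (real (lcp p q))"
proof -
  have "lcp (take (nat \<lceil>u\<rceil>) p) (take (nat \<lceil>v\<rceil>) q) = min (nat \<lceil>u\<rceil>) (min (nat \<lceil>v\<rceil>) (lcp p q))"
    by (simp add: lcp_take lcp_commute[of p "take _ q"] lcp_commute[of q p])
  moreover have "u \<le> real (nat \<lceil>u\<rceil>)" "v \<le> real (nat \<lceil>v\<rceil>)" by linarith+
  ultimately show ?thesis unfolding tdist_def meet_def anc_def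
    by (simp add: of_nat_min) (auto simp: min_def)
qed

lemma anc_in:
  assumes "(p, r) \<in> tree_points V" "0 \<le> u" "u \<le> r" and closed: "\<And>k p. p \<in> V \<Longrightarrow> take k p \<in> V"
  shows "anc p u \<in> tree_points V"
proof -
  have "nat \<lceil>u\<rceil> \<le> nat \<lceil>r\<rceil>" using assms by (intro nat_mono ceiling_mono)
  then show ?thesis using assms by (auto simp: tree_points_def anc_def)
qed

lemma anc_self: "(p, r) \<in> tree_points V \<Longrightarrow> anc p r = (p, r)"
  by (auto simp: anc_def tree_points_def)

lemma tree_geodesic:
  assumes x: "x \<in> tree_points V" and y: "y \<in> tree_points V"
    and closed: "\<And>k p. p \<in> V \<Longrightarrow> take k p \<in> V"
  shows "\<exists>\<gamma>. \<gamma> ` {0..tdist x y} \<subseteq> tree_points V \<and> \<gamma> 0 = x \<and> \<gamma> (tdist x y) = y \<and>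
    (\<forall>s\<in>{0..tdist x y}. \<forall>t\<in>{0..tdist x y}. tdist (\<gamma> s) (\<gamma> t) = \<bar>s - t\<bar>)"
proof -
  obtain p r q s where xy: "x = (p, r)" "y = (q, s)" by (cases x; cases y)
  define m where "m = meet x y"
  have m: "m = min (min r s) (real (lcp p q))" by (simp add: m_def meet_def xy)
  define D where "D = tdist x y"
  have D: "D = r + s - 2 * m" by (simp add: D_def m_def tdist_def xy)
  have rs: "0 \<le> r" "0 \<le> s" using x y by (auto simp: xy tree_points_def)
  have m0: "0 \<le> m" "m \<le> r" "m \<le> s" "m \<le> real (lcp p q)" using rs by (auto simp: m)
  \<comment> \<open>Descend from \<open>x\<close> to the branching height \<open>m\<close>, which
    takes time r - m, then climb towards \<open>y\<close>, with time counted backwards from the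
    end.\<close>
  define \<gamma> where "\<gamma> t = (if t \<le> r - m then anc p (r - t) else anc q (s - (D - t)))" for t
  have "\<gamma> t \<in> tree_points V" if "t \<in> {0..D}" for t
    using that x y m0 unfolding \<gamma>_def xy D by (auto intro!: anc_in closed)
  moreover have "\<gamma> 0 = x" using m0 anc_self x by (auto simp: \<gamma>_def xy)
  moreover have "\<gamma> D = y"
  \<comment> \<open>If \<open>y\<close> lies on the segment from the root to \<open>x\<close>, the
    path ends while it is still given by prefixes of \<open>p\<close>, and these have to be
    identified with prefixes of \<open>q\<close>.\<close>
  proof (cases "D \<le> r - m")
    case True
    then have "s = m" using D m0 by simp
    then have "tdist (anc p s) (anc q s) = 0" using rs m0 by (simp add: tdist_anc)
    moreover have "anc p s \<in> tree_points V" "anc q s \<in> tree_points V"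
      using \<open>s = m\<close> m0 x y rs closed by (auto simp: xy intro!: anc_in)
    ultimately have "anc p s = anc q s" using tdist_eq_0 by blast
    moreover have "r - D = s" using \<open>s = m\<close> D by simp
    ultimately show ?thesis using True anc_self y by (simp add: \<gamma>_def xy)
  next
    case False
    then show ?thesis using anc_self y by (simp add: \<gamma>_def xy)
  qed
  moreover have "tdist (\<gamma> a) (\<gamma> b) = \<bar>a - b\<bar>" if "a \<in> {0..D}" "b \<in> {0..D}" for a b
  proof -
    have pp: "tdist (anc p u) (anc p v) = \<bar>u - v\<bar>" if "0 \<le> u" "u \<le> r" "0 \<le> v" "v \<le> r" for u v
    proof -
      have "r \<le> real (length p)" using x rs by (simp add: xy tree_points_def)
      then show ?thesis using that by (auto simp: tdist_anc min_def)
    qed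
    have qq: "tdist (anc q u) (anc q v) = \<bar>u - v\<bar>" if "0 \<le> u" "u \<le> s" "0 \<le> v" "v \<le> s" for u v
    proof -
      have "s \<le> real (length q)" using y rs by (simp add: xy tree_points_def)
      then show ?thesis using that by (auto simp: tdist_anc min_def)
    qed
    have pq: "tdist (anc p u) (anc q v) = u + v - 2 * m" "tdist (anc q v) (anc p u) = u + v - 2 * m"
      if "m \<le> u" "u \<le> r" "m \<le> v" "v \<le> s" for u v
      using that m0 m by (auto simp: tdist_anc lcp_commute[of q p] min_def split: if_splits)
    show ?thesis
    proof (cases "a \<le> r - m"; cases "b \<le> r - m")
      assume "a \<le> r - m" "b \<le> r - m"
      then show ?thesis using that m0 by (simp add: \<gamma>_def pp)
    next
      assume h: "a \<le> r - m" "\<not> b \<le> r - m"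
      then have "tdist (\<gamma> a) (\<gamma> b) = (r - a) + (s - (D - b)) - 2 * m"
        using that m0 D unfolding \<gamma>_def by (simp only: if_True if_False) (intro pq; simp)
      then show ?thesis using D h by simp
    next
      assume h: "\<not> a \<le> r - m" "b \<le> r - m"
      then have "tdist (\<gamma> a) (\<gamma> b) = (r - b) + (s - (D - a)) - 2 * m"
        using that m0 D unfolding \<gamma>_def by (simp only: if_True if_False) (intro pq; simp)
      then show ?thesis using D h by simp
    next
      assume h: "\<not> a \<le> r - m" "\<not> b \<le> r - m"
      then show ?thesis using that m0 D by (simp add: \<gamma>_def qq)
    qed
  qed
  ultimately show ?thesis unfolding D_def[symmetric] by (intro exI[of _ \<gamma>]) auto
qed

text \<open>Points of the realization are determined by their distances to the vertices; this is how
  isometries of the vertex set are extended.\<close>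

lemma tdist_attained_at_vertex:
  assumes x: "x \<in> tree_points V" and y: "y \<in> tree_points V"
  shows "\<exists>v\<in>V. tdist x y \<le> \<bar>tdist x (vpoint v) - tdist y (vpoint v)\<bar>"
proof -
  obtain p r q s where xy: "x = (p, r)" "y = (q, s)" by (cases x; cases y)
  have le: "r \<le> real (length p)" "s \<le> real (length q)" and pq: "p \<in> V" "q \<in> V"
    using x y by (auto simp: xy tree_points_def)
  have l: "lcp p q \<le> length p" "lcp p q \<le> length q" by (rule lcp_le_length)+
  show ?thesis
  \<comment> \<open>If \<open>x\<close> branches off the segment to \<open>q\<close> no higher than
    \<open>y\<close>, then \<open>y\<close> lies between \<open>x\<close> and the vertex
    \<open>q\<close>. Otherwise \<open>y\<close> lies below \<open>x\<close> on the segment to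
    \<open>p\<close>, and \<open>x\<close> lies between \<open>y\<close> and the vertex
    \<open>p\<close>. Either way the difference of distances to that vertex is exact.\<close>
  proof (cases "min r (real (lcp p q)) \<le> s")
    case True
    then have "tdist x y \<le> \<bar>tdist x (vpoint q) - tdist y (vpoint q)\<bar>"
      using le l by (auto simp: xy tdist_def meet_def vpoint_def min_def split: if_splits)
    then show ?thesis using pq by blast
  next
    case False
    then have "tdist x y \<le> \<bar>tdist x (vpoint p) - tdist y (vpoint p)\<bar>"
      using le l by (auto simp: xy tdist_def meet_def vpoint_def min_def lcp_commute[of q p] split: if_splits)
    then show ?thesis using pq by blast
  qed
qed

text \<open>A path from a point of the edge ending at \<open>p\<close> to a vertex leaves the edge
  through one of its two ends.\<close>

lemma tdist_vertex:
  assumes "(p, r) \<in> tree_points V" "0 < r"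
  shows "tdist (p, r) (vpoint v) =
    min (vdist (butlast p) v + (r - (real (length p) - 1))) (vdist p v + (real (length p) - r))"
proof -
  have len: "length p = nat \<lceil>r\<rceil>" using assms by (simp add: tree_points_def)
  then have le: "r \<le> real (length p)" "real (length p) - 1 < r" "length p \<ge> 1"
    using assms(2) by linarith+
  have b: "lcp (butlast p) v = min (length p - 1) (lcp p v)"
    by (simp add: butlast_conv_take lcp_take)
  have l: "lcp p v \<le> length p" "lcp p v \<le> length v" by (rule lcp_le_length)+
  show ?thesis
  proof (cases "lcp p v = length p")
    case True
    then show ?thesis using le l
      by (auto simp: tdist_def vdist_def vpoint_def meet_def b of_nat_diff min_def split: if_splits)
  next
    case False
    then have "lcp p v \<le> length p - 1" "real (lcp p v) \<le> real (length p) - 1" using l le by linarith+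
    then show ?thesis using le l
      by (auto simp: tdist_def vdist_def vpoint_def meet_def b of_nat_diff min_def split: if_splits)
  qed
qed

lemma vdist_eq_1:
  assumes "vdist u w = 1"
  shows "w \<noteq> [] \<and> u = butlast w \<or> u \<noteq> [] \<and> w = butlast u"
proof -
  have l: "lcp u w \<le> length u" "lcp u w \<le> length w" by (rule lcp_le_length)+
  have "length u + length w = Suc (2 * lcp u w)"
    using assms unfolding vdist_def by linarith
  then consider "lcp u w = length u" "length w = Suc (length u)"
    | "lcp w u = length w" "length u = Suc (length w)"
    using l lcp_commute[of u w] by (cases "lcp u w = length u") auto
  then show ?thesis
  proof cases
    case 1
    then show ?thesis using lcp_eq_length[of u w] by (auto simp: butlast_conv_take)
  next
    case 2
    then show ?thesis using lcp_eq_length[of w u] by (auto simp: butlast_conv_take)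
  qed
qed

text \<open>The ends of an edge are sent to adjacent vertices, and the image point is placed at the
  same distance \<open>t\<close> from the image of the lower end. Since \<open>f\<close> need not
  fix the root, the lower end may become the upper one; this is the second case, where
  \<open>t\<close> is subtracted from a height rather than added.\<close>

lemma tree_isometry_extends:
  assumes closed: "\<And>k p. p \<in> V \<Longrightarrow> take k p \<in> V"
    and f: "\<And>p. p \<in> V \<Longrightarrow> f p \<in> V" "\<And>p q. p \<in> V \<Longrightarrow> q \<in> V \<Longrightarrow> vdist (f p) (f q) = vdist p q"
    and x: "x \<in> tree_points V"
  shows "\<exists>y\<in>tree_points V. \<forall>v\<in>V. tdist y (vpoint (f v)) = tdist x (vpoint v)"
proof -
  obtain p r where xp: "x = (p, r)" by (cases x)
  have p: "p \<in> V" "0 \<le> r" "length p = nat \<lceil>r\<rceil>" using x by (auto simp: xp tree_points_def)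
  show ?thesis
  proof (cases "r = real (length p)")
    case True
    then have "x = vpoint p" by (simp add: xp vpoint_def)
    then show ?thesis using f p by (intro bexI[of _ "vpoint (f p)"]) (auto simp: tdist_vpoint)
  next
    case False
    then have r: "0 < r" "r < real (length p)" "real (length p) - 1 < r" "length p \<ge> 1"
      using p by (auto simp: le_less) linarith+
    define t where "t = r - (real (length p) - 1)"
    have t: "0 < t" "t < 1" using r by (auto simp: t_def)
    let ?u = "butlast p"
    have u: "?u \<in> V" using closed[OF p(1)] by (simp add: butlast_conv_take)
    have "vdist ?u p = 1" using r by (simp add: vdist_def butlast_conv_take lcp_take of_nat_diff)
    then have "vdist (f ?u) (f p) = 1" using f u p by simp
    from vdist_eq_1[OF this] show ?thesis
    proof (elim disjE conjE)
      assume fp: "f p \<noteq> []" "f ?u = butlast (f p)"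
      let ?y = "(f p, real (length (f p)) - 1 + t)"
      have "length (f p) \<ge> 1" using fp(1) by (cases "f p") auto
      then have l: "0 < real (length (f p)) - 1 + t" "length (f p) = nat \<lceil>real (length (f p)) - 1 + t\<rceil>"
        using t by linarith+
      have y: "?y \<in> tree_points V" using f(1)[OF p(1)] l by (simp add: tree_points_def)
      show ?thesis
      proof (intro bexI[OF _ y] ballI)
        fix v assume v: "v \<in> V"
        show "tdist ?y (vpoint (f v)) = tdist x (vpoint v)"
          unfolding tdist_vertex[OF y l(1)] xp tdist_vertex[OF x[unfolded xp] r(1)]
          using f u p v by (simp add: fp(2)[symmetric] t_def)
      qed
    next
      assume fu: "f ?u \<noteq> []" "f p = butlast (f ?u)"
      let ?y = "(f ?u, real (length (f ?u)) - t)"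
      have "length (f ?u) \<ge> 1" using fu(1) by (cases "f ?u") auto
      then have l: "0 < real (length (f ?u)) - t" "length (f ?u) = nat \<lceil>real (length (f ?u)) - t\<rceil>"
        using t by linarith+
      have y: "?y \<in> tree_points V" using f(1)[OF u] l by (simp add: tree_points_def)
      show ?thesis
      proof (intro bexI[OF _ y] ballI)
        fix v assume v: "v \<in> V"
        show "tdist ?y (vpoint (f v)) = tdist x (vpoint v)"
          unfolding tdist_vertex[OF y l(1)] xp tdist_vertex[OF x[unfolded xp] r(1)]
          using f u p v by (simp add: fu(2)[symmetric] t_def min.commute algebra_simps)
      qed
    qed
  qed
qed

text \<open>All factors of a product must be metrics on one type, so the tree and the real line are
  transported along injections.\<close>

definition push_metric :: "('a \<Rightarrow> 'b) \<Rightarrow> 'a set \<Rightarrow> ('a \<Rightarrow> 'a \<Rightarrow> real) \<Rightarrow> 'b metric" where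
  "push_metric j M d = metric (j ` M, \<lambda>a b. d (inv_into M j a) (inv_into M j b))"

lemma
  assumes "Metric_space M d" and j: "inj_on j M"
  shows mspace_push_metric: "mspace (push_metric j M d) = j ` M"
    and mdist_push_metric: "x \<in> M \<Longrightarrow> y \<in> M \<Longrightarrow> mdist (push_metric j M d) (j x) (j y) = d x y"
proof -
  interpret Metric_space M d by fact
  have "Metric_space (j ` M) (\<lambda>a b. d (inv_into M j a) (inv_into M j b))"
    by standard (use j in \<open>auto simp: commute triangle\<close>)
  then show "mspace (push_metric j M d) = j ` M"
    "x \<in> M \<Longrightarrow> y \<in> M \<Longrightarrow> mdist (push_metric j M d) (j x) (j y) = d x y"
    using j by (simp_all add: push_metric_def Metric_space.mspace_metric Metric_space.mdist_metric)
qed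

lemma hyperbolic_space_push_metric:
  assumes M: "Metric_space M d" and j: "inj_on j M" and ne: "M \<noteq> {}"
    and geo: "\<And>x y. x \<in> M \<Longrightarrow> y \<in> M \<Longrightarrow> \<exists>\<gamma>. \<gamma> ` {0..d x y} \<subseteq> M \<and> \<gamma> 0 = x \<and> \<gamma> (d x y) = y \<and>
      (\<forall>s\<in>{0..d x y}. \<forall>t\<in>{0..d x y}. d (\<gamma> s) (\<gamma> t) = \<bar>s - t\<bar>)"
    and fp: "\<And>w x y z. w \<in> M \<Longrightarrow> x \<in> M \<Longrightarrow> y \<in> M \<Longrightarrow> z \<in> M \<Longrightarrow>
      d x z + d w y \<le> max (d x y + d z w) (d y z + d x w)"
  shows "hyperbolic_space (push_metric j M d)"
  unfolding hyperbolic_space_def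
proof (intro conjI)
  let ?X = "push_metric j M d"
  note ms = mspace_push_metric[OF M j] and md = mdist_push_metric[OF M j]
  show "mspace ?X \<noteq> {}" using ne by (simp add: ms)
  show "geodesic_space ?X"
    unfolding geodesic_space_def ms
  proof (intro ballI)
    fix a b assume "a \<in> j ` M" "b \<in> j ` M"
    then obtain x y where xy: "x \<in> M" "y \<in> M" and ab: "a = j x" "b = j y" by blast
    obtain \<gamma> where g: "\<gamma> ` {0..d x y} \<subseteq> M" "\<gamma> 0 = x" "\<gamma> (d x y) = y"
      "\<And>s t. s \<in> {0..d x y} \<Longrightarrow> t \<in> {0..d x y} \<Longrightarrow> d (\<gamma> s) (\<gamma> t) = \<bar>s - t\<bar>"
      using geo[OF xy] by blast
    have in_M: "\<gamma> s \<in> M" if "s \<in> {0..d x y}" for s using g(1) that by blast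
    show "\<exists>\<gamma>. \<gamma> ` {0..mdist ?X a b} \<subseteq> j ` M \<and> \<gamma> 0 = a \<and> \<gamma> (mdist ?X a b) = b \<and>
      (\<forall>s\<in>{0..mdist ?X a b}. \<forall>t\<in>{0..mdist ?X a b}. mdist ?X (\<gamma> s) (\<gamma> t) = \<bar>s - t\<bar>)"
      unfolding ab md[OF xy]
      by (intro exI[of _ "j \<circ> \<gamma>"] conjI) (use g in_M md in \<open>auto simp del: atLeastAtMost_iff\<close>)
  qed
  have "Gromov_hyperbolic 0 ?X"
    unfolding Gromov_hyperbolic_def ms Gromov_product_def
  proof (intro ballI)
    fix w x y z assume "w \<in> j ` M" "x \<in> j ` M" "y \<in> j ` M" "z \<in> j ` M"
    then obtain w' x' y' z' where m: "w' \<in> M" "x' \<in> M" "y' \<in> M" "z' \<in> M"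
      and e: "w = j w'" "x = j x'" "y = j y'" "z = j z'" by blast
    interpret Metric_space M d by fact
    show "min ((mdist ?X x w + mdist ?X y w - mdist ?X x y) / 2) ((mdist ?X y w + mdist ?X z w - mdist ?X y z) / 2) - 0
      \<le> (mdist ?X x w + mdist ?X z w - mdist ?X x z) / 2"
      using fp[OF m] m commute[of w' y'] unfolding e by (simp add: md min_def max_def split: if_splits)
  qed
  then show "\<exists>\<delta>\<ge>0. Gromov_hyperbolic \<delta> ?X" by blast
qed

section \<open>Lattices and rational matrices\<close>

definition ratvec :: "int ^ 'n \<Rightarrow> rat ^ 'n" where
  "ratvec x = (\<chi> i. of_int (x $ i))"

lemma ratvec_nth [simp]: "ratvec x $ i = of_int (x $ i)"
  by (simp add: ratvec_def)

lemma ratvec_add: "ratvec (x + y) = ratvec x + ratvec y"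
  and ratvec_zero [simp]: "ratvec 0 = 0"
  and ratvec_scale: "ratvec (k *s x) = of_int k *s ratvec x"
  and ratvec_eq_iff [simp]: "ratvec x = ratvec y \<longleftrightarrow> x = y"
  by (simp_all add: vec_eq_iff)

lemma additive_laws:
  fixes T :: "'a::ab_group_add \<Rightarrow> 'b::ab_group_add"
  assumes "\<And>x y. T (x + y) = T x + T y"
  shows "T 0 = 0" "T (- x) = - T x" "T (x - y) = T x - T y" "T (sum f S) = (\<Sum>i\<in>S. T (f i))"
proof -
  interpret additive T by standard (rule assms)
  show "T 0 = 0" "T (- x) = - T x" "T (x - y) = T x - T y" "T (sum f S) = (\<Sum>i\<in>S. T (f i))"
    by (rule zero minus diff sum)+
qed

text \<open>The scalar action on the target is a parameter \<open>s\<close>, characterized by its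
  recursion, so that integer vectors, rational vectors and real numbers are covered at once.\<close>

lemma additive_scale:
  fixes T :: "int ^ 'n \<Rightarrow> 'a::ab_group_add"
  assumes add: "\<And>x y. T (x + y) = T x + T y"
    and s: "\<And>x. s 0 x = 0" "\<And>k x. s (k + 1) x = s k x + (x::'a)"
  shows "T (k *s x) = s (k::int) (T x)"
proof -
  have "T (of_nat n *s x) = s (of_nat n) (T x) \<and> T ((- of_nat n) *s x) = s (- of_nat n) (T x)" for n
  proof (induction n)
    case 0
    then show ?case using s additive_laws(1)[of T, OF add] by simp
  next
    case (Suc n)
    have e: "s (- of_nat n) y = s (- of_nat (Suc n)) y + y" for y
      using s(2)[of "- of_nat (Suc n)" y] by simp
    have "T (of_nat (Suc n) *s x) = T (of_nat n *s x) + T x"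
    proof -
      have "of_nat (Suc n) *s x = of_nat n *s x + x"
        by (simp add: vec_eq_iff algebra_simps)
      then show ?thesis by (simp only: add)
    qed
    moreover have "T ((- of_nat (Suc n)) *s x) = T ((- of_nat n) *s x) - T x"
    proof -
      have "(- of_nat (Suc n)) *s x = (- of_nat n) *s x - x"
        by (simp add: vec_eq_iff algebra_simps)
      then show ?thesis by (simp add: additive_laws(3)[of T, OF add])
    qed
    ultimately show ?case using Suc s(2)[of "of_nat n" "T x"] e[of "T x"] by (simp add: algebra_simps)
  qed
  then show ?thesis by (cases k) (metis of_nat_Suc)+
qed

lemma additive_matrix:
  fixes T :: "int ^ 'n \<Rightarrow> rat ^ 'm"
  assumes add: "\<And>x y. T (x + y) = T x + T y"
  shows "\<exists>Q. \<forall>x. T x = Q *v ratvec x"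
proof (intro exI allI)
  fix x
  have sc: "T (k *s y) = of_int k *s T y" for k y
    by (rule additive_scale[OF add]) (simp_all add: vec_eq_iff algebra_simps)
  have "T x = T (\<Sum>j\<in>UNIV. x $ j *s axis j 1)" by (simp add: basis_expansion)
  also have "\<dots> = (\<Sum>j\<in>UNIV. of_int (x $ j) *s T (axis j 1))"
    by (simp add: additive_laws(4)[of T, OF add] sc)
  also have "\<dots> = (\<chi> i j. T (axis j 1) $ i) *v ratvec x"
    by (simp add: vec_eq_iff matrix_vector_mult_def sum_component mult.commute)
  finally show "T x = (\<chi> i j. T (axis j 1) $ i) *v ratvec x" .
qed

lemma common_denominator:
  assumes "finite (S :: rat set)"
  shows "\<exists>m>0. \<forall>q\<in>S. of_nat m * q \<in> \<int>"
  using assms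
proof (induction S)
  case empty
  then show ?case by (intro exI[of _ 1]) auto
next
  case (insert q S)
  then obtain m where m: "m > 0" "\<forall>q\<in>S. of_nat m * q \<in> \<int>" by blast
  obtain a b where ab: "q = of_int a / of_int b" "b > 0" by (cases q rule: Rat_cases) (auto simp: Fract_of_int_quotient)
  have "of_nat (m * nat b) * x \<in> \<int>" if x: "x \<in> insert q S" for x
  proof (cases "x = q")
    case True
    then have "of_nat (m * nat b) * x = of_int (int m * a)" using ab by simp
    then show ?thesis by (metis Ints_of_int)
  next
    case False
    then have "of_nat m * x \<in> \<int>" using x m by auto
    then have "of_nat (nat b) * (of_nat m * x) \<in> \<int>" by (rule Ints_mult[OF Ints_of_nat])
    moreover have "of_nat (m * nat b) * x = of_nat (nat b) * (of_nat m * x)" by simp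
    ultimately show ?thesis by (simp only:)
  qed
  then show ?case using m ab by (intro exI[of _ "m * nat b"]) auto
qed

lemma ratvec_of_Ints:
  assumes "\<And>i. x $ i \<in> \<int>"
  shows "\<exists>z. x = ratvec z"
proof -
  have "\<forall>i. \<exists>z. x $ i = of_int z" using assms Ints_cases by metis
  then obtain f where "\<forall>i. x $ i = of_int (f i)" by metis
  then show ?thesis by (intro exI[of _ "\<chi> i. f i"]) (simp add: vec_eq_iff)
qed

lemma vec_common_denominator:
  fixes x :: "rat ^ 'n"
  shows "\<exists>m>0. \<exists>z. of_nat m *s x = ratvec z"
proof -
  obtain m :: nat where m: "m > 0" "\<forall>q\<in>range (\<lambda>i. x $ i). of_nat m * q \<in> \<int>"
    using common_denominator[of "range (\<lambda>i. x $ i)"] by auto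
  then show ?thesis using ratvec_of_Ints[of "of_nat m *s x"] by auto
qed

lemma matrix_common_denominator:
  fixes B :: "rat ^ 'n ^ 'm"
  shows "\<exists>m>0. \<forall>x. \<exists>z. of_nat m *s (B *v ratvec x) = ratvec z"
proof -
  obtain m :: nat where m: "m > 0" "\<forall>q\<in>range (\<lambda>(i,j). B $ i $ j). of_nat m * q \<in> \<int>"
    using common_denominator[of "range (\<lambda>(i,j). B $ i $ j)"] by auto
  have "(of_nat m *s (B *v ratvec x)) $ i \<in> \<int>" for x i
  proof -
    have "(of_nat m *s (B *v ratvec x)) $ i = (\<Sum>j\<in>UNIV. (of_nat m * B $ i $ j) * of_int (x $ j))"
      by (simp add: matrix_vector_mult_def sum_distrib_left mult.assoc)
    also have "\<dots> \<in> \<int>"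
    proof (rule Ints_sum)
      show "(of_nat m * B $ i $ j) * of_int (x $ j) \<in> \<int>" for j
        using m(2) rangeI[of "\<lambda>(i,j). B $ i $ j" "(i, j)"] by (intro Ints_mult[OF _ Ints_of_int]) auto
    qed
    finally show ?thesis .
  qed
  then have "\<exists>z. of_nat m *s (B *v ratvec x) = ratvec z" for x by (intro ratvec_of_Ints)
  then show ?thesis using m(1) by blast
qed

text \<open>Clearing denominators turns a rational kernel vector into an integral one, on which
  injectivity applies.\<close>

lemma inj_additive_matrix_invertible:
  fixes T :: "int ^ 'n \<Rightarrow> rat ^ 'n"
  assumes Q: "\<And>x. T x = Q *v ratvec x" and inj: "inj T"
  shows "invertible Q"
proof -
  have "x = 0" if "Q *v x = 0" for x
  proof -
    obtain m :: nat and z where m: "m > 0" "of_nat m *s x = ratvec z"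
      using vec_common_denominator[of x] by blast
    have "T z = of_nat m *s (Q *v x)"
      by (simp add: Q m(2)[symmetric] matrix_vector_mult_def vec_eq_iff sum_distrib_left mult_ac)
    also have "\<dots> = T 0" using that Q by (simp add: vec_eq_iff)
    finally have "z = 0" using inj by (simp add: inj_eq)
    then show ?thesis using m by (simp add: vec_eq_iff)
  qed
  then show ?thesis
    by (simp add: invertible_left_inverse matrix_left_invertible_ker)
qed

lemma invertible_inverses:
  fixes Q :: "'a::field ^ 'n ^ 'n"
  assumes "invertible Q"
  shows "Q ** matrix_inv Q = mat 1" "matrix_inv Q ** Q = mat 1"
  using assms someI_ex[of "\<lambda>A'. Q ** A' = mat 1 \<and> A' ** Q = mat 1"]
  by (auto simp: invertible_def matrix_inv_def)

lemma invertible_cancel [simp]: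
  fixes Q :: "'a::field ^ 'n ^ 'n"
  assumes "invertible Q"
  shows "matrix_inv Q *v (Q *v x) = x" "Q *v (matrix_inv Q *v x) = x"
  by (simp_all add: matrix_vector_mul_assoc invertible_inverses assms)

text \<open>\<open>m\<close> is a common denominator of the inverse matrix. This is how the finite
  index of the image is used throughout.\<close>

lemma inj_additive_image_contains_multiples:
  fixes N :: "int ^ 'n \<Rightarrow> int ^ 'n"
  assumes add: "\<And>x y. N (x + y) = N x + N y" and inj: "inj N"
  shows "\<exists>m>0. \<forall>x. \<exists>y. N y = int m *s x"
proof -
  obtain Q where Q: "\<And>x. ratvec (N x) = Q *v ratvec x"
    using additive_matrix[of "\<lambda>x. ratvec (N x)"] by (auto simp: add ratvec_add)
  have inv: "invertible Q"
  proof (rule inj_additive_matrix_invertible[of "\<lambda>x. ratvec (N x)"])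
    show "ratvec (N x) = Q *v ratvec x" for x by (rule Q)
    show "inj (\<lambda>x. ratvec (N x))" using inj by (simp add: inj_def)
  qed
  obtain m :: nat where m: "m > 0" "\<And>x. \<exists>z. of_nat m *s (matrix_inv Q *v ratvec x) = ratvec z"
    using matrix_common_denominator[of "matrix_inv Q"] by blast
  have "\<exists>y. N y = int m *s x" for x
  proof -
    obtain z where z: "of_nat m *s (matrix_inv Q *v ratvec x) = ratvec z" using m by blast
    have "ratvec (N z) = of_nat m *s (Q *v (matrix_inv Q *v ratvec x))"
      by (simp add: Q z[symmetric] matrix_vector_mult_def vec_eq_iff sum_distrib_left mult_ac)
    then have "ratvec (N z) = ratvec (int m *s x)" by (simp add: inv ratvec_scale)
    then show ?thesis by (simp add: exI[of _ z])
  qed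
  then show ?thesis using m by blast
qed

lemma finite_bounded_int_vectors: "finite {x :: int ^ 'n. \<forall>i. x $ i \<in> S}" if "finite S"
proof (rule finite_subset)
  show "{x :: int ^ 'n. \<forall>i. x $ i \<in> S} \<subseteq> (\<lambda>f. \<chi> i. f i) ` (PiE UNIV (\<lambda>_. S))"
  proof
    fix x :: "int ^ 'n" assume "x \<in> {x. \<forall>i. x $ i \<in> S}"
    then show "x \<in> (\<lambda>f. \<chi> i. f i) ` (PiE UNIV (\<lambda>_. S))"
      by (intro image_eqI[of _ _ "\<lambda>i. x $ i"]) auto
  qed
  show "finite ((\<lambda>f. \<chi> i. f i) ` (PiE (UNIV :: 'n set) (\<lambda>_. S)) :: (int ^ 'n) set)"
    using that by (intro finite_imageI finite_PiE) auto
qed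

text \<open>The choice depends on the coset only. Representing the trivial coset by 0 lets normal
  forms recognize backtracking from an entry with first component 0.\<close>

definition coset_rep :: "(int ^ 'n) set \<Rightarrow> int ^ 'n \<Rightarrow> int ^ 'n" where
  "coset_rep B x = (if x \<in> B then 0 else SOME y. y - x \<in> B)"

locale additive_subgroup_Zn =
  fixes B :: "(int ^ 'n) set"
  assumes zero: "0 \<in> B" and diff: "x \<in> B \<Longrightarrow> y \<in> B \<Longrightarrow> x - y \<in> B"
begin

lemma minus: "x \<in> B \<Longrightarrow> - x \<in> B"
  using diff[OF zero, of x] by simp

lemma plus: "x \<in> B \<Longrightarrow> y \<in> B \<Longrightarrow> x + y \<in> B"
  using diff[of x "- y"] minus[of y] by simp

lemma rep_diff: "coset_rep B x - x \<in> B"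
proof (cases "x \<in> B")
  case True
  then show ?thesis using diff[OF zero] by (simp add: coset_rep_def)
next
  case False
  have "x - x \<in> B" using zero by simp
  then show ?thesis using False someI[of "\<lambda>y. y - x \<in> B" x] by (simp add: coset_rep_def)
qed

lemma diff_rep: "x - coset_rep B x \<in> B"
  using minus[OF rep_diff] by simp

lemma rep_eq_iff: "coset_rep B x = coset_rep B y \<longleftrightarrow> x - y \<in> B"
proof
  assume "coset_rep B x = coset_rep B y"
  then show "x - y \<in> B" using diff[OF rep_diff[of y] rep_diff[of x]] by simp
next
  assume xy: "x - y \<in> B"
  have "x \<in> B \<longleftrightarrow> y \<in> B" using diff[OF _ xy, of x] plus[OF xy, of y] by auto
  moreover have "z - x \<in> B \<longleftrightarrow> z - y \<in> B" for z
    using plus[OF xy, of "z - x"] diff[OF _ xy, of "z - y"] by auto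
  ultimately show "coset_rep B x = coset_rep B y" by (simp add: coset_rep_def)
qed

lemma rep_rep [simp]: "coset_rep B (coset_rep B x) = coset_rep B x"
  by (simp add: rep_eq_iff rep_diff)

lemma rep_zero [simp]: "coset_rep B 0 = 0"
  by (simp add: coset_rep_def zero)

lemma rep_eq_0_iff: "coset_rep B x = 0 \<longleftrightarrow> x \<in> B"
  using rep_eq_iff[of x 0] by simp

text \<open>Reducing coordinates modulo \<open>m\<close> does not change the coset.\<close>

lemma finite_range_rep:
  assumes m: "m > (0::nat)" "\<And>x. int m *s x \<in> B"
  shows "finite (range (coset_rep B))"
proof (rule finite_subset)
  show "range (coset_rep B) \<subseteq> coset_rep B ` {x. \<forall>i. x $ i \<in> {0..<int m}}"
  proof
    fix y assume "y \<in> range (coset_rep B)"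
    then obtain x where y: "y = coset_rep B x" by blast
    let ?z = "\<chi> i. x $ i mod int m"
    have "x - ?z = int m *s (\<chi> i. x $ i div int m)"
      by (simp add: vec_eq_iff minus_mod_eq_mult_div)
    then have "y = coset_rep B ?z" using m(2) by (simp add: y rep_eq_iff)
    moreover have "?z \<in> {x. \<forall>i. x $ i \<in> {0..<int m}}" using m by simp
    ultimately show "y \<in> coset_rep B ` {x. \<forall>i. x $ i \<in> {0..<int m}}" by blast
  qed
  show "finite (coset_rep B ` {x. \<forall>i. x $ i \<in> {0..<int m}})"
    by (intro finite_imageI finite_bounded_int_vectors) auto
qed

end

lemma matrix_bounded:
  fixes C :: "rat ^ 'n ^ 'm"
  shows "\<exists>c'. \<forall>y. (\<forall>i. \<bar>y $ i\<bar> \<le> c) \<longrightarrow> (\<forall>i. \<bar>(C *v y) $ i\<bar> \<le> c')"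
proof (intro exI allI impI)
  fix y :: "rat ^ 'n" and i assume y: "\<forall>i. \<bar>y $ i\<bar> \<le> c"
  have "\<bar>(C *v y) $ i\<bar> \<le> (\<Sum>j\<in>UNIV. \<bar>C $ i $ j * y $ j\<bar>)"
    by (simp add: matrix_vector_mult_def)
  also have "\<dots> \<le> (\<Sum>j\<in>UNIV. \<bar>C $ i $ j\<bar> * c)"
    using y by (intro sum_mono) (simp add: abs_mult mult_left_mono)
  also have "\<dots> \<le> (\<Sum>i\<in>UNIV. \<Sum>j\<in>UNIV. \<bar>C $ i $ j\<bar> * c)"
  proof (rule member_le_sum)
    have "0 \<le> c" using y abs_ge_zero order_trans by blast
    then show "0 \<le> (\<Sum>j\<in>UNIV. \<bar>C $ k $ j\<bar> * c)" for k by (intro sum_nonneg) auto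
  qed auto
  finally show "\<bar>(C *v y) $ i\<bar> \<le> (\<Sum>i\<in>UNIV. \<Sum>j\<in>UNIV. \<bar>C $ i $ j\<bar> * c)" .
qed

text \<open>The inverse matrix sends a box to a bounded set, and a bounded set contains finitely
  many lattice points.\<close>

lemma finite_affine_bounded:
  fixes Q :: "rat ^ 'n ^ 'n"
  assumes "invertible Q"
  shows "finite {x. \<forall>i. \<bar>(Q *v ratvec x + b) $ i\<bar> \<le> c}"
proof -
  obtain c' where c': "\<And>y. (\<forall>i. \<bar>y $ i\<bar> \<le> c) \<Longrightarrow> (\<forall>i. \<bar>(matrix_inv Q *v y) $ i\<bar> \<le> c')"
    using matrix_bounded[of c "matrix_inv Q"] by blast
  define d where "d = \<lceil>c' + (\<Sum>i\<in>UNIV. \<bar>(matrix_inv Q *v b) $ i\<bar>)\<rceil>"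
  have "x $ i \<in> {-d..d}" if x: "\<forall>i. \<bar>(Q *v ratvec x + b) $ i\<bar> \<le> c" for x i
  proof -
    have "matrix_inv Q *v (Q *v ratvec x + b) = ratvec x + matrix_inv Q *v b"
      by (simp add: assms matrix_vector_right_distrib)
    then have "\<bar>(ratvec x + matrix_inv Q *v b) $ i\<bar> \<le> c'" using c'[OF x] by metis
    moreover have "\<bar>(matrix_inv Q *v b) $ i\<bar> \<le> (\<Sum>i\<in>UNIV. \<bar>(matrix_inv Q *v b) $ i\<bar>)"
      by (rule member_le_sum) auto
    ultimately have "\<bar>rat_of_int (x $ i)\<bar> \<le> c' + (\<Sum>i\<in>UNIV. \<bar>(matrix_inv Q *v b) $ i\<bar>)"
      by simp
    then have "\<bar>rat_of_int (x $ i)\<bar> \<le> of_int d" unfolding d_def by linarith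
    then have "\<bar>x $ i\<bar> \<le> d" by (simp only: of_int_abs[symmetric] of_int_le_iff)
    then show ?thesis by auto
  qed
  then show ?thesis
    by (intro finite_subset[OF _ finite_bounded_int_vectors[of "{-d..d}"]]) auto
qed

section \<open>Coordinates on groups isomorphic to \<open>Zn\<close>\<close>

definition Zn_coord :: "('a, 'm) monoid_scheme \<Rightarrow> 'a \<Rightarrow> int ^ 'n" where
  "Zn_coord G = (\<lambda>x. \<chi> i. (SOME h. h \<in> iso G (Zn :: ('n::finite \<Rightarrow> int) monoid)) x i)"

lemma
  fixes G :: "('a, 'm) monoid_scheme"
  assumes "G \<cong> (Zn :: ('n::finite \<Rightarrow> int) monoid)"
  shows bij_Zn_coord: "bij_betw (Zn_coord G :: 'a \<Rightarrow> int ^ 'n) (carrier G) UNIV"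
    and Zn_coord_mult: "x \<in> carrier G \<Longrightarrow> y \<in> carrier G \<Longrightarrow>
      (Zn_coord G (x \<otimes>\<^bsub>G\<^esub> y) :: int ^ 'n) = Zn_coord G x + Zn_coord G y"
proof -
  let ?h = "SOME h. h \<in> iso G (Zn :: ('n \<Rightarrow> int) monoid)"
  have h: "?h \<in> iso G (Zn :: ('n \<Rightarrow> int) monoid)"
    using assms unfolding is_iso_def by (metis ex_in_conv someI_ex)
  have carr: "carrier (Zn :: ('n \<Rightarrow> int) monoid) = UNIV"
    by (auto simp: Zn_def product_group_def)
  have "bij_betw (\<lambda>f. \<chi> i. f i) (UNIV :: ('n \<Rightarrow> int) set) (UNIV :: (int ^ 'n) set)"
    by (rule bij_betw_byWitness[of _ "\<lambda>x i. x $ i"]) auto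
  from bij_betw_trans[OF _ this, of ?h "carrier G"]
  show "bij_betw (Zn_coord G :: 'a \<Rightarrow> int ^ 'n) (carrier G) UNIV"
    using h carr by (simp add: iso_def Zn_coord_def o_def)
  show "x \<in> carrier G \<Longrightarrow> y \<in> carrier G \<Longrightarrow>
      (Zn_coord G (x \<otimes>\<^bsub>G\<^esub> y) :: int ^ 'n) = Zn_coord G x + Zn_coord G y"
    using h by (auto simp: iso_def hom_def Zn_coord_def vec_eq_iff Zn_def product_group_def)
qed

section \<open>Words and coordinates\<close>

fun letter_inverse :: "('v, 'e, 'g, 'h) graph_of_groups \<Rightarrow> ('v, 'e, 'g) letter \<Rightarrow> ('v, 'e, 'g) letter" where
  "letter_inverse \<Gamma> (Vtx v x) = Vtx v (inv\<^bsub>vgroup \<Gamma> v\<^esub> x)"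
| "letter_inverse \<Gamma> (Edg e) = Edg (rev_arc \<Gamma> e)"

definition word_inverse ::
  "('v, 'e, 'g, 'h) graph_of_groups \<Rightarrow> ('v, 'e, 'g) letter list \<Rightarrow> ('v, 'e, 'g) letter list" where
  "word_inverse \<Gamma> w = rev (map (letter_inverse \<Gamma>) w)"

locale gbs_graph_of_groups =
  fixes \<Gamma> :: "('v, 'e, 'g, 'h) graph_of_groups" and dim :: "'n::finite itself"
  assumes gbs: "gbs_graph dim \<Gamma>"
begin

lemma graph: "fin_digraph (base_graph \<Gamma>)" "bidirected_digraph (base_graph \<Gamma>) (rev_arc \<Gamma>)"
  "Digraph_Component.connected (base_graph \<Gamma>)"
  using gbs unfolding gbs_graph_def finite_connected_graph_of_groups_def by auto

lemma group_vgroup: "v \<in> gverts \<Gamma> \<Longrightarrow> group (vgroup \<Gamma> v)"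
  and group_egroup: "e \<in> garcs \<Gamma> \<Longrightarrow> group (egroup \<Gamma> e)"
  and egroup_rev: "e \<in> garcs \<Gamma> \<Longrightarrow> egroup \<Gamma> (rev_arc \<Gamma> e) = egroup \<Gamma> e"
  and emb_hom: "e \<in> garcs \<Gamma> \<Longrightarrow> emb \<Gamma> e \<in> hom (egroup \<Gamma> e) (vgroup \<Gamma> (ghead \<Gamma> e))"
  and emb_inj: "e \<in> garcs \<Gamma> \<Longrightarrow> inj_on (emb \<Gamma> e) (carrier (egroup \<Gamma> e))"
  and vgroup_iso: "v \<in> gverts \<Gamma> \<Longrightarrow> vgroup \<Gamma> v \<cong> (Zn :: ('n \<Rightarrow> int) monoid)"
  and egroup_iso: "e \<in> garcs \<Gamma> \<Longrightarrow> egroup \<Gamma> e \<cong> (Zn :: ('n \<Rightarrow> int) monoid)"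
  using gbs unfolding gbs_graph_def finite_connected_graph_of_groups_def by auto

lemma finite_graph: "finite (gverts \<Gamma>)" "finite (garcs \<Gamma>)"
  using graph(1) by (auto simp: fin_digraph_def fin_digraph_axioms_def)

lemma arc_verts [simp]: "e \<in> garcs \<Gamma> \<Longrightarrow> gtail \<Gamma> e \<in> gverts \<Gamma>" "e \<in> garcs \<Gamma> \<Longrightarrow> ghead \<Gamma> e \<in> gverts \<Gamma>"
  using graph(1) by (auto simp: fin_digraph_def wf_digraph_def)

lemma rev_arc [simp]:
  shows "rev_arc \<Gamma> (rev_arc \<Gamma> e) = e"
    and "e \<in> garcs \<Gamma> \<Longrightarrow> rev_arc \<Gamma> e \<in> garcs \<Gamma>"
    and "e \<in> garcs \<Gamma> \<Longrightarrow> gtail \<Gamma> (rev_arc \<Gamma> e) = ghead \<Gamma> e"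
    and "e \<in> garcs \<Gamma> \<Longrightarrow> ghead \<Gamma> (rev_arc \<Gamma> e) = gtail \<Gamma> e"
proof -
  interpret bidirected_digraph "base_graph \<Gamma>" "rev_arc \<Gamma>" by (rule graph)
  show "rev_arc \<Gamma> (rev_arc \<Gamma> e) = e"
    and "e \<in> garcs \<Gamma> \<Longrightarrow> rev_arc \<Gamma> e \<in> garcs \<Gamma>"
    and "e \<in> garcs \<Gamma> \<Longrightarrow> gtail \<Gamma> (rev_arc \<Gamma> e) = ghead \<Gamma> e"
    and "e \<in> garcs \<Gamma> \<Longrightarrow> ghead \<Gamma> (rev_arc \<Gamma> e) = gtail \<Gamma> e" by simp_all
qed

lemma emb_closed [simp]:
  "e \<in> garcs \<Gamma> \<Longrightarrow> x \<in> carrier (egroup \<Gamma> e) \<Longrightarrow> emb \<Gamma> e x \<in> carrier (vgroup \<Gamma> (ghead \<Gamma> e))"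
  "e \<in> garcs \<Gamma> \<Longrightarrow> x \<in> carrier (egroup \<Gamma> e) \<Longrightarrow> emb \<Gamma> (rev_arc \<Gamma> e) x \<in> carrier (vgroup \<Gamma> (gtail \<Gamma> e))"
  using emb_hom[of e] emb_hom[of "rev_arc \<Gamma> e"] by (auto simp: hom_def egroup_rev)

definition vcoord :: "'v \<Rightarrow> 'g \<Rightarrow> int ^ 'n" where
  "vcoord v = Zn_coord (vgroup \<Gamma> v)"

definition ecoord :: "'e \<Rightarrow> 'h \<Rightarrow> int ^ 'n" where
  "ecoord e = Zn_coord (egroup \<Gamma> e)"

definition velem :: "'v \<Rightarrow> int ^ 'n \<Rightarrow> 'g" where
  "velem v = inv_into (carrier (vgroup \<Gamma> v)) (vcoord v)"

definition eelem :: "'e \<Rightarrow> int ^ 'n \<Rightarrow> 'h" where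
  "eelem e = inv_into (carrier (egroup \<Gamma> e)) (ecoord e)"

text \<open>The monomorphism at the head of \<open>e\<close>, read in the chosen coordinates of the
  edge group and the vertex group.\<close>

definition incl :: "'e \<Rightarrow> int ^ 'n \<Rightarrow> int ^ 'n" where
  "incl e y = vcoord (ghead \<Gamma> e) (emb \<Gamma> e (eelem e y))"

lemma vcoord_bij: "v \<in> gverts \<Gamma> \<Longrightarrow> bij_betw (vcoord v) (carrier (vgroup \<Gamma> v)) UNIV"
  unfolding vcoord_def by (rule bij_Zn_coord) (rule vgroup_iso)

lemma ecoord_bij: "e \<in> garcs \<Gamma> \<Longrightarrow> bij_betw (ecoord e) (carrier (egroup \<Gamma> e)) UNIV"
  unfolding ecoord_def by (rule bij_Zn_coord) (rule egroup_iso)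

lemma vcoord_mult: "v \<in> gverts \<Gamma> \<Longrightarrow> x \<in> carrier (vgroup \<Gamma> v) \<Longrightarrow> y \<in> carrier (vgroup \<Gamma> v) \<Longrightarrow>
    vcoord v (x \<otimes>\<^bsub>vgroup \<Gamma> v\<^esub> y) = vcoord v x + vcoord v y"
  unfolding vcoord_def by (rule Zn_coord_mult) (rule vgroup_iso)

lemma ecoord_mult: "e \<in> garcs \<Gamma> \<Longrightarrow> x \<in> carrier (egroup \<Gamma> e) \<Longrightarrow> y \<in> carrier (egroup \<Gamma> e) \<Longrightarrow>
    ecoord e (x \<otimes>\<^bsub>egroup \<Gamma> e\<^esub> y) = ecoord e x + ecoord e y"
  unfolding ecoord_def by (rule Zn_coord_mult) (rule egroup_iso)

lemma velem [simp]:
  assumes "v \<in> gverts \<Gamma>"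
  shows "velem v k \<in> carrier (vgroup \<Gamma> v)" "vcoord v (velem v k) = k"
    "x \<in> carrier (vgroup \<Gamma> v) \<Longrightarrow> velem v (vcoord v x) = x"
  using vcoord_bij[OF assms] unfolding velem_def bij_betw_def
  by (auto intro: inv_into_into f_inv_into_f)

lemma eelem [simp]:
  assumes "e \<in> garcs \<Gamma>"
  shows "eelem e k \<in> carrier (egroup \<Gamma> e)" "ecoord e (eelem e k) = k"
    "x \<in> carrier (egroup \<Gamma> e) \<Longrightarrow> eelem e (ecoord e x) = x"
  using ecoord_bij[OF assms] unfolding eelem_def bij_betw_def
  by (auto intro: inv_into_into f_inv_into_f)

lemma vcoord_one: "v \<in> gverts \<Gamma> \<Longrightarrow> vcoord v \<one>\<^bsub>vgroup \<Gamma> v\<^esub> = 0"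
  using vcoord_mult[of v "\<one>\<^bsub>vgroup \<Gamma> v\<^esub>" "\<one>\<^bsub>vgroup \<Gamma> v\<^esub>"] group.is_monoid[OF group_vgroup]
  by (simp add: monoid.one_closed monoid.l_one)

lemma velem_add:
  assumes "v \<in> gverts \<Gamma>"
  shows "velem v (k + l) = velem v k \<otimes>\<^bsub>vgroup \<Gamma> v\<^esub> velem v l"
proof -
  have "vcoord v (velem v k \<otimes>\<^bsub>vgroup \<Gamma> v\<^esub> velem v l) = k + l"
    using assms by (simp add: vcoord_mult)
  then show ?thesis using assms velem(3)[OF assms, of "velem v k \<otimes>\<^bsub>vgroup \<Gamma> v\<^esub> velem v l"]
      monoid.m_closed[OF group.is_monoid[OF group_vgroup]] by simp
qed

lemma velem_zero: "v \<in> gverts \<Gamma> \<Longrightarrow> velem v 0 = \<one>\<^bsub>vgroup \<Gamma> v\<^esub>"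
  using velem(3)[of v "\<one>\<^bsub>vgroup \<Gamma> v\<^esub>"] by (simp add: vcoord_one group.is_monoid group_vgroup monoid.one_closed)

text \<open>An arc and its reverse share the edge group and hence its coordinates, so
  \<open>incl e y\<close> and \<open>incl (rev_arc \<Gamma> e) y\<close> come from the same edge
  element.\<close>

lemma eelem_rev: "e \<in> garcs \<Gamma> \<Longrightarrow> eelem (rev_arc \<Gamma> e) = eelem e"
  by (simp add: eelem_def ecoord_def egroup_rev)

lemma eelem_add:
  assumes "e \<in> garcs \<Gamma>"
  shows "eelem e (k + l) = eelem e k \<otimes>\<^bsub>egroup \<Gamma> e\<^esub> eelem e l"
proof -
  have "ecoord e (eelem e k \<otimes>\<^bsub>egroup \<Gamma> e\<^esub> eelem e l) = k + l"
    using assms by (simp add: ecoord_mult)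
  then show ?thesis using assms eelem(3)[OF assms, of "eelem e k \<otimes>\<^bsub>egroup \<Gamma> e\<^esub> eelem e l"]
      monoid.m_closed[OF group.is_monoid[OF group_egroup]] by simp
qed

lemma incl_add:
  assumes "e \<in> garcs \<Gamma>"
  shows "incl e (x + y) = incl e x + incl e y"
  using assms emb_hom[OF assms] by (simp add: incl_def eelem_add hom_mult vcoord_mult)

lemma inj_incl:
  assumes "e \<in> garcs \<Gamma>"
  shows "inj (incl e)"
proof (rule injI)
  fix x y assume "incl e x = incl e y"
  then have "emb \<Gamma> e (eelem e x) = emb \<Gamma> e (eelem e y)"
    using assms by (metis arc_verts(2) eelem(1) emb_closed(1) incl_def velem(3))
  then have "eelem e x = eelem e y"
    using emb_inj[OF assms] assms by (simp add: inj_on_eq_iff)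
  then show "x = y" using assms by (metis eelem(2))
qed

text \<open>Both inclusions are given by invertible rational matrices \<open>Q\<close> and
  \<open>R\<close>, and L is R composed with the inverse of Q.\<close>

lemma incl_matrices:
  assumes "e \<in> garcs \<Gamma>"
  shows "\<exists>L. invertible L \<and> (\<forall>y. L *v ratvec (incl e y) = ratvec (incl (rev_arc \<Gamma> e) y))"
proof -
  let ?e = "rev_arc \<Gamma> e"
  have r: "?e \<in> garcs \<Gamma>" using assms by simp
  obtain Q where Q: "\<And>y. ratvec (incl e y) = Q *v ratvec y"
    using additive_matrix[of "\<lambda>x. ratvec (incl e x)"] assms by (auto simp: incl_add ratvec_add)
  obtain R where R: "\<And>y. ratvec (incl ?e y) = R *v ratvec y"
    using additive_matrix[of "\<lambda>x. ratvec (incl ?e x)"] r by (auto simp: incl_add ratvec_add)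
  have iQ: "invertible Q"
    by (rule inj_additive_matrix_invertible[of "\<lambda>x. ratvec (incl e x)", OF Q])
      (use inj_incl[OF assms] in \<open>simp add: inj_def\<close>)
  have iR: "invertible R"
    by (rule inj_additive_matrix_invertible[of "\<lambda>x. ratvec (incl ?e x)", OF R])
      (use inj_incl[OF r] in \<open>simp add: inj_def\<close>)
  have "invertible (matrix_inv Q)"
    using invertible_inverses[OF iQ] unfolding invertible_def by blast
  then have "invertible (R ** matrix_inv Q)" using iR by (rule invertible_mult[rotated])
  moreover have "(R ** matrix_inv Q) *v ratvec (incl e y) = ratvec (incl ?e y)" for y
    using iQ by (simp add: Q R matrix_vector_mul_assoc[symmetric])
  ultimately show ?thesis by blast
qed

definition edge_matrix :: "'e \<Rightarrow> rat ^ 'n ^ 'n" where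
  "edge_matrix e = (SOME L. invertible L \<and> (\<forall>y. L *v ratvec (incl e y) = ratvec (incl (rev_arc \<Gamma> e) y)))"

lemma edge_matrix:
  assumes "e \<in> garcs \<Gamma>"
  shows "invertible (edge_matrix e)" "edge_matrix e *v ratvec (incl e y) = ratvec (incl (rev_arc \<Gamma> e) y)"
  using someI_ex[OF incl_matrices[OF assms]] unfolding edge_matrix_def by auto

text \<open>The two matrices cancel on the image of the edge group, which contains a nonzero
  multiple of every rational vector.\<close>

lemma edge_matrix_rev:
  assumes e: "e \<in> garcs \<Gamma>"
  shows "edge_matrix e *v (edge_matrix (rev_arc \<Gamma> e) *v z) = z"
proof -
  let ?e = "rev_arc \<Gamma> e"
  have r: "?e \<in> garcs \<Gamma>" using e by simp
  obtain m :: nat where m: "m > 0" "\<forall>x. \<exists>y. incl ?e y = int m *s x"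
    using inj_additive_image_contains_multiples[OF incl_add[OF r] inj_incl[OF r]] by blast
  obtain k :: nat and x where k: "k > 0" "of_nat k *s z = ratvec x" using vec_common_denominator by blast
  obtain y where y: "incl ?e y = int m *s x" using m by blast
  have "edge_matrix e *v (edge_matrix ?e *v ratvec (incl ?e y)) = ratvec (incl ?e y)"
    using edge_matrix(2)[OF e] edge_matrix(2)[OF r] by simp
  moreover have "ratvec (incl ?e y) = of_nat (m * k) *s z"
    unfolding y ratvec_scale k(2)[symmetric] by (simp add: vec_eq_iff)
  ultimately have "of_nat (m * k) *s (edge_matrix e *v (edge_matrix ?e *v z)) = of_nat (m * k) *s z"
    by (simp only: vector_scalar_commute)
  then show ?thesis using m k by (simp add: vec_eq_iff)
qed

definition vletter :: "'v \<Rightarrow> int ^ 'n \<Rightarrow> ('v, 'e, 'g) letter" where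
  "vletter v k = Vtx v (velem v k)"

lemma vletter_letter [simp]: "v \<in> gverts \<Gamma> \<Longrightarrow> vletter v k \<in> letters \<Gamma>"
  and Edg_letter [simp]: "e \<in> garcs \<Gamma> \<Longrightarrow> Edg e \<in> letters \<Gamma>"
  by (auto simp: letters_def vletter_def)

lemma letter_cases:
  assumes "l \<in> letters \<Gamma>"
  obtains v k where "v \<in> gverts \<Gamma>" "l = vletter v k" | e where "e \<in> garcs \<Gamma>" "l = Edg e"
  using assms by (auto simp: letters_def vletter_def) (metis velem(3))

lemma word_eq_lists: "word_eq \<Gamma> w w' \<Longrightarrow> w \<in> lists (letters \<Gamma>) \<and> w' \<in> lists (letters \<Gamma>)"
proof (induction rule: word_eq.induct)
  case (vertex_mult v x y)
  then show ?case using monoid.m_closed[OF group.is_monoid[OF group_vgroup]] by (auto simp: letters_def)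
next
  case (vertex_one v)
  then show ?case using monoid.one_closed[OF group.is_monoid[OF group_vgroup]] by (auto simp: letters_def)
next
  case (edge_conj e x)
  then show ?case by (auto simp: letters_def)
qed auto

lemma word_eq_append:
  assumes "word_eq \<Gamma> w w'" "word_eq \<Gamma> z z'"
  shows "word_eq \<Gamma> (w @ z) (w' @ z')"
proof (rule word_eq.trans)
  show "word_eq \<Gamma> (w @ z) (w' @ z)"
    using word_eq.cong[OF assms(1), of "[]" z] word_eq_lists[OF assms(2)] by simp
  show "word_eq \<Gamma> (w' @ z) (w' @ z')"
    using word_eq.cong[OF assms(2), of w' "[]"] word_eq_lists[OF assms(1)] by simp
qed

lemma word_eq_vletter:
  assumes "v \<in> gverts \<Gamma>"
  shows "word_eq \<Gamma> [vletter v k, vletter v l] [vletter v (k + l)]" "word_eq \<Gamma> [vletter v 0] []"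
  using assms word_eq.vertex_mult[of v \<Gamma> "velem v k" "velem v l"] word_eq.vertex_one[of v \<Gamma>]
  by (simp_all add: vletter_def velem_add velem_zero)

lemma word_eq_edge:
  assumes "e \<in> garcs \<Gamma>"
  shows "word_eq \<Gamma> [Edg e, vletter (ghead \<Gamma> e) (incl e y), Edg (rev_arc \<Gamma> e)]
     [vletter (gtail \<Gamma> e) (incl (rev_arc \<Gamma> e) y)]"
  using word_eq.edge_conj[OF assms, of "eelem e y"] assms by (simp add: vletter_def incl_def eelem_rev)

text \<open>The universal property of F(\<Gamma>): letters acting compatibly with the defining
  relations give an action of word classes. The set \<open>Y\<close> is there for the action on
  normal forms, where the relations are checked on valid forms; for the affine representation it is
  everything.\<close>

lemma foldr_word_eq:
  assumes w: "word_eq \<Gamma> w w'"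
    and closed: "\<And>l y. l \<in> letters \<Gamma> \<Longrightarrow> y \<in> Y \<Longrightarrow> act l y \<in> Y"
    and v_add: "\<And>v k l y. v \<in> gverts \<Gamma> \<Longrightarrow> y \<in> Y \<Longrightarrow> act (vletter v k) (act (vletter v l) y) = act (vletter v (k + l)) y"
    and v_zero: "\<And>v y. v \<in> gverts \<Gamma> \<Longrightarrow> y \<in> Y \<Longrightarrow> act (vletter v 0) y = y"
    and e_inv: "\<And>e y. e \<in> garcs \<Gamma> \<Longrightarrow> y \<in> Y \<Longrightarrow> act (Edg e) (act (Edg (rev_arc \<Gamma> e)) y) = y"
    and e_conj: "\<And>e x y. e \<in> garcs \<Gamma> \<Longrightarrow> y \<in> Y \<Longrightarrow>
      act (Edg e) (act (vletter (ghead \<Gamma> e) (incl e x)) (act (Edg (rev_arc \<Gamma> e)) y))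
        = act (vletter (gtail \<Gamma> e) (incl (rev_arc \<Gamma> e) x)) y"
    and y: "y \<in> Y"
  shows "foldr act w y = foldr act w' y"
  using w y
proof (induction arbitrary: y rule: word_eq.induct)
  case (cong w w' p q)
  have "foldr act q y \<in> Y"
    using cong.hyps(3) cong.prems by (induction q) (auto intro: closed)
  then show ?case using cong.IH by simp
next
  case (vertex_mult v x y' y)
  then show ?case using v_add[of v y "vcoord v x" "vcoord v y'"] by (simp add: vletter_def velem_add)
next
  case (vertex_one v)
  then show ?case using v_zero[of v y] by (simp add: vletter_def velem_zero)
next
  case (edge_conj e x)
  then show ?case using e_conj[of e y "ecoord e x"]
    by (simp add: vletter_def incl_def eelem_rev)
qed (use e_inv in auto)

lemma class_eq_iff:
  assumes "w \<in> lists (letters \<Gamma>)"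
  shows "word_class \<Gamma> w = word_class \<Gamma> w' \<longleftrightarrow> word_eq \<Gamma> w w'"
proof
  assume "word_class \<Gamma> w = word_class \<Gamma> w'"
  then have "w \<in> word_class \<Gamma> w'" using word_eq.refl[OF assms] by (auto simp: word_class_def)
  then show "word_eq \<Gamma> w w'" by (simp add: word_class_def word_eq.sym)
next
  assume eq: "word_eq \<Gamma> w w'"
  have "word_eq \<Gamma> w x \<longleftrightarrow> word_eq \<Gamma> w' x" for x
    using word_eq.trans[OF eq] word_eq.trans[OF word_eq.sym[OF eq]] by auto
  then show "word_class \<Gamma> w = word_class \<Gamma> w'"
    by (simp add: word_class_def)
qed

lemma class_eqI: "word_eq \<Gamma> w w' \<Longrightarrow> word_class \<Gamma> w = word_class \<Gamma> w'"
  using class_eq_iff word_eq_lists by blast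

lemma path_group_mult:
  assumes "w \<in> lists (letters \<Gamma>)" "z \<in> lists (letters \<Gamma>)"
  shows "word_class \<Gamma> w \<otimes>\<^bsub>path_group \<Gamma>\<^esub> word_class \<Gamma> z = word_class \<Gamma> (w @ z)"
proof -
  have "word_class \<Gamma> (x @ y) = word_class \<Gamma> (w @ z)" if "x \<in> word_class \<Gamma> w" "y \<in> word_class \<Gamma> z" for x y
    using that by (intro class_eqI[symmetric] word_eq_append) (auto simp: word_class_def)
  moreover have "w \<in> word_class \<Gamma> w" "z \<in> word_class \<Gamma> z"
    using assms word_eq.refl by (auto simp: word_class_def)
  ultimately have "(\<Union>x\<in>word_class \<Gamma> w. \<Union>y\<in>word_class \<Gamma> z. word_class \<Gamma> (x @ y)) = word_class \<Gamma> (w @ z)"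
    by blast
  then show ?thesis by (simp add: path_group_def)
qed

abbreviation linv where "linv \<equiv> letter_inverse \<Gamma>"

abbreviation winv where "winv \<equiv> word_inverse \<Gamma>"

lemma winv_simps [simp]:
  "winv [] = []" "winv (l # w) = winv w @ [linv l]" "winv (w @ w') = winv w' @ winv w"
  by (simp_all add: word_inverse_def)

lemma linv_vletter [simp]: "v \<in> gverts \<Gamma> \<Longrightarrow> linv (vletter v k) = vletter v (- k)"
  using velem_add[of v "- k" k] by (simp add: vletter_def velem_zero group.inv_equality[OF group_vgroup])

lemma linv_letter: "l \<in> letters \<Gamma> \<Longrightarrow> linv l \<in> letters \<Gamma>"
  by (erule letter_cases) auto

lemma winv_lists [simp]: "w \<in> lists (letters \<Gamma>) \<Longrightarrow> winv w \<in> lists (letters \<Gamma>)"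
  by (induction w) (auto simp: linv_letter)

lemma linv_cancel:
  assumes "l \<in> letters \<Gamma>"
  shows "word_eq \<Gamma> [l, linv l] []" "word_eq \<Gamma> [linv l, l] []"
  using assms
proof (atomize (full), cases rule: letter_cases)
  case (1 v k)
  then show "word_eq \<Gamma> [l, linv l] [] \<and> word_eq \<Gamma> [linv l, l] []"
    using word_eq.trans[OF word_eq_vletter(1)[of v k "- k"], of "[]"] word_eq.trans[OF word_eq_vletter(1)[of v "- k" k], of "[]"]
      word_eq_vletter(2)[of v] by simp
next
  case (2 e)
  then show "word_eq \<Gamma> [l, linv l] [] \<and> word_eq \<Gamma> [linv l, l] []"
    using word_eq.edge_inv[of e \<Gamma>] word_eq.edge_inv[of "rev_arc \<Gamma> e" \<Gamma>] by simp
qed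

lemma word_eq_middle:
  assumes "word_eq \<Gamma> z z'" "p \<in> lists (letters \<Gamma>)" "q \<in> lists (letters \<Gamma>)" "word_eq \<Gamma> (p @ z' @ q) r"
  shows "word_eq \<Gamma> (p @ z @ q) r"
  using word_eq.trans[OF word_eq.cong[OF assms(1-3)] assms(4)] .

lemma winv_cancel:
  assumes "w \<in> lists (letters \<Gamma>)"
  shows "word_eq \<Gamma> (w @ winv w) [] \<and> word_eq \<Gamma> (winv w @ w) []"
  using assms
proof (induction w)
  case Nil
  show ?case using word_eq.refl[of "[]"] by simp
next
  case (Cons l w)
  have "word_eq \<Gamma> ((l # w) @ winv (l # w)) []"
    using word_eq_middle[of "w @ winv w" "[]" "[l]" "[linv l]" "[]"] linv_cancel(1)[of l] Cons linv_letter[of l]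
    by simp
  moreover have "word_eq \<Gamma> (winv (l # w) @ (l # w)) []"
    using word_eq_middle[OF linv_cancel(2)[of l], of "winv w" w "[]"] Cons by simp
  ultimately show ?case by blast
qed

lemma path_word_verts: "path_word \<Gamma> u w v \<Longrightarrow> u \<in> gverts \<Gamma> \<and> v \<in> gverts \<Gamma>"
proof (induction w arbitrary: u)
  case (Cons l w)
  then show ?case by (cases l) auto
qed auto

lemma path_word_lists: "path_word \<Gamma> u w v \<Longrightarrow> w \<in> lists (letters \<Gamma>)"
proof (induction w arbitrary: u)
  case (Cons l w)
  then show ?case using path_word_verts[OF Cons.prems] by (cases l) (auto simp: letters_def)
qed auto

lemma path_word_append: "path_word \<Gamma> u w t \<Longrightarrow> path_word \<Gamma> t w' v \<Longrightarrow> path_word \<Gamma> u (w @ w') v"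
proof (induction w arbitrary: u)
  case (Cons l w)
  then show ?case by (cases l) auto
qed auto

lemma path_word_vletter [simp]:
  "u \<in> gverts \<Gamma> \<Longrightarrow> path_word \<Gamma> u (vletter v k # w) t \<longleftrightarrow> u = v \<and> path_word \<Gamma> u w t"
  by (auto simp: vletter_def)

lemma path_word_cases [consumes 1, case_names Nil vletter Edg]:
  assumes "path_word \<Gamma> u w v"
  obtains "w = []" "u = v" "u \<in> gverts \<Gamma>"
  | k w' where "w = vletter u k # w'" "path_word \<Gamma> u w' v" "u \<in> gverts \<Gamma>"
  | e w' where "w = Edg e # w'" "e \<in> garcs \<Gamma>" "gtail \<Gamma> e = u" "path_word \<Gamma> (ghead \<Gamma> e) w' v"
proof (cases w)
  case (Cons l w')
  show ?thesis
  proof (cases l)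
    case (Vtx t x)
    have "u \<in> gverts \<Gamma>" using path_word_verts[OF assms] by simp
    then show ?thesis using assms that(2)[of "vcoord u x" w'] Vtx Cons by (simp add: vletter_def)
  qed (use assms that Cons in auto)
qed (use assms that in auto)

lemma path_word_induct [consumes 1, case_names Nil vletter Edg]:
  assumes "path_word \<Gamma> u w v"
    and "v \<in> gverts \<Gamma> \<Longrightarrow> P v []"
    and "\<And>u k w. u \<in> gverts \<Gamma> \<Longrightarrow> path_word \<Gamma> u w v \<Longrightarrow> P u w \<Longrightarrow> P u (vletter u k # w)"
    and "\<And>e w. e \<in> garcs \<Gamma> \<Longrightarrow> path_word \<Gamma> (ghead \<Gamma> e) w v \<Longrightarrow> P (ghead \<Gamma> e) w \<Longrightarrow> P (gtail \<Gamma> e) (Edg e # w)"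
  shows "P u w"
  using assms(1)
proof (induction w arbitrary: u)
  case Nil
  then show ?case using assms(2) by auto
next
  case (Cons l w)
  show ?case using Cons.prems
    by (cases rule: path_word_cases) (use Cons.IH assms(3,4) in auto)
qed

lemma path_word_winv: "path_word \<Gamma> u w v \<Longrightarrow> path_word \<Gamma> v (winv w) u"
proof (induction rule: path_word_induct)
  case (vletter u k w)
  then show ?case by (auto intro!: path_word_append[of _ _ u])
next
  case (Edg e w)
  then show ?case by (auto intro!: path_word_append[of _ _ "ghead \<Gamma> e"])
qed auto

end

section \<open>The affine representation\<close>

text \<open>Among the cosets of the powers 0 to c of \<open>x\<close>, with c the index, two
  coincide, so some power of \<open>x\<close> with positive exponent at most c lies in
  \<open>H\<close>. The factorial of c is a multiple of all these exponents and serves every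
  \<open>x\<close> at once, also when \<open>H\<close> is not normal.\<close>

lemma finite_index_power:
  fixes G :: "'a monoid" (structure)
  assumes "group G" and index: "finite_index_subgroup H G"
  shows "\<exists>m>(0::nat). \<forall>x\<in>carrier G. x [^] m \<in> H"
proof (intro exI conjI ballI)
  interpret group G by fact
  let ?c = "card (rcosets H)"
  have H: "subgroup H G" and fin: "finite (rcosets H)"
    using index by (auto simp: finite_index_subgroup_def)
  show "fact ?c > (0::nat)" by simp
  fix x assume x: "x \<in> carrier G"
  let ?f = "\<lambda>i::nat. H #> x [^] i"
  have "?f ` {0..?c} \<subseteq> rcosets H"
    using x subgroup.subset[OF H] by (auto intro: rcosetsI)
  then have "card (?f ` {0..?c}) < card {0..?c}"
    using card_mono[OF fin] by (simp add: less_Suc_eq_le)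
  then have "\<not> inj_on ?f {0..?c}" by (rule pigeonhole)
  then obtain i j where ij: "i < j" "j \<le> ?c" "?f i = ?f j"
    by (auto simp: inj_on_def) (metis linorder_neqE_nat)
  have "x [^] j \<in> H #> x [^] i"
    using ij rcos_self[OF _ H, of "x [^] j"] x by simp
  then obtain h where h: "h \<in> H" "x [^] j = h \<otimes> x [^] i" by (auto simp: r_coset_def)
  have "x [^] (j - i) \<otimes> x [^] i = x [^] j" using x ij by (simp add: nat_pow_mult)
  then have e: "x [^] (j - i) = h" using h x subgroup.mem_carrier[OF H] by auto
  have "(j - i) dvd fact ?c" using ij by (intro dvd_fact) auto
  then obtain q where q: "fact ?c = (j - i) * q" by (auto simp: dvd_def)
  have "x [^] (fact ?c :: nat) = h [^] q" using x e q by (simp add: nat_pow_pow[symmetric])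
  moreover have "h [^] q \<in> H"
    using h(1) by (induction q) (auto intro: subgroup.m_closed[OF H] subgroup.one_closed[OF H])
  ultimately show "x [^] (fact ?c :: nat) \<in> H" by simp
qed

context gbs_graph_of_groups
begin

definition letter_affine :: "('v, 'e, 'g) letter \<Rightarrow> rat ^ 'n \<Rightarrow> rat ^ 'n" where
  "letter_affine l z = (case l of Vtx v x \<Rightarrow> z + ratvec (vcoord v x) | Edg e \<Rightarrow> edge_matrix e *v z)"

definition letter_linear :: "('v, 'e, 'g) letter \<Rightarrow> rat ^ 'n ^ 'n" where
  "letter_linear l = (case l of Vtx v x \<Rightarrow> mat 1 | Edg e \<Rightarrow> edge_matrix e)"

definition aff :: "('v, 'e, 'g) letter list \<Rightarrow> rat ^ 'n \<Rightarrow> rat ^ 'n" where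
  "aff w = foldr letter_affine w"

definition lin :: "('v, 'e, 'g) letter list \<Rightarrow> rat ^ 'n ^ 'n" where
  "lin w = foldr (\<lambda>l M. letter_linear l ** M) w (mat 1)"

lemma letter_affine_simps [simp]:
  "v \<in> gverts \<Gamma> \<Longrightarrow> letter_affine (vletter v k) z = z + ratvec k" "letter_affine (Edg e) z = edge_matrix e *v z"
  by (simp_all add: letter_affine_def vletter_def)

lemma aff_simps [simp]: "aff [] z = z" "aff (l # w) z = letter_affine l (aff w z)"
    "aff (w @ w') z = aff w (aff w' z)"
  by (simp_all add: aff_def)

lemma lin_simps [simp]: "lin [] = mat 1" "lin (l # w) = letter_linear l ** lin w"
  by (simp_all add: lin_def)

lemma lin_append [simp]: "lin (w @ w') = lin w ** lin w'"
  by (induction w) (simp_all add: matrix_mul_assoc)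

text \<open>The edge relation amounts to \<open>edge_matrix e\<close> intertwining the two
  inclusions of the edge group.\<close>

lemma aff_word_eq:
  assumes "word_eq \<Gamma> w w'"
  shows "aff w = aff w'"
proof
  fix z
  show "aff w z = aff w' z"
    unfolding aff_def
  proof (rule foldr_word_eq[OF assms, of UNIV])
    fix e x and y :: "rat ^ 'n" assume e: "e \<in> garcs \<Gamma>"
    then show "letter_affine (Edg e) (letter_affine (vletter (ghead \<Gamma> e) (incl e x)) (letter_affine (Edg (rev_arc \<Gamma> e)) y))
        = letter_affine (vletter (gtail \<Gamma> e) (incl (rev_arc \<Gamma> e) x)) y"
      by (simp add: matrix_vector_right_distrib edge_matrix edge_matrix_rev)
  qed (auto simp: ratvec_add edge_matrix_rev algebra_simps)
qed

lemma aff_eq_lin: "aff w z = lin w *v z + aff w 0"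
proof (induction w)
  case (Cons l w)
  then show ?case
    by (cases l) (simp_all add: letter_affine_def letter_linear_def matrix_vector_right_distrib
        matrix_vector_mul_assoc[symmetric])
qed simp

lemma lin_word_eq:
  assumes "word_eq \<Gamma> w w'"
  shows "lin w = lin w'"
proof -
  have "lin w *v z = lin w' *v z" for z
    using aff_word_eq[OF assms] aff_eq_lin[of w z] aff_eq_lin[of w' z] by simp
  then show ?thesis by (simp add: matrix_eq)
qed

lemma invertible_lin: "w \<in> lists (letters \<Gamma>) \<Longrightarrow> invertible (lin w)"
proof (induction w)
  case Nil
  then show ?case using invertible_def matrix_mul_lid by fastforce
next
  case (Cons l w)
  have "invertible (mat 1 :: rat ^ 'n ^ 'n)" using invertible_def matrix_mul_lid by fastforce
  then show ?case using Cons edge_matrix(1)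
    by (cases l) (auto simp: letter_linear_def letters_def intro!: invertible_mult)
qed

section \<open>The group F(\<Gamma>) and the representation induced on it\<close>

abbreviation F where "F \<equiv> path_group \<Gamma>"

abbreviation F_mult (infixl "\<cdot>" 70) where "X \<cdot> Y \<equiv> X \<otimes>\<^bsub>path_group \<Gamma>\<^esub> Y"

lemma carrier_F: "carrier F = word_class \<Gamma> ` lists (letters \<Gamma>)"
  and one_F: "\<one>\<^bsub>F\<^esub> = word_class \<Gamma> []"
  by (simp_all add: path_group_def)

lemma F_cases:
  assumes "X \<in> carrier F"
  obtains w where "w \<in> lists (letters \<Gamma>)" "X = word_class \<Gamma> w"
  using assms unfolding carrier_F by blast

lemma class_in_F [simp]: "w \<in> lists (letters \<Gamma>) \<Longrightarrow> word_class \<Gamma> w \<in> carrier F"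
  by (simp add: carrier_F)

lemma group_F: "group F"
proof (rule groupI)
  show "x \<cdot> y \<in> carrier F" if "x \<in> carrier F" "y \<in> carrier F" for x y
    using that by (elim F_cases) (simp add: path_group_mult)
  show "\<one>\<^bsub>F\<^esub> \<in> carrier F" by (simp add: one_F)
  show "x \<cdot> y \<cdot> z = x \<cdot> (y \<cdot> z)"
    if "x \<in> carrier F" "y \<in> carrier F" "z \<in> carrier F" for x y z
    using that by (elim F_cases) (simp add: path_group_mult)
  show "\<one>\<^bsub>F\<^esub> \<cdot> x = x" if "x \<in> carrier F" for x
    using that by (elim F_cases) (simp add: one_F path_group_mult)
  show "\<exists>y\<in>carrier F. y \<cdot> x = \<one>\<^bsub>F\<^esub>" if x: "x \<in> carrier F" for x
  proof -
    obtain w where w: "x = word_class \<Gamma> w" "w \<in> lists (letters \<Gamma>)" using x by (auto simp: carrier_F)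
    then have "word_class \<Gamma> (winv w) \<cdot> x = \<one>\<^bsub>F\<^esub>"
      using winv_cancel[OF w(2)] by (simp add: path_group_mult one_F class_eqI)
    then show ?thesis using w by (intro bexI[of _ "word_class \<Gamma> (winv w)"]) auto
  qed
qed

sublocale F: group F by (rule group_F)

lemma inv_F:
  assumes "w \<in> lists (letters \<Gamma>)"
  shows "inv\<^bsub>F\<^esub> (word_class \<Gamma> w) = word_class \<Gamma> (winv w)"
  using winv_cancel[OF assms] assms by (intro F.inv_equality) (auto simp: path_group_mult one_F class_eqI)

definition caff :: "('v, 'e, 'g) letter list set \<Rightarrow> rat ^ 'n \<Rightarrow> rat ^ 'n" where
  "caff X = aff (SOME w. w \<in> X)"

definition clin :: "('v, 'e, 'g) letter list set \<Rightarrow> rat ^ 'n ^ 'n" where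
  "clin X = lin (SOME w. w \<in> X)"

lemma word_eq_some: "w \<in> lists (letters \<Gamma>) \<Longrightarrow> word_eq \<Gamma> w (SOME w'. w' \<in> word_class \<Gamma> w)"
  using someI[of "\<lambda>w'. word_eq \<Gamma> w w'" w] word_eq.refl[of w \<Gamma>] by (simp add: word_class_def)

lemma caff_class [simp]: "w \<in> lists (letters \<Gamma>) \<Longrightarrow> caff (word_class \<Gamma> w) = aff w"
  and clin_class [simp]: "w \<in> lists (letters \<Gamma>) \<Longrightarrow> clin (word_class \<Gamma> w) = lin w"
  unfolding caff_def clin_def using aff_word_eq lin_word_eq word_eq_some by metis+

lemma caff_mult: "X \<in> carrier F \<Longrightarrow> Y \<in> carrier F \<Longrightarrow> caff (X \<cdot> Y) z = caff X (caff Y z)"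
  and clin_mult: "X \<in> carrier F \<Longrightarrow> Y \<in> carrier F \<Longrightarrow> clin (X \<cdot> Y) = clin X ** clin Y"
  and caff_eq_clin: "X \<in> carrier F \<Longrightarrow> caff X z = clin X *v z + caff X 0"
  and invertible_clin: "X \<in> carrier F \<Longrightarrow> invertible (clin X)"
  by (elim F_cases; simp add: path_group_mult invertible_lin aff_eq_lin[symmetric])+

lemma caff_one: "caff \<one>\<^bsub>F\<^esub> z = z" and clin_one: "clin \<one>\<^bsub>F\<^esub> = mat 1"
  by (simp_all add: one_F)

lemma clin_inv:
  assumes "X \<in> carrier F"
  shows "clin (inv\<^bsub>F\<^esub> X) ** clin X = mat 1" "clin X ** clin (inv\<^bsub>F\<^esub> X) = mat 1"
  using assms by (simp_all add: clin_one flip: clin_mult)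

lemma caff_inv:
  assumes "X \<in> carrier F"
  shows "caff (inv\<^bsub>F\<^esub> X) (caff X z) = z" "caff X (caff (inv\<^bsub>F\<^esub> X) z) = z"
  using assms by (simp_all add: caff_one flip: caff_mult)

definition vclass :: "'v \<Rightarrow> int ^ 'n \<Rightarrow> ('v, 'e, 'g) letter list set" where
  "vclass v k = word_class \<Gamma> [vletter v k]"

lemma vclass_in [simp]: "v \<in> gverts \<Gamma> \<Longrightarrow> vclass v k \<in> carrier F"
  by (simp add: vclass_def)

lemma vclass_add: "v \<in> gverts \<Gamma> \<Longrightarrow> vclass v (k + l) = vclass v k \<cdot> vclass v l"
  using class_eqI[OF word_eq_vletter(1)[of v k l]] by (simp add: vclass_def path_group_mult)

lemma vclass_zero: "v \<in> gverts \<Gamma> \<Longrightarrow> vclass v 0 = \<one>\<^bsub>F\<^esub>"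
  using class_eqI[OF word_eq_vletter(2)[of v]] by (simp add: vclass_def one_F)

lemma caff_vclass [simp]: "v \<in> gverts \<Gamma> \<Longrightarrow> caff (vclass v k) z = z + ratvec k"
  and clin_vclass [simp]: "v \<in> gverts \<Gamma> \<Longrightarrow> clin (vclass v k) = mat 1"
  by (simp_all add: vclass_def) (simp add: letter_linear_def vletter_def)

lemma vertex_subgroup_eq:
  assumes "v \<in> gverts \<Gamma>"
  shows "vertex_subgroup \<Gamma> v = range (vclass v)"
proof -
  have "x \<in> range (velem v)" if "x \<in> carrier (vgroup \<Gamma> v)" for x
    using velem(3)[OF assms that] rangeI[of "velem v" "vcoord v x"] by simp
  then have "carrier (vgroup \<Gamma> v) = range (velem v)" using assms by auto
  then show ?thesis by (simp add: vertex_subgroup_def vclass_def vletter_def image_image)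
qed

text \<open>Conjugating a translation by an affine map applies the linear part to the translation
  vector.\<close>

lemma caff_conj_vclass:
  assumes "X \<in> carrier F" "v \<in> gverts \<Gamma>"
  shows "caff (X \<cdot> vclass v k \<cdot> inv\<^bsub>F\<^esub> X) z = z + clin X *v ratvec k"
proof -
  have "caff (X \<cdot> vclass v k \<cdot> inv\<^bsub>F\<^esub> X) z = caff X (caff (inv\<^bsub>F\<^esub> X) z + ratvec k)"
    using assms by (simp add: caff_mult)
  also have "\<dots> = caff X (caff (inv\<^bsub>F\<^esub> X) z) + clin X *v ratvec k"
    using caff_eq_clin[OF assms(1), of "caff (inv\<^bsub>F\<^esub> X) z + ratvec k"] caff_eq_clin[OF assms(1), of "caff (inv\<^bsub>F\<^esub> X) z"]
    by (simp add: matrix_vector_right_distrib)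
  finally show ?thesis using assms by (simp add: caff_inv)
qed

text \<open>Conjugation along a path commensurates the vertex groups at its ends. A vertex letter
  acts trivially, since the vertex group is abelian; to cross an arc the element must first be
  brought into the image of the edge group, which costs one factor per arc.\<close>

lemma path_conj_multiple:
  assumes "path_word \<Gamma> u w v"
  shows "\<exists>m>0. \<forall>k. \<exists>l. word_class \<Gamma> w \<cdot> vclass v (int m *s k) \<cdot> inv\<^bsub>F\<^esub> (word_class \<Gamma> w) = vclass u l"
  using assms
proof (induction rule: path_word_induct)
  case Nil
  have "\<exists>l. word_class \<Gamma> [] \<cdot> vclass v (int 1 *s k) \<cdot> inv\<^bsub>F\<^esub> (word_class \<Gamma> []) = vclass v l" for k
    using Nil by (simp add: one_F[symmetric] exI[of _ k])
  then show ?case using zero_less_one by blast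
next
  case (vletter u k' w)
  have v: "v \<in> gverts \<Gamma>" and w: "w \<in> lists (letters \<Gamma>)" using path_word_verts path_word_lists vletter by blast+
  obtain m where m: "m > 0"
    "\<And>k. \<exists>l. word_class \<Gamma> w \<cdot> vclass v (int m *s k) \<cdot> inv\<^bsub>F\<^esub> (word_class \<Gamma> w) = vclass u l"
    using vletter.IH by blast
  have e: "word_class \<Gamma> (vletter u k' # w) = vclass u k' \<cdot> word_class \<Gamma> w"
    using vletter w by (simp add: vclass_def path_group_mult)
  have "\<exists>l. word_class \<Gamma> (vletter u k' # w) \<cdot> vclass v (int m *s k) \<cdot> inv\<^bsub>F\<^esub> (word_class \<Gamma> (vletter u k' # w)) = vclass u l" for k
  proof -
    obtain l where l: "word_class \<Gamma> w \<cdot> vclass v (int m *s k) \<cdot> inv\<^bsub>F\<^esub> (word_class \<Gamma> w) = vclass u l"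
      using m by blast
    have "word_class \<Gamma> (vletter u k' # w) \<cdot> vclass v (int m *s k) \<cdot> inv\<^bsub>F\<^esub> (word_class \<Gamma> (vletter u k' # w))
      = vclass u k' \<cdot> (word_class \<Gamma> w \<cdot> vclass v (int m *s k) \<cdot> inv\<^bsub>F\<^esub> (word_class \<Gamma> w)) \<cdot> inv\<^bsub>F\<^esub> (vclass u k')"
      using vletter w v unfolding e by (simp add: F.m_assoc F.inv_mult_group)
    also have "\<dots> = vclass u l \<cdot> vclass u k' \<cdot> inv\<^bsub>F\<^esub> (vclass u k')"
      unfolding l using vletter by (simp add: add.commute flip: vclass_add)
    finally show ?thesis using vletter by (auto simp: F.m_assoc)
  qed
  then show ?case using m by blast
next
  case (Edg e w)
  have v: "v \<in> gverts \<Gamma>" and w: "w \<in> lists (letters \<Gamma>)" using path_word_verts path_word_lists Edg by blast+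
  let ?w = "word_class \<Gamma> w" and ?e = "word_class \<Gamma> [Edg e]"
  have in_F: "?w \<in> carrier F" "?e \<in> carrier F" using w Edg by auto
  obtain m where m: "m > 0"
    "\<And>k. \<exists>l. ?w \<cdot> vclass v (int m *s k) \<cdot> inv\<^bsub>F\<^esub> ?w = vclass (ghead \<Gamma> e) l"
    using Edg.IH by blast
  obtain m' :: nat where m': "m' > 0" "\<And>x. \<exists>y. incl e y = int m' *s x"
    using inj_additive_image_contains_multiples[OF incl_add inj_incl] Edg by blast
  have conj: "?e \<cdot> vclass (ghead \<Gamma> e) (incl e y) \<cdot> inv\<^bsub>F\<^esub> ?e = vclass (gtail \<Gamma> e) (incl (rev_arc \<Gamma> e) y)" for y
    using class_eqI[OF word_eq_edge[OF Edg(1), of y]] Edg(1) by (simp add: vclass_def path_group_mult inv_F)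
  have e: "word_class \<Gamma> (Edg e # w) = ?e \<cdot> ?w"
    using Edg w by (simp add: path_group_mult)
  have "\<exists>l. word_class \<Gamma> (Edg e # w) \<cdot> vclass v (int (m * m') *s k) \<cdot> inv\<^bsub>F\<^esub> (word_class \<Gamma> (Edg e # w)) = vclass (gtail \<Gamma> e) l" for k
  proof -
    obtain l where l: "?w \<cdot> vclass v (int m *s k) \<cdot> inv\<^bsub>F\<^esub> ?w = vclass (ghead \<Gamma> e) l"
      using m by blast
    obtain l' where l': "?w \<cdot> vclass v (int m *s (int m' *s k)) \<cdot> inv\<^bsub>F\<^esub> ?w = vclass (ghead \<Gamma> e) l'"
      using m by blast
    have "ratvec l' = clin ?w *v ratvec (int m *s (int m' *s k))" "ratvec l = clin ?w *v ratvec (int m *s k)"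
      using caff_conj_vclass[OF in_F(1) v, of "int m *s (int m' *s k)" 0] caff_conj_vclass[OF in_F(1) v, of "int m *s k" 0] l l'
        Edg(1) by simp_all
    \<comment> \<open>Vertex elements are determined by their translation vectors, so the two
      conjugates are compared there, using linearity.\<close>
    then have "ratvec l' = ratvec (int m' *s l)"
      by (simp add: ratvec_scale vector_scalar_commute mult.commute)
    then obtain y where y: "l' = incl e y" using m'(2)[of l] by (metis ratvec_eq_iff)
    have mm: "int (m * m') *s k = int m *s (int m' *s k)" by simp
    have "word_class \<Gamma> (Edg e # w) \<cdot> vclass v (int (m * m') *s k) \<cdot> inv\<^bsub>F\<^esub> (word_class \<Gamma> (Edg e # w))
      = ?e \<cdot> (?w \<cdot> vclass v (int m *s (int m' *s k)) \<cdot> inv\<^bsub>F\<^esub> ?w) \<cdot> inv\<^bsub>F\<^esub> ?e"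
      using in_F v unfolding e mm by (simp add: F.m_assoc F.inv_mult_group)
    also have "\<dots> = vclass (gtail \<Gamma> e) (incl (rev_arc \<Gamma> e) y)"
      unfolding l' y conj ..
    finally show ?thesis by blast
  qed
  then show ?case using m m' by (intro exI[of _ "m * m'"]) auto
qed

end

section \<open>The modular homomorphism\<close>

lemma int_Suc_scale: "int (Suc n) *s k = int n *s k + (k :: int ^ 'n)"
  by (simp add: vec_eq_iff algebra_simps)

context gbs_graph_of_groups
begin

definition vconj :: "('v, 'e, 'g) letter list set \<Rightarrow> 'v \<Rightarrow> int ^ 'n \<Rightarrow> ('v, 'e, 'g) letter list set" where
  "vconj c v k = c \<cdot> vclass v k \<cdot> inv\<^bsub>F\<^esub> c"

lemma vconj_in [simp]: "c \<in> carrier F \<Longrightarrow> v \<in> gverts \<Gamma> \<Longrightarrow> vconj c v k \<in> carrier F"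
  by (simp add: vconj_def)

lemma vconj_add: "c \<in> carrier F \<Longrightarrow> v \<in> gverts \<Gamma> \<Longrightarrow> vconj c v (k + l) = vconj c v k \<cdot> vconj c v l"
  by (simp add: vconj_def vclass_add F.m_assoc)

lemma vconj_zero: "c \<in> carrier F \<Longrightarrow> v \<in> gverts \<Gamma> \<Longrightarrow> vconj c v 0 = \<one>\<^bsub>F\<^esub>"
  by (simp add: vconj_def vclass_zero)

lemma vconj_minus:
  assumes "c \<in> carrier F" "v \<in> gverts \<Gamma>"
  shows "vconj c v (- k) = inv\<^bsub>F\<^esub> (vconj c v k)"
  using vconj_add[OF assms, of "- k" k] assms by (simp add: vconj_zero F.inv_equality)

lemma vconj_pow: "c \<in> carrier F \<Longrightarrow> v \<in> gverts \<Gamma> \<Longrightarrow> vconj c v (int m *s k) = vconj c v k [^]\<^bsub>F\<^esub> m"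
proof (induction m)
  case (Suc m)
  then show ?case by (simp only: int_Suc_scale vconj_add F.nat_pow_Suc)
qed (simp add: vconj_zero)

lemma caff_vconj: "c \<in> carrier F \<Longrightarrow> v \<in> gverts \<Gamma> \<Longrightarrow> caff (vconj c v k) z = z + clin c *v ratvec k"
  unfolding vconj_def by (rule caff_conj_vclass)

lemma path_classes_cases:
  assumes "X \<in> path_classes \<Gamma> u v"
  obtains w where "path_word \<Gamma> u w v" "X = word_class \<Gamma> w" "w \<in> lists (letters \<Gamma>)"
  using assms path_word_lists unfolding path_classes_def by blast

lemma path_classesI: "path_word \<Gamma> u w v \<Longrightarrow> word_class \<Gamma> w \<in> path_classes \<Gamma> u v"
  unfolding path_classes_def by blast

lemma path_classes_F: "X \<in> path_classes \<Gamma> u v \<Longrightarrow> X \<in> carrier F"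
  by (erule path_classes_cases) simp

lemma path_classes_mult:
  "X \<in> path_classes \<Gamma> u v \<Longrightarrow> Y \<in> path_classes \<Gamma> v t \<Longrightarrow> X \<cdot> Y \<in> path_classes \<Gamma> u t"
  by (elim path_classes_cases) (simp add: path_group_mult path_classesI path_word_append)

lemma path_classes_inv: "X \<in> path_classes \<Gamma> u v \<Longrightarrow> inv\<^bsub>F\<^esub> X \<in> path_classes \<Gamma> v u"
  by (elim path_classes_cases) (simp add: inv_F path_classesI path_word_winv)

lemma path_classes_vclass: "v \<in> gverts \<Gamma> \<Longrightarrow> vclass v k \<in> path_classes \<Gamma> v v"
  unfolding vclass_def by (intro path_classesI) simp

lemma path_classes_verts: "X \<in> path_classes \<Gamma> u v \<Longrightarrow> u \<in> gverts \<Gamma> \<and> v \<in> gverts \<Gamma>"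
  by (elim path_classes_cases) (rule path_word_verts)

lemma vconj_path_classes: "c \<in> path_classes \<Gamma> u v \<Longrightarrow> vconj c v k \<in> path_classes \<Gamma> u u"
  unfolding vconj_def using path_classes_verts
  by (blast intro: path_classes_mult path_classes_inv path_classes_vclass)

lemma subgroup_path_classes:
  assumes "u \<in> gverts \<Gamma>"
  shows "subgroup (path_classes \<Gamma> u u) F"
proof (rule subgroup.intro)
  show "\<one>\<^bsub>F\<^esub> \<in> path_classes \<Gamma> u u" using path_classes_vclass[OF assms, of 0] by (simp add: vclass_zero assms)
qed (auto intro: path_classes_F path_classes_mult path_classes_inv)

end

locale gbs_basis = gbs_graph_of_groups \<Gamma> dim
  for \<Gamma> :: "('v, 'e, 'g, 'h) graph_of_groups" and dim :: "'n::finite itself" +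
  fixes P :: 'v and v0 :: "('v, 'e, 'g) tree_vertex" and A :: "('v, 'e, 'g) letter list set set"
    and a :: "'n \<Rightarrow> ('v, 'e, 'g) letter list set"
  assumes P: "P \<in> gverts \<Gamma>"
    and base: "base_Zn_subgroup dim \<Gamma> P v0 A"
    and basis: "ordered_basis (fundamental_group \<Gamma> P) A a"
begin

abbreviation G where "G \<equiv> fundamental_group \<Gamma> P"

lemma G_simps [simp]:
  "carrier G = path_classes \<Gamma> P P" "X \<otimes>\<^bsub>G\<^esub> Y = X \<cdot> Y" "\<one>\<^bsub>G\<^esub> = \<one>\<^bsub>F\<^esub>" "X [^]\<^bsub>G\<^esub> (n::nat) = X [^]\<^bsub>F\<^esub> n"
  by (simp_all add: fundamental_group_def nat_pow_def)

lemma subgroup_G: "subgroup (carrier G) F"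
  using subgroup_path_classes[OF P] by simp

lemma G_eq: "G = F\<lparr>carrier := carrier G\<rparr>"
  by (simp add: fundamental_group_def)

lemma group_G: "group G"
  by (subst G_eq) (rule F.subgroup_imp_group[OF subgroup_G])

sublocale G: group G by (rule group_G)

lemma inv_G: "X \<in> carrier G \<Longrightarrow> inv\<^bsub>G\<^esub> X = inv\<^bsub>F\<^esub> X"
  using F.m_inv_consistent[OF subgroup_G, of X] by (simp only: G_eq[symmetric])

lemma G_in_F: "X \<in> carrier G \<Longrightarrow> X \<in> carrier F"
  using path_classes_F by simp

text \<open>An element stabilizes the coset of \<open>c\<close> exactly if its conjugate by c^-1
  lies in the vertex group, so the stabilizer is a conjugate of that group.\<close>

lemma stabilizer_eq:
  obtains c v where "c \<in> path_classes \<Gamma> P v" "v \<in> gverts \<Gamma>" "tree_stabilizer \<Gamma> P v0 = range (vconj c v)"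
proof -
  obtain v c where v: "v \<in> gverts \<Gamma>" and c: "c \<in> path_classes \<Gamma> P v"
    and v0: "v0 = (v, c <#\<^bsub>F\<^esub> vertex_subgroup \<Gamma> v)"
    using base unfolding base_Zn_subgroup_def tree_vertices_def by auto
  have cF: "c \<in> carrier F" using path_classes_F c by blast
  let ?C = "c <#\<^bsub>F\<^esub> vertex_subgroup \<Gamma> v"
  have l_range: "X <#\<^bsub>F\<^esub> range f = range (\<lambda>k. X \<cdot> f k)" for X and f :: "int ^ 'n \<Rightarrow> _"
    by (auto simp: l_coset_def)
  have C: "?C = range (\<lambda>k. c \<cdot> vclass v k)"
    by (simp add: l_range vertex_subgroup_eq[OF v])
  have "X \<in> range (vconj c v)" if X: "X \<in> carrier G" "X <#\<^bsub>F\<^esub> ?C = ?C" for X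
  proof -
    have "c \<in> range (\<lambda>k. c \<cdot> vclass v k)"
      using cF vclass_zero[OF v] rangeI[of "\<lambda>k. c \<cdot> vclass v k" 0] by simp
    then have "X \<cdot> c \<in> X <#\<^bsub>F\<^esub> ?C"
      unfolding C by (subst l_coset_def) blast
    then have "X \<cdot> c \<in> range (\<lambda>k. c \<cdot> vclass v k)" using X(2) C by simp
    then obtain k where k: "X \<cdot> c = c \<cdot> vclass v k" by blast
    have "X = X \<cdot> c \<cdot> inv\<^bsub>F\<^esub> c" using G_in_F[OF X(1)] cF by (simp add: F.m_assoc)
    then show ?thesis unfolding k vconj_def by blast
  qed
  moreover have "vconj c v k \<in> carrier G \<and> vconj c v k <#\<^bsub>F\<^esub> ?C = ?C" for k
  proof
    show "vconj c v k \<in> carrier G" using vconj_path_classes[OF c] by simp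
    have e: "vconj c v k \<cdot> (c \<cdot> vclass v l) = c \<cdot> vclass v (k + l)" for l
      using cF v by (simp add: vconj_def F.m_assoc vclass_add)
    have "vconj c v k <#\<^bsub>F\<^esub> ?C = range (\<lambda>l. c \<cdot> vclass v (k + l))"
      unfolding C l_range e ..
    also have "\<dots> = (\<lambda>l. c \<cdot> vclass v l) ` range (\<lambda>l. k + l)" by (simp only: image_image)
    also have "range (\<lambda>l. k + l) = UNIV" by (intro surjI[of _ "\<lambda>l. l - k"]) simp
    finally show "vconj c v k <#\<^bsub>F\<^esub> ?C = ?C" by (simp add: C)
  qed
  ultimately have "tree_stabilizer \<Gamma> P v0 = range (vconj c v)"
    unfolding tree_stabilizer_def stabilizer_def tree_action_def v0 by auto
  then show ?thesis using that c v by blast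
qed

definition comb :: "int ^ 'n \<Rightarrow> ('v, 'e, 'g) letter list set" where
  "comb k = int_comb G A a (\<lambda>i. k $ i)"

lemma comb_inj: "inj comb" and comb_range: "range comb = A"
proof -
  have b: "bij_betw (int_comb G A a) UNIV A" using basis by (simp add: ordered_basis_def)
  have "bij_betw (\<lambda>x i. x $ i) (UNIV :: (int ^ 'n) set) UNIV"
    by (rule bij_betw_byWitness[of _ "\<lambda>f. \<chi> i. f i"]) auto
  from bij_betw_trans[OF this b] have "bij_betw comb UNIV A"
    by (simp add: comb_def[abs_def] o_def)
  then show "inj comb" "range comb = A" by (auto simp: bij_betw_def)
qed

text \<open>\<open>A\<close> lies with finite index in a stabilizer, that is, in the vertex group at
  \<open>v\<close> conjugated by \<open>c\<close>. \<open>K\<close> turns coordinates with respect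
  to \<open>a\<close> into coordinates of that vertex group, and the final multiple \<open>m\<close>
  expresses the finite index.\<close>

lemma subgroup_A: "subgroup A G"
  and comb_structure: "\<exists>c v K. c \<in> path_classes \<Gamma> P v \<and> v \<in> gverts \<Gamma> \<and> (\<forall>k l. K (k + l) = K k + K l) \<and>
    (\<forall>k. comb k = vconj c v (K k)) \<and> (\<forall>j. a j = vconj c v (K (axis j 1))) \<and>
    (\<exists>m>0. \<forall>k. vconj c v (int m *s k) \<in> A)"
proof -
  obtain c v where c: "c \<in> path_classes \<Gamma> P v" and v: "v \<in> gverts \<Gamma>"
    and S: "tree_stabilizer \<Gamma> P v0 = range (vconj c v)" by (rule stabilizer_eq)
  let ?S = "range (vconj c v)"
  have cF: "c \<in> carrier F" using path_classes_F c by blast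
  have S_G: "subgroup ?S G"
  proof (rule G.subgroupI)
    show "?S \<subseteq> carrier G" using vconj_path_classes[OF c] by auto
    show "inv\<^bsub>G\<^esub> X \<in> ?S" if "X \<in> ?S" for X
      using that vconj_path_classes[OF c] vconj_minus[OF cF v] by (auto simp: inv_G) (metis rangeI)
    show "X \<otimes>\<^bsub>G\<^esub> Y \<in> ?S" if "X \<in> ?S" "Y \<in> ?S" for X Y
      using that by (auto simp: vconj_add[OF cF v, symmetric])
  qed auto
  have fi: "finite_index_subgroup A (G\<lparr>carrier := ?S\<rparr>)"
    using base unfolding base_Zn_subgroup_def S by blast
  then have A_S: "subgroup A (G\<lparr>carrier := ?S\<rparr>)" by (simp add: finite_index_subgroup_def)
  show A_G: "subgroup A G" by (rule G.incl_subgroup[OF S_G A_S])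
  have AS: "A \<subseteq> ?S" using subgroup.subset[OF A_S] by simp
  interpret GA: comm_group "G\<lparr>carrier := A\<rparr>"
  proof (rule group.group_comm_groupI[OF G.subgroup_imp_group[OF A_G]])
    fix X Y assume "X \<in> carrier (G\<lparr>carrier := A\<rparr>)" "Y \<in> carrier (G\<lparr>carrier := A\<rparr>)"
    then have "X \<in> ?S" "Y \<in> ?S" using AS by auto
    then show "X \<otimes>\<^bsub>G\<lparr>carrier := A\<rparr>\<^esub> Y = Y \<otimes>\<^bsub>G\<lparr>carrier := A\<rparr>\<^esub> X"
      by (auto simp: vconj_add[OF cF v, symmetric] add.commute)
  qed
  have aA: "a j \<in> A" for j using basis by (auto simp: ordered_basis_def)
  then have "\<exists>\<kappa>. a j = vconj c v \<kappa>" for j using AS by blast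
  then obtain \<kappa> where \<kappa>: "\<And>j. a j = vconj c v (\<kappa> j)" by metis
  \<comment> \<open>The product of powers of the \<open>a i\<close> corresponds, inside the abelian
    stabilizer, to this sum of their vertex coordinates \<open>\<kappa> i\<close>.\<close>
  define K where "K k = (\<Sum>i\<in>UNIV. k $ i *s \<kappa> i)" for k :: "int ^ 'n"
  have pw: "a j [^]\<^bsub>G\<^esub> (z::int) = vconj c v (z *s \<kappa> j)" for j z
  proof (cases z)
    case (nonneg n)
    then show ?thesis by (simp add: int_pow_int \<kappa> vconj_pow[OF cF v, symmetric])
  next
    case (neg n)
    have "z *s \<kappa> j = - (int (Suc n) *s \<kappa> j)" by (simp add: neg vec_eq_iff)
    moreover have "a j [^]\<^bsub>G\<^esub> (- int (Suc n)) = inv\<^bsub>G\<^esub> (a j [^]\<^bsub>G\<^esub> Suc n)"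
      using subgroup.subset[OF A_G] aA by (intro G.int_pow_neg_int) auto
    moreover have "\<dots> = inv\<^bsub>F\<^esub> (vconj c v (int (Suc n) *s \<kappa> j))"
      using vconj_path_classes[OF c, of "int (Suc n) *s \<kappa> j"] unfolding \<kappa> vconj_pow[OF cF v]
      by (subst inv_G) (simp_all del: F.nat_pow_Suc)
    ultimately show ?thesis by (simp only: neg vconj_minus[OF cF v])
  qed
  have pA: "a j [^]\<^bsub>G\<^esub> (z::int) \<in> A" for j z
    using G.subgroup_int_pow_closed[OF A_G aA] .
  have "finprod (G\<lparr>carrier := A\<rparr>) (\<lambda>i. a i [^]\<^bsub>G\<^esub> k $ i) I = vconj c v (\<Sum>i\<in>I. k $ i *s \<kappa> i)"
    if "finite I" for I and k :: "int ^ 'n"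
    using that
  proof (induction I)
    case empty
    then show ?case by (simp add: vconj_zero[OF cF v])
  next
    case (insert i I)
    then have "finprod (G\<lparr>carrier := A\<rparr>) (\<lambda>i. a i [^]\<^bsub>G\<^esub> k $ i) (insert i I) =
      a i [^]\<^bsub>G\<^esub> k $ i \<otimes>\<^bsub>G\<lparr>carrier := A\<rparr>\<^esub> finprod (G\<lparr>carrier := A\<rparr>) (\<lambda>i. a i [^]\<^bsub>G\<^esub> k $ i) I"
      using pA by (intro GA.finprod_insert) auto
    then show ?case using insert by (simp add: pw vconj_add[OF cF v])
  qed
  then have comb: "comb k = vconj c v (K k)" for k by (simp add: comb_def int_comb_def K_def)
  have Kadd: "K (k + l) = K k + K l" for k l
    by (simp add: K_def sum.distrib vec_eq_iff algebra_simps)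
  have Kax: "K (axis j 1) = \<kappa> j" for j
  proof -
    have "K (axis j 1) = (\<Sum>i\<in>UNIV. if i = j then \<kappa> j else 0)"
      unfolding K_def by (intro sum.cong) (auto simp: axis_def)
    then show ?thesis by simp
  qed
  obtain m :: nat where m: "m > 0" "\<forall>X\<in>?S. X [^]\<^bsub>G\<lparr>carrier := ?S\<rparr>\<^esub> m \<in> A"
    using finite_index_power[OF _ fi] G.subgroup_imp_group[OF S_G] by auto
  have "X [^]\<^bsub>G\<lparr>carrier := ?S\<rparr>\<^esub> m = X [^]\<^bsub>F\<^esub> m" for X
    by (simp add: nat_pow_def)
  then have "vconj c v (int m *s k) \<in> A" for k using m(2) vconj_pow[OF cF v] by auto
  then show "\<exists>c v K. c \<in> path_classes \<Gamma> P v \<and> v \<in> gverts \<Gamma> \<and> (\<forall>k l. K (k + l) = K k + K l) \<and>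
    (\<forall>k. comb k = vconj c v (K k)) \<and> (\<forall>j. a j = vconj c v (K (axis j 1))) \<and>
    (\<exists>m>0. \<forall>k. vconj c v (int m *s k) \<in> A)"
    using c v comb Kadd Kax \<kappa> m(1) by metis
qed

lemma comb_in: "comb k \<in> A" "comb k \<in> carrier G" "comb k \<in> carrier F"
  using comb_range subgroup.subset[OF subgroup_A] G_in_F by auto

lemma comb_add: "comb (k + l) = comb k \<cdot> comb l"
  using comb_structure vconj_add path_classes_F by metis

lemma comb_axis: "comb (axis j 1) = a j"
  using comb_structure by metis

lemma comb_zero: "comb 0 = \<one>\<^bsub>F\<^esub>"
  using comb_add[of 0 0] comb_in(3)[of 0] F.r_cancel_one' by simp

lemma comb_minus: "comb (- k) = inv\<^bsub>F\<^esub> (comb k)"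
  using comb_add[of "- k" k] comb_in(3) by (simp add: comb_zero F.inv_equality)

lemma comb_pow: "comb (int m *s k) = comb k [^]\<^bsub>F\<^esub> m"
proof (induction m)
  case (Suc m)
  then show ?case by (simp only: int_Suc_scale comb_add F.nat_pow_Suc)
qed (simp add: comb_zero)

lemma comb_commute: "comb k \<cdot> comb l = comb l \<cdot> comb k"
  by (simp add: add.commute flip: comb_add)

text \<open>The matrix combines the change of coordinates \<open>K\<close>, which is injective and
  hence invertible over the rationals, with the linear part of \<open>c\<close>.\<close>

lemma comb_translation: "\<exists>base_matrix. invertible base_matrix \<and> (\<forall>k z. caff (comb k) z = z + base_matrix *v ratvec k)"
proof -
  obtain c v K where c: "c \<in> path_classes \<Gamma> P v" and v: "v \<in> gverts \<Gamma>"
    and K: "\<And>k l. K (k + l) = K k + K l" and comb: "\<And>k. comb k = vconj c v (K k)"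
    using comb_structure by blast
  have cF: "c \<in> carrier F" using path_classes_F c by blast
  have Kinj: "inj K" using comb_inj comb by (auto simp: inj_def)
  obtain Q where Q: "\<And>k. ratvec (K k) = Q *v ratvec k"
    using additive_matrix[of "\<lambda>k. ratvec (K k)"] by (auto simp: K ratvec_add)
  have iQ: "invertible Q"
    by (rule inj_additive_matrix_invertible[of "\<lambda>k. ratvec (K k)", OF Q]) (use Kinj in \<open>simp add: inj_def\<close>)
  have "invertible (clin c ** Q)" using invertible_clin[OF cF] iQ by (rule invertible_mult)
  moreover have "caff (comb k) z = z + (clin c ** Q) *v ratvec k" for k z
    by (simp add: comb caff_vconj[OF cF v] Q matrix_vector_mul_assoc)
  ultimately show ?thesis by blast
qed

definition base_matrix :: "rat ^ 'n ^ 'n" where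
  "base_matrix = (SOME base_matrix. invertible base_matrix \<and> (\<forall>k z. caff (comb k) z = z + base_matrix *v ratvec k))"

lemma invertible_base_matrix: "invertible base_matrix" and caff_comb: "caff (comb k) z = z + base_matrix *v ratvec k"
  using someI_ex[OF comb_translation] unfolding base_matrix_def[symmetric] by auto

lemma caff_conj_comb:
  assumes "X \<in> carrier F"
  shows "caff (X \<cdot> comb k \<cdot> inv\<^bsub>F\<^esub> X) z = z + clin X *v (base_matrix *v ratvec k)"
proof -
  have "caff (X \<cdot> comb k \<cdot> inv\<^bsub>F\<^esub> X) z = caff X (caff (inv\<^bsub>F\<^esub> X) z + base_matrix *v ratvec k)"
    using assms by (simp add: caff_mult comb_in caff_comb)
  also have "\<dots> = caff X (caff (inv\<^bsub>F\<^esub> X) z) + clin X *v (base_matrix *v ratvec k)"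
    using caff_eq_clin[OF assms, of "caff (inv\<^bsub>F\<^esub> X) z + base_matrix *v ratvec k"] caff_eq_clin[OF assms, of "caff (inv\<^bsub>F\<^esub> X) z"]
    by (simp add: matrix_vector_right_distrib)
  finally show ?thesis using assms by (simp add: caff_inv)
qed

text \<open>Conjugating by \<open>c\<close> turns \<open>g\<close> into a loop at \<open>v\<close>.
  The factor \<open>m2\<close> brings the conjugate back into the vertex group, and
  \<open>m1\<close> from there into \<open>A\<close>.\<close>

lemma conj_comb_multiple:
  assumes g: "g \<in> carrier G"
  shows "\<exists>m>0. \<forall>k. \<exists>l. g \<cdot> comb (int m *s k) \<cdot> inv\<^bsub>F\<^esub> g = comb l"
proof -
  obtain c v K m1 where c: "c \<in> path_classes \<Gamma> P v" and v: "v \<in> gverts \<Gamma>"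
    and K: "\<And>k l. K (k + l) = K k + K l" and comb: "\<And>k. comb k = vconj c v (K k)"
    and m1: "m1 > 0" "\<And>k. vconj c v (int m1 *s k) \<in> A"
    using comb_structure by blast
  have cF: "c \<in> carrier F" using path_classes_F c by blast
  have gF: "g \<in> carrier F" using g G_in_F by blast
  have "inv\<^bsub>F\<^esub> c \<cdot> g \<cdot> c \<in> path_classes \<Gamma> v v"
    using c g by (intro path_classes_mult[of _ _ P] path_classes_inv) auto
  then obtain w where w: "path_word \<Gamma> v w v" "inv\<^bsub>F\<^esub> c \<cdot> g \<cdot> c = word_class \<Gamma> w"
    by (rule path_classes_cases)
  obtain m2 where m2: "m2 > 0" "\<And>k. \<exists>l. word_class \<Gamma> w \<cdot> vclass v (int m2 *s k) \<cdot> inv\<^bsub>F\<^esub> (word_class \<Gamma> w) = vclass v l"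
    using path_conj_multiple[OF w(1)] by blast
  have Ks: "K (z *s k) = z *s K k" for z k
    by (rule additive_scale[OF K]) (simp_all add: vec_eq_iff algebra_simps)
  have "\<exists>l. g \<cdot> comb (int (m2 * m1) *s k) \<cdot> inv\<^bsub>F\<^esub> g = comb l" for k
  proof -
    obtain l where l: "word_class \<Gamma> w \<cdot> vclass v (int m2 *s K k) \<cdot> inv\<^bsub>F\<^esub> (word_class \<Gamma> w) = vclass v l"
      using m2 by blast
    have "g \<cdot> vconj c v (int m2 *s K k) \<cdot> inv\<^bsub>F\<^esub> g = c \<cdot> vclass v l \<cdot> inv\<^bsub>F\<^esub> c"
      unfolding l[symmetric] w(2)[symmetric] vconj_def using cF gF v by (simp add: F.m_assoc F.inv_mult_group)
    then have e: "g \<cdot> comb (int m2 *s k) \<cdot> inv\<^bsub>F\<^esub> g = vconj c v l"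
      by (simp add: comb Ks vconj_def)
    have "g \<cdot> comb (int (m2 * m1) *s k) \<cdot> inv\<^bsub>F\<^esub> g = g \<cdot> comb (int m1 *s (int m2 *s k)) \<cdot> inv\<^bsub>F\<^esub> g"
      by (simp add: mult.commute)
    also have "\<dots> = (g \<cdot> comb (int m2 *s k) \<cdot> inv\<^bsub>F\<^esub> g) [^]\<^bsub>F\<^esub> m1"
      unfolding comb_pow[of m1] by (rule F.conj_pow[symmetric]) (use gF comb_in in auto)
    also have "\<dots> = vconj c v (int m1 *s l)" by (simp only: e vconj_pow[OF cF v])
    finally have e': "g \<cdot> comb (int (m2 * m1) *s k) \<cdot> inv\<^bsub>F\<^esub> g = vconj c v (int m1 *s l)" .
    have "vconj c v (int m1 *s l) \<in> range comb" using m1(2)[of l] comb_range by simp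
    then obtain l' where "vconj c v (int m1 *s l) = comb l'" by blast
    then show ?thesis unfolding e' by blast
  qed
  then show ?thesis using m1 m2 by (intro exI[of _ "m2 * m1"]) auto
qed

lemma subgroup_conj_A:
  assumes g: "g \<in> carrier G"
  shows "subgroup (A \<inter> (\<lambda>x. inv\<^bsub>G\<^esub> g \<otimes>\<^bsub>G\<^esub> x \<otimes>\<^bsub>G\<^esub> g) ` A) G"
proof (rule G.subgroups_Inter_pair[OF subgroup_A])
  let ?f = "\<lambda>x. inv\<^bsub>G\<^esub> g \<otimes>\<^bsub>G\<^esub> x \<otimes>\<^bsub>G\<^esub> g"
  have AG: "A \<subseteq> carrier G" using subgroup.subset[OF subgroup_A] .
  have gF: "g \<in> carrier F" using g G_in_F by blast
  have AF: "x \<in> A \<Longrightarrow> x \<in> carrier F" for x using AG G_in_F by blast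
  show "subgroup (?f ` A) G"
  proof (rule G.subgroupI)
    show "?f ` A \<subseteq> carrier G" using AG g by (blast intro: G.m_closed G.inv_closed)
    show "?f ` A \<noteq> {}" using subgroup.one_closed[OF subgroup_A] by blast
    show "inv\<^bsub>G\<^esub> X \<in> ?f ` A" if X: "X \<in> ?f ` A" for X
    proof -
      obtain x where x: "x \<in> A" "X = ?f x" using X by blast
      have "?f x \<in> carrier G" using x AG g by (blast intro: G.m_closed G.inv_closed)
      then have "inv\<^bsub>G\<^esub> X = inv\<^bsub>F\<^esub> (inv\<^bsub>F\<^esub> g \<cdot> x \<cdot> g)"
        unfolding x(2) by (subst inv_G) (simp_all add: inv_G[OF g])
      also have "\<dots> = inv\<^bsub>F\<^esub> g \<cdot> inv\<^bsub>F\<^esub> x \<cdot> g"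
        using gF AF[OF x(1)] by (simp add: F.inv_mult_group F.m_assoc)
      also have "\<dots> = ?f (inv\<^bsub>G\<^esub> x)"
        using x(1) AG by (subst inv_G[of x]) (auto simp: inv_G[OF g])
      finally have "inv\<^bsub>G\<^esub> X = ?f (inv\<^bsub>G\<^esub> x)" .
      then show ?thesis using x subgroup.m_inv_closed[OF subgroup_A] by blast
    qed
    show "X \<otimes>\<^bsub>G\<^esub> Y \<in> ?f ` A" if XY: "X \<in> ?f ` A" "Y \<in> ?f ` A" for X Y
    proof -
      obtain x where x: "x \<in> A" "X = ?f x" using XY(1) by blast
      obtain y where y: "y \<in> A" "Y = ?f y" using XY(2) by blast
      have "X \<otimes>\<^bsub>G\<^esub> Y = ?f (x \<otimes>\<^bsub>G\<^esub> y)"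
        using x y gF AF by (simp add: inv_G[OF g] F.m_assoc)
      then show ?thesis using x y subgroup.m_closed[OF subgroup_A] by blast
    qed
  qed
qed

lemma generate_multiples: "generate G (range (\<lambda>j. a j [^]\<^bsub>G\<^esub> m)) = range (\<lambda>k. comb (int m *s k))" (is "?L = ?R")
proof
  have sc: "int m *s (k + l) = int m *s k + int m *s l" "int m *s (- k) = - (int m *s k)" for k l :: "int ^ 'n"
    by (simp_all add: vec_eq_iff algebra_simps)
  have gen: "a j [^]\<^bsub>G\<^esub> m = comb (int m *s axis j 1)" for j
    by (simp add: comb_pow comb_axis)
  have R: "subgroup ?R G"
  proof (rule G.subgroupI)
    show "?R \<subseteq> carrier G" using comb_in by auto
    show "inv\<^bsub>G\<^esub> X \<in> ?R" if X: "X \<in> ?R" for X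
    proof -
      obtain k where k: "X = comb (int m *s k)" using X by blast
      have "inv\<^bsub>G\<^esub> X = comb (int m *s (- k))" using inv_G comb_in by (simp only: k comb_minus sc)
      then show ?thesis by blast
    qed
    show "X \<otimes>\<^bsub>G\<^esub> Y \<in> ?R" if XY: "X \<in> ?R" "Y \<in> ?R" for X Y
    proof -
      obtain k l where k: "X = comb (int m *s k)" "Y = comb (int m *s l)" using XY by blast
      have "X \<otimes>\<^bsub>G\<^esub> Y = comb (int m *s (k + l))" by (simp only: k comb_add sc G_simps)
      then show ?thesis by blast
    qed
  qed auto
  show "?L \<subseteq> ?R" by (rule G.generate_subgroup_incl[OF _ R]) (auto simp: gen simp del: G_simps)
  have sub: "range (\<lambda>j. a j [^]\<^bsub>G\<^esub> m) \<subseteq> carrier G" using comb_in unfolding gen by auto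
  have L: "subgroup ?L G" by (rule G.generate_is_subgroup[OF sub])
  have L_add: "comb k \<cdot> comb l \<in> ?L" if "comb k \<in> ?L" "comb l \<in> ?L" for k l
    using subgroup.m_closed[OF L that] by simp
  have axis: "comb (int m *s (z *s axis j 1)) \<in> ?L" for j z
  proof -
    have base: "comb (int m *s axis j 1) \<in> ?L"
      unfolding gen[symmetric] by (rule generate.incl) blast
    have pos: "comb (int m *s (int n *s axis j 1)) \<in> ?L" for n
    proof (induction n)
      case 0
      then show ?case using subgroup.one_closed[OF L] by (simp add: comb_zero)
    next
      case (Suc n)
      have e: "int m *s (int (Suc n) *s axis j 1) = int m *s (int n *s axis j 1) + int m *s (axis j 1 :: int ^ 'n)"
        unfolding int_Suc_scale sc ..
      show ?case unfolding e comb_add using Suc base by (rule L_add)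
    qed
    show ?thesis
    proof (cases z rule: int_cases2)
      case (nonpos n)
      have "int m *s (z *s axis j 1) = - (int m *s (int n *s (axis j 1 :: int ^ 'n)))"
        by (simp add: nonpos vec_eq_iff)
      then have "comb (int m *s (z *s axis j 1)) = inv\<^bsub>G\<^esub> (comb (int m *s (int n *s axis j 1)))"
        using inv_G comb_in by (simp only: comb_minus)
      then show ?thesis using subgroup.m_inv_closed[OF L pos] by simp
    qed (use pos in simp)
  qed
  show "?R \<subseteq> ?L"
  proof
    fix X assume "X \<in> ?R"
    then obtain k where k: "X = comb (int m *s k)" by blast
    have "comb (int m *s (\<Sum>j\<in>I. k $ j *s axis j 1)) \<in> ?L" if "finite I" for I
      using that
    proof (induction I)
      case empty
      then show ?case using subgroup.one_closed[OF L] by (simp add: comb_zero)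
    next
      case (insert j I)
      then show ?case by (simp only: sum.insert sc comb_add L_add axis simp_thms)
    qed
    from this[of UNIV] show "X \<in> ?L" by (simp add: basis_expansion k)
  qed
qed

text \<open>Every coset is represented by a combination with coordinates reduced modulo
  \<open>m\<close>.\<close>

lemma finite_index_multiples:
  assumes B: "subgroup B G" "B \<subseteq> A" and m: "m > 0" and sub: "range (\<lambda>k. comb (int m *s k)) \<subseteq> B"
  shows "finite_index_subgroup (generate G (range (\<lambda>j. a j [^]\<^bsub>G\<^esub> m))) (G\<lparr>carrier := B\<rparr>)"
  unfolding finite_index_subgroup_def
proof
  let ?N = "range (\<lambda>k. comb (int m *s k))"
  have N: "subgroup ?N G"
    unfolding generate_multiples[symmetric]
    by (rule G.generate_is_subgroup) (use comb_in in \<open>auto simp: comb_axis[symmetric] comb_pow[symmetric] simp del: G_simps(1)\<close>)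
  show "subgroup (generate G (range (\<lambda>j. a j [^]\<^bsub>G\<^esub> m))) (G\<lparr>carrier := B\<rparr>)"
    unfolding generate_multiples by (rule G.subgroup_incl[OF N B(1) sub])
  have "rcosets\<^bsub>G\<lparr>carrier := B\<rparr>\<^esub> ?N \<subseteq> (\<lambda>k. ?N #>\<^bsub>G\<^esub> comb k) ` {k. \<forall>i. k $ i \<in> {0..<int m}}"
  proof
    fix Z assume "Z \<in> rcosets\<^bsub>G\<lparr>carrier := B\<rparr>\<^esub> ?N"
    then obtain X where X: "X \<in> B" "Z = ?N #>\<^bsub>G\<^esub> X"
      by (auto simp: RCOSETS_def r_coset_def)
    then obtain k where k: "X = comb k" using B(2) comb_range by blast
    let ?r = "\<chi> i. k $ i mod int m" and ?q = "\<chi> i. k $ i div int m"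
    have kr: "k = int m *s ?q + ?r" by (simp add: vec_eq_iff)
    have "X = comb (int m *s ?q) \<cdot> comb ?r" unfolding k comb_add[symmetric] kr[symmetric] ..
    then have "X \<in> ?N #>\<^bsub>G\<^esub> comb ?r" by (auto simp: r_coset_def)
    then have "Z = ?N #>\<^bsub>G\<^esub> comb ?r"
      unfolding X(2) by (intro G.repr_independence[symmetric]) (use N comb_in in auto)
    then show "Z \<in> (\<lambda>k. ?N #>\<^bsub>G\<^esub> comb k) ` {k. \<forall>i. k $ i \<in> {0..<int m}}"
      using m by (intro image_eqI[of _ _ ?r]) auto
  qed
  then show "finite (rcosets\<^bsub>G\<lparr>carrier := B\<rparr>\<^esub> (generate G (range (\<lambda>j. a j [^]\<^bsub>G\<^esub> m))))"
    unfolding generate_multiples by (rule finite_subset) (intro finite_imageI finite_bounded_int_vectors; simp)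
qed

text \<open>Both sides of the conjugation equation act on rational vectors as translations.
  Comparing the translation vectors determines \<open>c / m\<close> as the linear part of
  \<open>g\<close> written in the basis \<open>a\<close>, whatever \<open>m\<close> was; this gives
  uniqueness, and \<open>conj_comb_multiple\<close> gives existence.\<close>

theorem modular_hom_eq:
  assumes g: "g \<in> carrier G"
  shows "modular_hom G A a g = matrix_inv base_matrix ** clin g ** base_matrix"
  unfolding modular_hom_def
proof (rule the_equality)
  have gF: "g \<in> carrier F" using g G_in_F by blast
  have AF: "x \<in> A \<Longrightarrow> x \<in> carrier F" for x using subgroup.subset[OF subgroup_A] G_in_F by blast
  have ic: "int_comb G A a (\<lambda>i. c i j) = comb (\<chi> i. c i j)" for c j by (simp add: comb_def)
  have eq: "(\<chi> i j. of_int (c i j) / of_nat m) = matrix_inv base_matrix ** clin g ** base_matrix"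
    if m: "m > 0" and c: "\<And>j. g \<cdot> comb (int m *s axis j 1) \<cdot> inv\<^bsub>F\<^esub> g = comb (\<chi> i. c i j)"
    for m :: nat and c :: "'n \<Rightarrow> 'n \<Rightarrow> int"
  proof -
    have "of_int (c i j) / of_nat m = (matrix_inv base_matrix ** clin g ** base_matrix) $ i $ j" for i j
    proof -
      let ?c = "ratvec (\<chi> i. c i j)"
      have "clin g *v (base_matrix *v ratvec (int m *s axis j 1)) = base_matrix *v ?c"
        using caff_conj_comb[OF gF, of "int m *s axis j 1" 0] caff_comb[of "\<chi> i. c i j" 0]
        unfolding c by simp
      then have "?c = matrix_inv base_matrix *v (clin g *v (base_matrix *v ratvec (int m *s axis j 1)))"
        by (simp add: invertible_base_matrix)
      also have "ratvec (int m *s axis j 1) = of_nat m *s axis j 1"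
        by (simp add: vec_eq_iff axis_def)
      also have "matrix_inv base_matrix *v (clin g *v (base_matrix *v (of_nat m *s axis j 1))) =
          of_nat m *s ((matrix_inv base_matrix ** clin g ** base_matrix) *v axis j 1)"
        by (simp add: matrix_vector_mul_assoc[symmetric] vector_scalar_commute)
      finally have "?c $ i = of_nat m * ((matrix_inv base_matrix ** clin g ** base_matrix) *v axis j 1) $ i" by simp
      moreover have "(M *v axis j 1) $ i = M $ i $ j" for M :: "rat ^ 'n ^ 'n"
        by (simp add: matrix_vector_mult_def axis_def if_distrib cong: if_cong)
      ultimately show ?thesis using m by (simp add: field_simps)
    qed
    then show ?thesis by (simp add: vec_eq_iff)
  qed
  obtain m where m: "m > 0" "\<And>k. \<exists>l. g \<cdot> comb (int m *s k) \<cdot> inv\<^bsub>F\<^esub> g = comb l"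
    using conj_comb_multiple[OF g] by blast
  then have "\<forall>j. \<exists>l. g \<cdot> comb (int m *s axis j 1) \<cdot> inv\<^bsub>F\<^esub> g = comb l" by blast
  then obtain l where l: "\<And>j. g \<cdot> comb (int m *s axis j 1) \<cdot> inv\<^bsub>F\<^esub> g = comb (l j)" by metis
  have pw: "a j [^]\<^bsub>G\<^esub> m = comb (int m *s axis j 1)" for j m by (simp add: comb_pow comb_axis)
  let ?B = "A \<inter> (\<lambda>x. inv\<^bsub>G\<^esub> g \<otimes>\<^bsub>G\<^esub> x \<otimes>\<^bsub>G\<^esub> g) ` A"
  have sub: "range (\<lambda>k. comb (int m *s k)) \<subseteq> ?B"
  proof
    fix X assume "X \<in> range (\<lambda>k. comb (int m *s k))"
    then obtain k where k: "X = comb (int m *s k)" by blast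
    obtain l where l: "g \<cdot> comb (int m *s k) \<cdot> inv\<^bsub>F\<^esub> g = comb l" using m by blast
    have "X = inv\<^bsub>G\<^esub> g \<otimes>\<^bsub>G\<^esub> comb l \<otimes>\<^bsub>G\<^esub> g"
      unfolding l[symmetric] k using gF comb_in by (simp add: inv_G[OF g] F.m_assoc)
    then have "X \<in> (\<lambda>x. inv\<^bsub>G\<^esub> g \<otimes>\<^bsub>G\<^esub> x \<otimes>\<^bsub>G\<^esub> g) ` A" using comb_in(1) by (rule image_eqI)
    then show "X \<in> ?B" using comb_in(1) k by simp
  qed
  show "\<exists>m c. 0 < m \<and>
        finite_index_subgroup (generate G (range (\<lambda>j. a j [^]\<^bsub>G\<^esub> m))) (G\<lparr>carrier := ?B\<rparr>) \<and>
        (\<forall>j. g \<otimes>\<^bsub>G\<^esub> a j [^]\<^bsub>G\<^esub> m \<otimes>\<^bsub>G\<^esub> inv\<^bsub>G\<^esub> g = int_comb G A a (\<lambda>i. c i j)) \<and>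
        matrix_inv base_matrix ** clin g ** base_matrix = (\<chi> i j. of_int (c i j) / of_nat m)"
  proof (intro exI[of _ m] exI[of _ "\<lambda>i j. l j $ i"] conjI allI)
    show "finite_index_subgroup (generate G (range (\<lambda>j. a j [^]\<^bsub>G\<^esub> m))) (G\<lparr>carrier := ?B\<rparr>)"
      by (rule finite_index_multiples[OF subgroup_conj_A[OF g] _ m(1) sub]) blast
    show "g \<otimes>\<^bsub>G\<^esub> a j [^]\<^bsub>G\<^esub> m \<otimes>\<^bsub>G\<^esub> inv\<^bsub>G\<^esub> g = int_comb G A a (\<lambda>i. l j $ i)" for j
      unfolding pw using l[of j] by (simp add: inv_G[OF g] comb_def)
    show "matrix_inv base_matrix ** clin g ** base_matrix = (\<chi> i j. of_int (l j $ i) / of_nat m)"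
      using eq[of m "\<lambda>i j. l j $ i"] m l by simp
  qed (rule m)
  fix M :: "rat ^ 'n ^ 'n"
  assume "\<exists>m c. 0 < m \<and>
        finite_index_subgroup (generate G (range (\<lambda>j. a j [^]\<^bsub>G\<^esub> m))) (G\<lparr>carrier := ?B\<rparr>) \<and>
        (\<forall>j. g \<otimes>\<^bsub>G\<^esub> a j [^]\<^bsub>G\<^esub> m \<otimes>\<^bsub>G\<^esub> inv\<^bsub>G\<^esub> g = int_comb G A a (\<lambda>i. c i j)) \<and>
        M = (\<chi> i j. of_int (c i j) / of_nat m)"
  then obtain m :: nat and c where m: "m > 0" and M: "M = (\<chi> i j. of_int (c i j) / of_nat m)"
    and c: "\<And>j. g \<otimes>\<^bsub>G\<^esub> a j [^]\<^bsub>G\<^esub> m \<otimes>\<^bsub>G\<^esub> inv\<^bsub>G\<^esub> g = int_comb G A a (\<lambda>i. c i j)"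
    by blast
  have "g \<cdot> comb (int m *s axis j 1) \<cdot> inv\<^bsub>F\<^esub> g = comb (\<chi> i. c i j)" for j
    using c[of j] unfolding pw ic by (simp add: inv_G[OF g])
  then show "M = matrix_inv base_matrix ** clin g ** base_matrix" unfolding M by (rule eq[OF m])
qed

end

section \<open>From product acylindrical actions to finite monodromy\<close>

lemma group_action_group: "group_action K E \<phi> \<Longrightarrow> group K"
  unfolding group_action_def group_hom_def by blast

lemma BijGroup_mult_apply:
  "f \<in> carrier (BijGroup S) \<Longrightarrow> g \<in> carrier (BijGroup S) \<Longrightarrow> x \<in> S \<Longrightarrow> (f \<otimes>\<^bsub>BijGroup S\<^esub> g) x = f (g x)"
  and BijGroup_one_apply: "x \<in> S \<Longrightarrow> \<one>\<^bsub>BijGroup S\<^esub> x = x"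
  by (simp_all add: BijGroup_def compose_def)

text \<open>The components of \<phi> h are chosen separately for each h. They still form actions,
  because evaluation at points of the product determines them on the factors. Loxodromicity is used
  later only through the positive translation length.\<close>

lemma product_action_factors:
  fixes K :: "'a monoid" and X :: "nat \<Rightarrow> 'x metric"
  assumes act: "product_acylindrical_action K r X \<phi>"
  obtains \<psi> where "\<And>i. i < r \<Longrightarrow> isom_action K (X i) (\<psi> i)"
    "\<And>h x i. h \<in> carrier K \<Longrightarrow> x \<in> mspace (l1_product r X) \<Longrightarrow> i < r \<Longrightarrow> \<phi> h x i = \<psi> i h (x i)"
    "\<exists>h\<in>carrier K. \<exists>i<r. 0 < isom_action.tlen K (X i) (\<psi> i) h"
proof -
  have hyp: "hyperbolic_space (X i)" if "i < r" for i
    using act that unfolding product_acylindrical_action_def by blast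
  have ga: "group_action K (mspace (l1_product r X)) \<phi>"
    using act unfolding product_acylindrical_action_def isometric_action_def by blast
  interpret group_action K "mspace (l1_product r X)" \<phi> by (rule ga)
  interpret K: group K using ga by (rule group_action_group)
  define \<psi> where "\<psi> i h = (SOME fs. acts_as r X (\<phi> h) fs) i" for i h
  have as: "acts_as r X (\<phi> h) (\<lambda>i. \<psi> i h)" if "h \<in> carrier K" for h
    using act that unfolding product_acylindrical_action_def preserves_factors_def \<psi>_def by (metis someI_ex)
  have ne: "mspace (X i) \<noteq> {}" if "i < r" for i using hyp[OF that] by (simp add: hyperbolic_space_def)
  \<comment> \<open>Replacing one coordinate of this base point makes every point of
    \<open>X i\<close> occur as a coordinate of a point of the product.\<close>
  define b where "b = (\<lambda>i\<in>{..<r}. SOME x. x \<in> mspace (X i))"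
  have b: "b i \<in> mspace (X i)" if "i < r" for i
    using ne[OF that] that by (simp add: b_def some_in_eq)
  have upd: "b(i := x) \<in> mspace (l1_product r X)" if "i < r" "x \<in> mspace (X i)" for i x
    using that b by (auto simp: PiE_iff extensional_def b_def)
  have comp: "\<phi> h y i = \<psi> i h (y i)" if "h \<in> carrier K" "y \<in> mspace (l1_product r X)" "i < r" for h y i
    using as[OF that(1)] that unfolding acts_as_def by blast
  have eval: "\<psi> i h x = \<phi> h (b(i := x)) i" if "h \<in> carrier K" "i < r" "x \<in> mspace (X i)" for i h x
    using comp[OF that(1) upd[OF that(2,3)] that(2)] by simp
  have isom: "\<psi> i h \<in> Isom (X i)" if "h \<in> carrier K" "i < r" for i h
    using as[OF that(1)] that(2) unfolding acts_as_def by blast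
  have ia: "isom_action K (X i) (\<psi> i)" if i: "i < r" for i
  proof
    fix g h x assume g: "g \<in> carrier K" and h: "h \<in> carrier K" and x: "x \<in> mspace (X i)"
    show "\<psi> i (g \<otimes>\<^bsub>K\<^esub> h) x = \<psi> i g (\<psi> i h x)"
    proof -
      have y: "b(i := x) \<in> mspace (l1_product r X)" using upd[OF i x] .
      have y': "\<phi> h (b(i := x)) \<in> mspace (l1_product r X)" using element_image[OF h y] by blast
      have "\<psi> i (g \<otimes>\<^bsub>K\<^esub> h) x = \<phi> g (\<phi> h (b(i := x))) i"
        using eval[OF K.m_closed[OF g h] i x] composition_rule[OF y g h] by simp
      also have "\<dots> = \<psi> i g (\<phi> h (b(i := x)) i)" by (rule comp[OF g y' i])
      finally show ?thesis using eval[OF h i x] by simp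
    qed
  next
    fix x assume x: "x \<in> mspace (X i)"
    have "\<phi> \<one>\<^bsub>K\<^esub> (b(i := x)) = b(i := x)"
      using id_eq_one upd[OF i x] by (metis restrict_apply')
    then show "\<psi> i \<one>\<^bsub>K\<^esub> x = x" using eval[OF K.one_closed i x] by simp
  next
    fix g x assume "g \<in> carrier K" "x \<in> mspace (X i)"
    then show "\<psi> i g x \<in> mspace (X i)"
      using isom[OF _ i] by (auto simp: Isom_def Bij_def bij_betw_def)
  next
    fix g x y assume "g \<in> carrier K" "x \<in> mspace (X i)" "y \<in> mspace (X i)"
    then show "mdist (X i) (\<psi> i g x) (\<psi> i g y) = mdist (X i) x y"
      using isom[OF _ i] by (auto simp: Isom_def)
  qed (rule ne[OF i])
  obtain h fs i where h: "h \<in> carrier K" and fs: "acts_as r X (\<phi> h) fs" and i: "i < r"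
    and lox: "loxodromic (X i) (fs i)"
    using act unfolding product_acylindrical_action_def by blast
  interpret isom_action K "X i" "\<psi> i" by (rule ia[OF i])
  let ?B = "BijGroup (mspace (X i))"
  interpret B: group ?B by (rule group_BijGroup)
  have f: "fs i \<in> carrier ?B"
    using lox by (auto simp: loxodromic_def Isom_def BijGroup_def)
  \<comment> \<open>The loxodromic component belongs to another choice \<open>fs\<close> of
    components, which agrees with \<psi> on \<open>X i\<close>.\<close>
  have fx: "fs i x = \<psi> i h x" if "x \<in> mspace (X i)" for x
  proof -
    have all: "\<forall>y\<in>mspace (l1_product r X). \<forall>i<r. \<phi> h y i = fs i (y i)"
      using fs unfolding acts_as_def by (rule conjunct2)
    have "\<phi> h (b(i := x)) i = fs i ((b(i := x)) i)"
      by (rule all[THEN bspec, OF upd[OF i that], THEN spec, THEN mp, OF i])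
    then have "\<phi> h (b(i := x)) i = fs i x" by simp
    then show ?thesis using eval[OF h i that] by simp
  qed
  have pow: "(fs i [^]\<^bsub>?B\<^esub> n) x = \<psi> i (h [^]\<^bsub>K\<^esub> n) x" if "x \<in> mspace (X i)" for n :: nat and x
    using that
  proof (induction n arbitrary: x)
    case 0
    then show ?case by (simp add: BijGroup_one_apply act_one)
  next
    case (Suc n)
    have "(fs i [^]\<^bsub>?B\<^esub> Suc n) x = (fs i [^]\<^bsub>?B\<^esub> n) (fs i x)"
      unfolding B.nat_pow_Suc by (rule BijGroup_mult_apply[OF B.nat_pow_closed[OF f] f Suc.prems])
    then show ?case using Suc fx h by (simp add: act_closed act_mult)
  qed
  obtain x L C where x: "x \<in> mspace (X i)" and L: "L \<ge> 1" and
    lb: "\<And>k l :: int. \<bar>real_of_int (k - l)\<bar> / L - C \<le> mdist (X i) ((fs i [^]\<^bsub>?B\<^esub> k) x) ((fs i [^]\<^bsub>?B\<^esub> l) x)"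
    using lox unfolding loxodromic_def by blast
  have low: "real n / L - C \<le> disp x (h [^]\<^bsub>K\<^esub> n)" for n
    using lb[of "int n" 0] x h
    by (simp add: int_pow_int pow BijGroup_one_apply mdist_commute disp_def)
  \<comment> \<open>The quasi-isometric lower bound n / L - C, divided by n = 2^k, tends to 1 /
    L.\<close>
  have "1 / L \<le> tlen h"
  proof (rule LIMSEQ_le[OF _ tlen_tendsto[OF h x]])
    have "(\<lambda>k. 1 / L - C * (1 / 2) ^ k) \<longlonglongrightarrow> 1 / L - C * 0"
      by (intro tendsto_intros) auto
    then show "(\<lambda>k. 1 / L - C * (1 / 2) ^ k) \<longlonglongrightarrow> 1 / L" by simp
    show "\<exists>N. \<forall>n\<ge>N. 1 / L - C * (1 / 2) ^ n \<le> disp x (h [^]\<^bsub>K\<^esub> (2 ^ n :: nat)) / 2 ^ n"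
    proof (intro exI allI impI)
      fix n :: nat
      have "(2 ^ n / L - C) / 2 ^ n \<le> disp x (h [^]\<^bsub>K\<^esub> (2 ^ n :: nat)) / 2 ^ n"
        using low[of "2 ^ n"] by (intro divide_right_mono) auto
      then show "1 / L - C * (1 / 2) ^ n \<le> disp x (h [^]\<^bsub>K\<^esub> (2 ^ n :: nat)) / 2 ^ n"
        by (simp add: diff_divide_distrib power_one_over)
    qed
  qed
  then have "0 < tlen h" using L by (smt (verit) divide_pos_pos)
  then show ?thesis using that[of \<psi>] ia comp h i by blast
qed

text \<open>Columns of modular matrices are rational, so additive functions on the lattice have to
  be evaluated at rational vectors.\<close>

lemma rat_linear_extension:
  fixes \<beta> :: "int ^ 'n \<Rightarrow> real"
  assumes "\<And>x y. \<beta> (x + y) = \<beta> x + \<beta> y"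
  obtains \<gamma> :: "rat ^ 'n \<Rightarrow> real" where "\<And>k. \<gamma> (ratvec k) = \<beta> k" "\<And>x y. \<gamma> (x - y) = \<gamma> x - \<gamma> y"
    "\<And>q x. \<gamma> (q *s x) = of_rat q * \<gamma> x"
proof (rule that[of "\<lambda>v. \<Sum>j\<in>UNIV. of_rat (v $ j) * \<beta> (axis j 1)"])
  fix k
  have sc: "\<beta> (z *s x) = of_int z * \<beta> x" for z x
    by (rule additive_scale[OF assms]) (simp_all add: algebra_simps)
  have "\<beta> k = \<beta> (\<Sum>j\<in>UNIV. k $ j *s axis j 1)" by (simp add: basis_expansion)
  also have "\<dots> = (\<Sum>j\<in>UNIV. of_int (k $ j) * \<beta> (axis j 1))"
    by (simp add: additive_laws(4)[of \<beta>, OF assms] sc)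
  finally show "(\<Sum>j\<in>UNIV. of_rat (ratvec k $ j) * \<beta> (axis j 1)) = \<beta> k" by simp
qed (simp_all add: of_rat_diff of_rat_mult sum_subtractf sum_distrib_left algebra_simps)

text \<open>Each \<gamma> i takes at most two values on the set, and together they separate its
  points.\<close>

lemma finite_abs_values:
  fixes \<gamma> :: "nat \<Rightarrow> rat ^ 'n \<Rightarrow> real"
  assumes diff: "\<And>i x y. i < r \<Longrightarrow> \<gamma> i (x - y) = \<gamma> i x - \<gamma> i y"
    and inj: "\<And>x. (\<And>i. i < r \<Longrightarrow> \<gamma> i x = 0) \<Longrightarrow> x = 0"
  shows "finite {x. \<forall>i<r. \<bar>\<gamma> i x\<bar> = c i}"
proof -
  let ?W = "{x. \<forall>i<r. \<bar>\<gamma> i x\<bar> = c i}" and ?f = "\<lambda>x. \<lambda>i\<in>{..<r}. \<gamma> i x"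
  have "inj_on ?f ?W"
  proof (rule inj_onI)
    fix x y assume "?f x = ?f y"
    then have "\<gamma> i x = \<gamma> i y" if "i < r" for i using that by (metis lessThan_iff restrict_apply')
    then have "x - y = 0" by (intro inj) (simp add: diff)
    then show "x = y" by simp
  qed
  moreover have "?f ` ?W \<subseteq> PiE {..<r} (\<lambda>i. {c i, - c i})"
    by (auto simp: PiE_iff abs_if split: if_splits)
  moreover have "finite (PiE {..<r} (\<lambda>i. {c i, - c i}))" by (intro finite_PiE) auto
  ultimately show ?thesis by (meson finite_imageD finite_subset)
qed

lemma finite_matrices_by_columns:
  fixes W :: "'n::finite \<Rightarrow> (rat ^ 'n) set"
  assumes "\<And>j. finite (W j)"
  shows "finite {M :: rat ^ 'n ^ 'n. \<forall>j. M *v axis j 1 \<in> W j}"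
proof -
  let ?S = "{M :: rat ^ 'n ^ 'n. \<forall>j. M *v axis j 1 \<in> W j}" and ?f = "\<lambda>M :: rat ^ 'n ^ 'n. \<lambda>j. M *v axis j 1"
  have col: "(M *v axis j 1) $ i = M $ i $ j" for M :: "rat ^ 'n ^ 'n" and i j
    by (simp add: matrix_vector_mult_def axis_def if_distrib cong: if_cong)
  have "inj_on ?f ?S"
    by (rule inj_onI) (metis col vec_eq_iff)
  moreover have "?f ` ?S \<subseteq> PiE UNIV W" by auto
  moreover have "finite (PiE UNIV W)" using assms by (intro finite_PiE) auto
  ultimately show ?thesis by (meson finite_imageD finite_subset)
qed

lemma inj_conj_matrix:
  fixes base_matrix :: "'a::field ^ 'n ^ 'n"
  assumes "invertible base_matrix"
  shows "inj (\<lambda>M. matrix_inv base_matrix ** M ** base_matrix)"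
proof (rule inj_on_inverseI)
  fix M
  have "base_matrix ** (matrix_inv base_matrix ** M ** base_matrix) ** matrix_inv base_matrix = (base_matrix ** matrix_inv base_matrix) ** M ** (base_matrix ** matrix_inv base_matrix)"
    by (simp only: matrix_mul_assoc)
  then show "(\<lambda>N. base_matrix ** N ** matrix_inv base_matrix) (matrix_inv base_matrix ** M ** base_matrix) = M"
    by (simp add: invertible_inverses[OF assms])
qed

section \<open>Reduction of the monodromy to linear parts, and the forward implication\<close>

context gbs_basis
begin

lemma finite_monodromy_iff: "finite (monodromy G A a) \<longleftrightarrow> finite (clin ` carrier G)"
proof -
  have eq: "monodromy G A a = (\<lambda>M. matrix_inv base_matrix ** M ** base_matrix) ` clin ` carrier G"
    unfolding monodromy_def image_image by (rule image_cong) (simp_all only: modular_hom_eq)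
  have "inj_on (\<lambda>M. matrix_inv base_matrix ** M ** base_matrix) (clin ` carrier G)"
    using inj_conj_matrix[OF invertible_base_matrix] by (rule inj_on_subset) simp
  then show ?thesis unfolding eq by (rule finite_image_iff)
qed

lemma finite_clin_of_finite_index:
  assumes H: "finite_index_subgroup H G" and fin: "finite (clin ` H)"
  shows "finite (clin ` carrier G)"
proof -
  have sH: "subgroup H G" and fr: "finite (rcosets\<^bsub>G\<^esub> H)"
    using H by (auto simp: finite_index_subgroup_def)
  have "finite (clin ` Z)" if Z: "Z \<in> rcosets\<^bsub>G\<^esub> H" for Z
  proof -
    obtain x where x: "x \<in> carrier G" "Z = H #>\<^bsub>G\<^esub> x" using Z by (auto simp: RCOSETS_def)
    have "clin ` Z \<subseteq> (\<lambda>M. M ** clin x) ` clin ` H"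
    proof
      fix M assume "M \<in> clin ` Z"
      then obtain h where h: "h \<in> H" "M = clin (h \<cdot> x)" using x by (auto simp: r_coset_def)
      then have "M = clin h ** clin x"
        using subgroup.subset[OF sH] G_in_F x by (auto simp: clin_mult)
      then show "M \<in> (\<lambda>M. M ** clin x) ` clin ` H" using h by blast
    qed
    then show ?thesis using fin finite_subset by blast
  qed
  then have "finite (\<Union>Z\<in>rcosets\<^bsub>G\<^esub> H. clin ` Z)" using fr by blast
  moreover have "clin ` carrier G \<subseteq> (\<Union>Z\<in>rcosets\<^bsub>G\<^esub> H. clin ` Z)"
    unfolding G.rcosets_part_G[OF sH, symmetric] by blast
  ultimately show ?thesis by (rule finite_subset[rotated])
qed

lemma finite_clin_if_product_acylindrical:
  fixes X :: "nat \<Rightarrow> 'y metric"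
  assumes H: "finite_index_subgroup H G"
    and act: "product_acylindrical_action (G\<lparr>carrier := H\<rparr>) r X \<phi>"
  shows "finite (clin ` carrier G)"
proof (rule finite_clin_of_finite_index[OF H])
  let ?K = "G\<lparr>carrier := H\<rparr>"
  have sH: "subgroup H G" using H by (auto simp: finite_index_subgroup_def)
  interpret K: group ?K by (rule G.subgroup_imp_group[OF sH])
  have HF: "x \<in> carrier F" if "x \<in> H" for x using subgroup.subset[OF sH] G_in_F that by blast
  have K_pow: "x [^]\<^bsub>?K\<^esub> (n::nat) = x [^]\<^bsub>F\<^esub> n" for x n
    by (simp add: nat_pow_def)
  have K_inv: "inv\<^bsub>?K\<^esub> x = inv\<^bsub>F\<^esub> x" if "x \<in> H" for x
  proof -
    have "inv\<^bsub>?K\<^esub> x = inv\<^bsub>G\<^esub> x" using G.m_inv_consistent[OF sH that] by simp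
    then show ?thesis using inv_G subgroup.subset[OF sH] that by auto
  qed
  obtain \<psi> where ia: "\<And>i. i < r \<Longrightarrow> isom_action ?K (X i) (\<psi> i)"
    and comp: "\<And>h x i. h \<in> H \<Longrightarrow> x \<in> mspace (l1_product r X) \<Longrightarrow> i < r \<Longrightarrow> \<phi> h x i = \<psi> i h (x i)"
    and lox: "\<exists>h\<in>H. \<exists>i<r. 0 < isom_action.tlen ?K (X i) (\<psi> i) h"
    using product_action_factors[OF act] by auto
  define t where "t i = isom_action.tlen ?K (X i) (\<psi> i)" for i
  obtain h i0 where h: "h \<in> H" and i0: "i0 < r" and th: "0 < t i0 h" using lox unfolding t_def by blast
  have "\<forall>i. \<exists>\<delta>. i < r \<longrightarrow> \<delta> \<ge> 0 \<and> Gromov_hyperbolic \<delta> (X i) \<and> geodesic_space (X i)"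
    using act unfolding product_acylindrical_action_def hyperbolic_space_def by blast
  then obtain \<delta> where \<delta>: "\<And>i. i < r \<Longrightarrow> \<delta> i \<ge> 0" "\<And>i. i < r \<Longrightarrow> Gromov_hyperbolic (\<delta> i) (X i)"
    "\<And>i. i < r \<Longrightarrow> geodesic_space (X i)" by metis
  obtain N0 :: nat where N0: "N0 > 0" "\<And>x. x \<in> carrier G \<Longrightarrow> x [^]\<^bsub>F\<^esub> N0 \<in> H"
    using finite_index_power[OF group_G H] by auto
  \<comment> \<open>These powers of base elements lie in \<open>H\<close>, and conjugation
    identities for \<open>comb\<close> pass to them by taking \<open>N0\<close>-th powers.\<close>
  define b where "b k = comb (int N0 *s k)" for k
  have b_H: "b k \<in> H" for k using N0(2)[OF comb_in(2)] by (simp add: b_def comb_pow)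
  have b_F: "b k \<in> carrier F" for k by (simp add: b_def comb_in)
  have b_add: "b (k + l) = b k \<cdot> b l" for k l
    by (simp add: b_def comb_add vector_add_ldistrib)
  have b_minus: "b (- k) = inv\<^bsub>F\<^esub> (b k)" for k
  proof -
    have "int N0 *s (- k) = - (int N0 *s k)" by (simp add: vec_eq_iff)
    then show ?thesis by (simp add: b_def comb_minus)
  qed
  have b_comm: "b k \<cdot> b l = b l \<cdot> b k" for k l by (simp add: b_def comb_commute)
  have b_inj: "b k = b l \<longleftrightarrow> k = l" for k l
    using N0(1) comb_inj by (auto simp: b_def inj_eq vec_eq_iff)
  have b_conj: "g \<cdot> b k \<cdot> inv\<^bsub>F\<^esub> g = b l"
    if "g \<in> carrier F" "g \<cdot> comb k \<cdot> inv\<^bsub>F\<^esub> g = comb l" for g k l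
    using F.conj_pow[of "comb k" g N0] that comb_in(3) by (simp add: b_def comb_pow)
  define f where "f i k = t i (b k)" for i k
  have t_conj: "t i (g \<cdot> x \<cdot> inv\<^bsub>F\<^esub> g) = t i x" if "i < r" "g \<in> H" "x \<in> H" for i g x
    using isom_action.tlen_conj[OF ia[OF that(1)], of x g] that by (simp add: t_def K_inv)
  have "\<exists>\<beta>. (\<forall>x y. \<beta> (x + y) = \<beta> x + \<beta> y) \<and> (\<forall>x. f i x = \<bar>\<beta> x\<bar>)" if i: "i < r" for i
  proof -
    interpret A: isom_action ?K "X i" "\<psi> i" by (rule ia[OF i])
    have bd: "inv\<^bsub>F\<^esub> (b y) \<cdot> b x = b (x - y)" for x y
      by (simp add: algebra_simps flip: b_minus b_add)
    have "\<exists>\<beta> :: int ^ 'n \<Rightarrow> real. (\<forall>x y. \<beta> (x + y) = \<beta> x + \<beta> y) \<and> (\<forall>x. f i x = \<bar>\<beta> x\<bar>)"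
    proof (rule abs_additive_of_parallelogram[of "f i"])
      show "0 \<le> f i x" for x using A.tlen_nonneg b_H by (simp add: f_def t_def)
      show "f i (- x) = f i x" for x
        using A.tlen_inv[of "b x"] b_H by (simp add: f_def t_def b_minus K_inv)
      show "f i (x + x) = 2 * f i x" for x
      proof -
        have "A.tlen (b x \<cdot> b x) = 2 * A.tlen (b x)"
          using A.tlen_double[of "b x"] b_H by simp
        then show ?thesis by (simp only: f_def t_def b_add)
      qed
      show "f i (x + y) \<le> f i x + f i y" for x y
        using A.tlen_mult_le[of "b x" "b y"] b_H b_comm by (simp add: f_def t_def b_add)
      show "f i (x + y) + f i (x - y) \<le> 2 * max (f i x) (f i y)" for x y
        using A.tlen_parallelogram(1)[OF \<delta>(2)[OF i], of "b x" "b y"] b_H b_comm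
        by (simp add: f_def t_def b_add K_inv bd)
      show "2 * f i x \<le> max (2 * f i y) (f i (x + y) + f i (x - y))" for x y
        using A.tlen_parallelogram(2)[OF \<delta>(2)[OF i], of "b x" "b y"] b_H b_comm
        by (simp add: f_def t_def b_add K_inv bd)
    qed blast
    then show ?thesis .
  qed
  then obtain \<beta> where \<beta>: "\<And>i x y. i < r \<Longrightarrow> \<beta> i (x + y) = \<beta> i x + \<beta> i y"
    "\<And>i x. i < r \<Longrightarrow> f i x = \<bar>\<beta> i x\<bar>" by metis

  have kernel: "k = 0" if f0: "\<And>i. i < r \<Longrightarrow> f i k = 0" for k
  proof (rule ccontr)
    assume k: "k \<noteq> 0"
    \<comment> \<open>The common displacement bounds of the factors add up in the l1 metric.
      \<open>E\<close> is independent of the finite set to which they are applied, so it can be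
      fixed before \<open>N\<close> and \<open>R\<close>.\<close>
    define E where "E = (\<Sum>i<r. 20 * \<delta> i + 6)"
    have "0 \<le> E" unfolding E_def using \<delta>(1) by (intro sum_nonneg) auto
    have acyl: "acylindrical ?K (l1_product r X) \<phi>"
      using act unfolding product_acylindrical_action_def by (elim conjE)
    obtain N :: nat and R where "\<forall>x\<in>mspace (l1_product r X). \<forall>y\<in>mspace (l1_product r X).
      R \<le> mdist (l1_product r X) x y \<longrightarrow>
      finite {h \<in> carrier ?K. mdist (l1_product r X) x (\<phi> h x) \<le> E \<and> mdist (l1_product r X) y (\<phi> h y) \<le> E} \<and>
      card {h \<in> carrier ?K. mdist (l1_product r X) x (\<phi> h x) \<le> E \<and> mdist (l1_product r X) y (\<phi> h y) \<le> E} \<le> N"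
      using acyl[unfolded acylindrical_def, THEN spec, THEN mp, OF \<open>0 \<le> E\<close>] by (elim exE)
    moreover have "carrier ?K = H" by simp
    ultimately have NR: "finite {h \<in> H. mdist (l1_product r X) x (\<phi> h x) \<le> E \<and> mdist (l1_product r X) y (\<phi> h y) \<le> E} \<and>
      card {h \<in> H. mdist (l1_product r X) x (\<phi> h x) \<le> E \<and> mdist (l1_product r X) y (\<phi> h y) \<le> E} \<le> N"
      if "x \<in> mspace (l1_product r X)" "y \<in> mspace (l1_product r X)" "R \<le> mdist (l1_product r X) x y" for x y
      using that by (simp only:)
    \<comment> \<open>With this power, \<open>g\<close> translates by at least \<open>R\<close> in
      factor \<open>i0\<close>, so it moves every point of the product at least that far.\<close>
    obtain j :: nat where j: "R / t i0 h < 2 ^ j" using real_arch_pow[of 2 "R / t i0 h"] by auto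
    define g where "g = h [^]\<^bsub>F\<^esub> (2 ^ j :: nat)"
    have g: "g \<in> H" using K.nat_pow_closed[of h "2 ^ j"] h by (simp add: g_def K_pow)
    have gF: "g \<in> carrier F" using HF g by blast
    have tg: "R \<le> t i0 g"
      using isom_action.tlen_pow2[OF ia[OF i0], of h j] h j th
      by (simp add: t_def g_def K_pow field_simps)
    have ig: "inv\<^bsub>F\<^esub> g \<in> H" using K.inv_closed[of g] g by (simp add: K_inv)
    then have "inv\<^bsub>F\<^esub> g \<in> carrier G" using subgroup.subset[OF sH] by blast
    \<comment> \<open>Conjugation by g^-1 may leave the base subgroup. Multiples of \<open>q\<close>
      are carried back into it, so the elements of \<open>S\<close> below all commute.\<close>
    then obtain q where q: "q > 0" "\<And>k. \<exists>l. inv\<^bsub>F\<^esub> g \<cdot> comb (int q *s k) \<cdot> inv\<^bsub>F\<^esub> (inv\<^bsub>F\<^esub> g) = comb l"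
      using conj_comb_multiple by blast
    let ?s = "\<lambda>s::nat. b (int q *s (int s *s k))"
    let ?c = "\<lambda>x. inv\<^bsub>F\<^esub> g \<cdot> x \<cdot> g"
    \<comment> \<open>One element more than acylindricity allows; they are distinct because
      \<open>k\<close> is nonzero and \<open>q\<close> is positive.\<close>
    define S0 where "S0 = ?s ` {1..N+1}"
    have c_range: "?c (?s s) \<in> range b" for s
    proof -
      obtain l where "inv\<^bsub>F\<^esub> g \<cdot> comb (int q *s (int s *s k)) \<cdot> inv\<^bsub>F\<^esub> (inv\<^bsub>F\<^esub> g) = comb l"
        using q by blast
      then show ?thesis using b_conj[of "inv\<^bsub>F\<^esub> g"] gF by auto
    qed
    \<comment> \<open>The conjugates are included so that a single point \<open>p\<close> controls
      the displacements of \<open>S0\<close> both at \<open>p\<close> and at g p.\<close>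
    define S where "S = S0 \<union> ?c ` S0"
    have S_b: "S \<subseteq> range b" unfolding S_def S0_def using c_range by auto
    have S_H: "S \<subseteq> H" using S_b b_H by blast
    have S0_H: "S0 \<subseteq> H" using S_H by (auto simp: S_def)
    have card_S0: "card S0 = N + 1"
    proof -
      obtain a0 where a0: "k $ a0 \<noteq> 0" using k by (auto simp: vec_eq_iff)
      have "inj_on ?s {1..N+1}"
      proof (rule inj_onI)
        fix x y assume "?s x = ?s y"
        then have "int q *s (int x *s k) = int q *s (int y *s k)" by (simp add: b_inj)
        then have "int q * (int x * k $ a0) = int q * (int y * k $ a0)" by (metis vector_smult_component)
        then show "x = y" using a0 q(1) by simp
      qed
      then show ?thesis by (simp add: S0_def card_image)
    qed
    have t_S0: "t i s = 0" if "s \<in> S0" "i < r" for s i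
    proof -
      obtain m where "s = b (int q *s (int m *s k))" using \<open>s \<in> S0\<close> by (auto simp: S0_def)
      then have "t i s = \<bar>\<beta> i (int q *s (int m *s k))\<bar>" using \<beta>(2)[OF \<open>i < r\<close>] by (simp add: f_def)
      moreover have "\<beta> i (z *s x) = of_int z * \<beta> i x" for z x
        by (rule additive_scale[OF \<beta>(1)[OF \<open>i < r\<close>]]) (simp_all add: algebra_simps)
      moreover have "\<beta> i k = 0" using f0[OF \<open>i < r\<close>] \<beta>(2)[OF \<open>i < r\<close>] by simp
      ultimately show ?thesis by simp
    qed
    have t_S: "t i s = 0" if "s \<in> S" "i < r" for s i
    proof -
      consider "s \<in> S0" | s0 where "s0 \<in> S0" "s = ?c s0" using \<open>s \<in> S\<close> by (auto simp: S_def)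
      then show ?thesis
      proof cases
        case 2
        have "t i s = t i s0"
          using t_conj[OF \<open>i < r\<close> ig, of s0] 2 S0_H gF by auto
        then show ?thesis using t_S0 2 that by simp
      qed (use t_S0 that in simp)
    qed
    have "\<exists>x\<in>mspace (X i). \<forall>s\<in>S. mdist (X i) x (\<psi> i s x) \<le> 20 * \<delta> i + 6" if i: "i < r" for i
    proof -
      interpret A: isom_action ?K "X i" "\<psi> i" by (rule ia[OF i])
      have "\<exists>x\<in>mspace (X i). \<forall>s\<in>S. A.disp x s \<le> 20 * \<delta> i + 6"
      proof (rule A.small_common_displacement[OF \<delta>(2)[OF i] \<delta>(1)[OF i] \<delta>(3)[OF i]])
        show "finite S" by (simp add: S_def S0_def)
        show "S \<subseteq> carrier ?K" using S_H by simp
        show "s \<otimes>\<^bsub>?K\<^esub> s' = s' \<otimes>\<^bsub>?K\<^esub> s" if ss: "s \<in> S" "s' \<in> S" for s s'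
        proof -
          obtain k l where "s = b k" "s' = b l" using ss S_b by blast
          then show ?thesis using b_comm[of k l] by simp
        qed
        show "A.tlen s = 0" if "s \<in> S" for s using t_S[OF that i] by (simp add: t_def)
      qed
      then show ?thesis by (simp add: A.disp_def)
    qed
    then obtain x where x: "\<And>i. i < r \<Longrightarrow> x i \<in> mspace (X i)"
      "\<And>i s. i < r \<Longrightarrow> s \<in> S \<Longrightarrow> mdist (X i) (x i) (\<psi> i s (x i)) \<le> 20 * \<delta> i + 6" by metis
    define p where "p = (\<lambda>i\<in>{..<r}. x i)"
    have p: "p \<in> mspace (l1_product r X)" using x(1) by (simp add: p_def)
    interpret ga: group_action ?K "mspace (l1_product r X)" \<phi>
      using act unfolding product_acylindrical_action_def isometric_action_def by blast
    have gp: "\<phi> g p \<in> mspace (l1_product r X)" using ga.element_image[of g p] g p by auto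
    have far: "R \<le> mdist (l1_product r X) p (\<phi> g p)"
    proof -
      have "t i0 g \<le> mdist (X i0) (x i0) (\<psi> i0 g (x i0))"
        using isom_action.tlen_le[OF ia[OF i0], of g "x i0"] g x(1)[OF i0]
        by (simp add: t_def isom_action.disp_def[OF ia[OF i0]])
      also have "\<dots> \<le> (\<Sum>i<r. mdist (X i) (p i) (\<phi> g p i))"
        using member_le_sum[of i0 "{..<r}" "\<lambda>i. mdist (X i) (p i) (\<phi> g p i)"] i0 comp[OF g p i0]
        by (simp add: p_def)
      finally show ?thesis using tg by simp
    qed
    have "S0 \<subseteq> {h \<in> H. mdist (l1_product r X) p (\<phi> h p) \<le> E \<and> mdist (l1_product r X) (\<phi> g p) (\<phi> h (\<phi> g p)) \<le> E}"
    proof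
      fix s assume s: "s \<in> S0"
      have sH': "s \<in> H" using s S0_H by blast
      have cs: "?c s \<in> S" "?c s \<in> H" using s S_H by (auto simp: S_def)
      have "mdist (l1_product r X) p (\<phi> s p) \<le> E"
        unfolding mdist_l1_product E_def
      proof (rule sum_mono)
        fix i assume "i \<in> {..<r}"
        then show "mdist (X i) (p i) (\<phi> s p i) \<le> 20 * \<delta> i + 6"
          using comp[OF sH' p] x(2)[of i s] s by (simp add: p_def S_def)
      qed
      moreover have "mdist (l1_product r X) (\<phi> g p) (\<phi> s (\<phi> g p)) \<le> E"
        unfolding mdist_l1_product E_def
      proof (rule sum_mono)
        fix i assume "i \<in> {..<r}"
        then have i: "i < r" by simp
        interpret A: isom_action ?K "X i" "\<psi> i" by (rule ia[OF i])
        \<comment> \<open>The displacement of \<open>s\<close> at g p is that of g^-1 s g at p, and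
          this conjugate belongs to \<open>S\<close>.\<close>
        have "mdist (X i) (\<phi> g p i) (\<phi> s (\<phi> g p) i) = A.disp (\<psi> i g (x i)) s"
          using comp[OF g p i] comp[OF sH' gp i] i by (simp add: p_def A.disp_def)
        also have "\<dots> = A.disp (x i) (?c s)"
          using A.disp_conj[of s "inv\<^bsub>F\<^esub> g" "x i"] sH' ig x(1)[OF i] K_inv[OF ig] gF by simp
        also have "\<dots> \<le> 20 * \<delta> i + 6" using x(2)[OF i cs(1)] by (simp add: A.disp_def)
        finally show "mdist (X i) (\<phi> g p i) (\<phi> s (\<phi> g p) i) \<le> 20 * \<delta> i + 6" .
      qed
      ultimately show "s \<in> {h \<in> H. mdist (l1_product r X) p (\<phi> h p) \<le> E \<and> mdist (l1_product r X) (\<phi> g p) (\<phi> h (\<phi> g p)) \<le> E}"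
        using sH' by blast
    qed
    then have "card S0 \<le> N"
      using NR[OF p gp far] card_mono order_trans by blast
    then show False using card_S0 by simp
  qed

  have "\<exists>\<gamma>. (\<forall>k. \<gamma> (ratvec k) = \<beta> i k) \<and> (\<forall>x y. \<gamma> (x - y) = \<gamma> x - \<gamma> y) \<and> (\<forall>q x. \<gamma> (q *s x) = of_rat q * \<gamma> x)"
    if "i < r" for i
    using rat_linear_extension[of "\<beta> i", OF \<beta>(1)[OF that]] by metis
  then obtain \<gamma> where \<gamma>: "\<And>i k. i < r \<Longrightarrow> \<gamma> i (ratvec k) = \<beta> i k"
    "\<And>i x y. i < r \<Longrightarrow> \<gamma> i (x - y) = \<gamma> i x - \<gamma> i y" "\<And>i q x. i < r \<Longrightarrow> \<gamma> i (q *s x) = of_rat q * \<gamma> i x"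
    by metis
  \<comment> \<open>The candidates for the j-th column: the base element with coordinates
    \<open>axis j 1\<close> and its conjugates by \<open>H\<close> have equal translation length on
    every factor, which fixes all values of \<gamma> i up to sign.\<close>
  define W where "W j = {x. \<forall>i<r. \<bar>\<gamma> i x\<bar> = f i (axis j 1)}" for j
  have "finite (W j)" for j
    unfolding W_def
  proof (rule finite_abs_values)
    fix x assume x0: "\<And>i. i < r \<Longrightarrow> \<gamma> i x = 0"
    \<comment> \<open>Clearing denominators reduces joint injectivity on rational vectors to
      \<open>kernel\<close>.\<close>
    obtain m :: nat and z where m: "m > 0" "of_nat m *s x = ratvec z" using vec_common_denominator by blast
    have "f i z = 0" if "i < r" for i
      using \<gamma>(1)[OF that, of z] \<gamma>(3)[OF that, of "of_nat m" x] x0[OF that] \<beta>(2)[OF that] m by simp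
    then have "z = 0" by (rule kernel)
    then show "x = 0" using m by (simp add: vec_eq_iff)
  qed (use \<gamma>(2) in auto)
  then have fin: "finite {M :: rat ^ 'n ^ 'n. \<forall>j. M *v axis j 1 \<in> W j}" by (rule finite_matrices_by_columns)
  have "matrix_inv base_matrix ** clin g ** base_matrix \<in> {M. \<forall>j. M *v axis j 1 \<in> W j}" if g: "g \<in> H" for g
  proof (intro CollectI allI)
    fix j
    have gG: "g \<in> carrier G" using g subgroup.subset[OF sH] by blast
    have gF: "g \<in> carrier F" using gG G_in_F by blast
    obtain m l where m: "m > 0" "g \<cdot> comb (int m *s axis j 1) \<cdot> inv\<^bsub>F\<^esub> g = comb l"
      using conj_comb_multiple[OF gG] by metis
    have "base_matrix *v ratvec l = clin g *v (base_matrix *v ratvec (int m *s axis j 1))"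
      using caff_conj_comb[OF gF, of "int m *s axis j 1" 0] caff_comb[of l 0] m by simp
    then have "ratvec l = matrix_inv base_matrix *v (clin g *v (base_matrix *v ratvec (int m *s axis j 1)))"
      by (metis invertible_base_matrix invertible_cancel(1))
    also have "ratvec (int m *s axis j 1) = of_nat m *s axis j 1" by (simp add: vec_eq_iff axis_def)
    finally have l: "ratvec l = of_nat m *s ((matrix_inv base_matrix ** clin g ** base_matrix) *v axis j 1)"
      by (simp add: matrix_vector_mul_assoc[symmetric] vector_scalar_commute)
    show "(matrix_inv base_matrix ** clin g ** base_matrix) *v axis j 1 \<in> W j"
      unfolding W_def
    proof (intro CollectI allI impI)
      fix i assume i: "i < r"
      have sc: "\<beta> i (z *s x) = of_int z * \<beta> i x" for z x
        by (rule additive_scale[OF \<beta>(1)[OF i]]) (simp_all add: algebra_simps)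
      have "f i l = t i (g \<cdot> b (int m *s axis j 1) \<cdot> inv\<^bsub>F\<^esub> g)"
        using b_conj[OF gF m(2)] by (simp add: f_def)
      also have "\<dots> = f i (int m *s axis j 1)" using t_conj[OF i g b_H] by (simp add: f_def)
      also have "\<dots> = real m * f i (axis j 1)" by (simp add: \<beta>(2)[OF i] sc abs_mult)
      finally have "\<bar>\<gamma> i (ratvec l)\<bar> = real m * f i (axis j 1)" by (simp add: \<gamma>(1)[OF i] \<beta>(2)[OF i])
      then show "\<bar>\<gamma> i ((matrix_inv base_matrix ** clin g ** base_matrix) *v axis j 1)\<bar> = f i (axis j 1)"
        unfolding l \<gamma>(3)[OF i] using m(1) by (simp add: abs_mult)
    qed
  qed
  then have "(\<lambda>M. matrix_inv base_matrix ** M ** base_matrix) ` clin ` H \<subseteq> {M. \<forall>j. M *v axis j 1 \<in> W j}" by auto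
  then have fin': "finite ((\<lambda>M. matrix_inv base_matrix ** M ** base_matrix) ` clin ` H)" using fin finite_subset by blast
  have "inj_on (\<lambda>M. matrix_inv base_matrix ** M ** base_matrix) (clin ` H)"
    using inj_conj_matrix[OF invertible_base_matrix] by (rule inj_on_subset) simp
  then show "finite (clin ` H)" using fin' finite_imageD by blast
qed

end

section \<open>The Bass--Serre tree by normal forms\<close>

context gbs_graph_of_groups
begin

text \<open>The image of the edge group in the vertex group at the tail of \<open>e\<close>; its
  cosets are the edges of type \<open>e\<close> leaving a tree vertex.\<close>

definition Bsub :: "'e \<Rightarrow> (int ^ 'n) set" where
  "Bsub e = range (incl (rev_arc \<Gamma> e))"

text \<open>The isomorphism between the two images of the edge group. In F(\<Gamma>) it moves an
  element across the arc: b e = e theta(b), which is \<open>vclass_eclass\<close>.\<close>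

definition theta :: "'e \<Rightarrow> int ^ 'n \<Rightarrow> int ^ 'n" where
  "theta e b = incl e (inv_into UNIV (incl (rev_arc \<Gamma> e)) b)"

abbreviation rep :: "'e \<Rightarrow> int ^ 'n \<Rightarrow> int ^ 'n" where
  "rep e \<equiv> coset_rep (Bsub e)"

lemma theta_incl [simp]: "e \<in> garcs \<Gamma> \<Longrightarrow> theta e (incl (rev_arc \<Gamma> e) y) = incl e y"
  using inj_incl[of "rev_arc \<Gamma> e"] by (simp add: theta_def)

lemma additive_Bsub:
  assumes "e \<in> garcs \<Gamma>"
  shows "additive_subgroup_Zn (Bsub e)"
proof
  note add = incl_add[of "rev_arc \<Gamma> e"]
  have r: "rev_arc \<Gamma> e \<in> garcs \<Gamma>" using assms by simp
  show "0 \<in> Bsub e" using additive_laws(1)[of "incl (rev_arc \<Gamma> e)", OF add[OF r]]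
    unfolding Bsub_def by (intro range_eqI[of _ _ 0]) simp
  show "x - y \<in> Bsub e" if xy: "x \<in> Bsub e" "y \<in> Bsub e" for x y
  proof -
    obtain x' y' where "x = incl (rev_arc \<Gamma> e) x'" "y = incl (rev_arc \<Gamma> e) y'"
      using xy unfolding Bsub_def by blast
    then have "x - y = incl (rev_arc \<Gamma> e) (x' - y')"
      by (simp only: additive_laws(3)[of "incl (rev_arc \<Gamma> e)", OF add[OF r]])
    then show ?thesis unfolding Bsub_def by blast
  qed
qed

lemma Bsub_cases:
  assumes "e \<in> garcs \<Gamma>" "b \<in> Bsub e"
  obtains y where "b = incl (rev_arc \<Gamma> e) y" "theta e b = incl e y"
  using assms theta_incl[OF assms(1)] unfolding Bsub_def by blast

lemma theta_in: "e \<in> garcs \<Gamma> \<Longrightarrow> b \<in> Bsub e \<Longrightarrow> theta e b \<in> Bsub (rev_arc \<Gamma> e)"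
  by (erule Bsub_cases, assumption) (simp add: Bsub_def)

lemma theta_theta:
  assumes e: "e \<in> garcs \<Gamma>" and b: "b \<in> Bsub e"
  shows "theta (rev_arc \<Gamma> e) (theta e b) = b"
proof -
  obtain y where y: "b = incl (rev_arc \<Gamma> e) y" "theta e b = incl e y" using Bsub_cases[OF e b] by blast
  then show ?thesis using theta_incl[of "rev_arc \<Gamma> e" y] e by simp
qed

lemma theta_add:
  assumes e: "e \<in> garcs \<Gamma>" and b: "b \<in> Bsub e" and b': "b' \<in> Bsub e"
  shows "theta e (b + b') = theta e b + theta e b'"
proof -
  have r: "rev_arc \<Gamma> e \<in> garcs \<Gamma>" using e by simp
  obtain y where y: "b = incl (rev_arc \<Gamma> e) y" "theta e b = incl e y" using Bsub_cases[OF e b] by blast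
  obtain y' where y': "b' = incl (rev_arc \<Gamma> e) y'" "theta e b' = incl e y'" using Bsub_cases[OF e b'] by blast
  have "theta e (incl (rev_arc \<Gamma> e) (y + y')) = incl e (y + y')" by (rule theta_incl[OF e])
  then show ?thesis by (simp only: y(2) y'(2) y(1)[symmetric] y'(1)[symmetric] incl_add[OF e] incl_add[OF r])
qed

text \<open>Vertices of the Bass--Serre tree as normal forms: the list \<open>(c\<^sub>1, e\<^sub>1), \<dots>, (c\<^sub>k, e\<^sub>k)\<close> stands for
  the coset of \<open>c\<^sub>1 e\<^sub>1 \<cdots> c\<^sub>k e\<^sub>k\<close>, the \<open>c\<^sub>i\<close> being coset representatives.\<close>

fun valid :: "'v \<Rightarrow> ((int ^ 'n) \<times> 'e) list \<Rightarrow> bool" where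
  "valid v [] \<longleftrightarrow> v \<in> gverts \<Gamma>"
| "valid v ((c, e) # p) \<longleftrightarrow> e \<in> garcs \<Gamma> \<and> gtail \<Gamma> e = v \<and> rep e c = c \<and> valid (ghead \<Gamma> e) p \<and>
     (\<forall>p'. p \<noteq> (0, rev_arc \<Gamma> e) # p')"

text \<open>Left multiplication by a vertex element: \<open>x + c\<close> splits into its
  representative and a remainder in \<open>Bsub e\<close>, and the remainder is moved across the arc
  to act on the rest.\<close>

fun vact :: "int ^ 'n \<Rightarrow> ((int ^ 'n) \<times> 'e) list \<Rightarrow> ((int ^ 'n) \<times> 'e) list" where
  "vact x [] = []"
| "vact x ((c, e) # p) = (rep e (x + c), e) # vact (theta e (x + c - rep e (x + c))) p"

text \<open>Left multiplication by an arc, which cancels against a form that begins by running back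
  along it.\<close>

definition eact :: "'e \<Rightarrow> ((int ^ 'n) \<times> 'e) list \<Rightarrow> ((int ^ 'n) \<times> 'e) list" where
  "eact e p = (if \<exists>p'. p = (0, rev_arc \<Gamma> e) # p' then tl p else (0, e) # p)"

lemma eact_cancel [simp]: "eact e ((0, rev_arc \<Gamma> e) # p) = p"
  by (simp add: eact_def)

lemma eact_push: "(\<And>p'. p \<noteq> (0, rev_arc \<Gamma> e) # p') \<Longrightarrow> eact e p = (0, e) # p"
  by (simp add: eact_def)

text \<open>\<open>theta e b\<close> lies in the very subgroup whose cosets are recorded by entries
  with arc \<open>rev_arc \<Gamma> e\<close>, so it leaves such a head representative unchanged.
  Hence \<open>vact\<close> preserves reducedness and respects the case distinction in
  \<open>eact\<close>.\<close>

lemma vact_head_zero: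
  assumes e: "e \<in> garcs \<Gamma>" and b: "b \<in> Bsub e" and p: "valid (ghead \<Gamma> e) p"
  shows "(\<exists>p'. vact (theta e b) p = (0, rev_arc \<Gamma> e) # p') \<longleftrightarrow> (\<exists>p'. p = (0, rev_arc \<Gamma> e) # p')"
proof (cases p)
  case (Cons a q)
  obtain c e' where a: "a = (c, e')" by (cases a)
  show ?thesis
  proof (cases "e' = rev_arc \<Gamma> e")
    case True
    then have "additive_subgroup_Zn (Bsub e')" using p by (simp add: a Cons additive_Bsub)
    then interpret additive_subgroup_Zn "Bsub e'" .
    have "rep e' (theta e b + c) = rep e' c"
      unfolding rep_eq_iff using theta_in[OF e b] True by simp
    then have "rep e' (theta e b + c) = c" using p by (simp add: Cons a)
    then show ?thesis by (simp add: Cons a)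
  qed (simp add: Cons a)
qed simp

lemma diff_rep_in: "e \<in> garcs \<Gamma> \<Longrightarrow> x - rep e x \<in> Bsub e"
  using additive_subgroup_Zn.diff_rep[OF additive_Bsub] .

lemma valid_vact: "valid v p \<Longrightarrow> valid v (vact x p)"
proof (induction x p arbitrary: v rule: vact.induct)
  case (2 x c e p)
  have e: "e \<in> garcs \<Gamma>" using 2 by simp
  interpret additive_subgroup_Zn "Bsub e" by (rule additive_Bsub[OF e])
  show ?case
    using 2 vact_head_zero[OF e diff_rep_in[OF e, of "x + c"], of p] by auto
qed simp

lemma vact_zero: "valid v p \<Longrightarrow> vact 0 p = p"
proof (induction p arbitrary: v)
  case (Cons a p)
  obtain c e where a: "a = (c, e)" by (cases a)
  have e: "e \<in> garcs \<Gamma>" using Cons.prems by (simp add: a)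
  interpret additive_subgroup_Zn "Bsub e" by (rule additive_Bsub[OF e])
  have "theta e 0 = 0" using theta_add[OF e zero zero] by simp
  then show ?case using Cons.IH[of "ghead \<Gamma> e"] Cons.prems by (simp add: a)
qed simp

text \<open>The remainders moved across the first arc add up, as \<open>theta e\<close> is additive
  on \<open>Bsub e\<close>.\<close>

lemma vact_vact: "valid v p \<Longrightarrow> vact x (vact y p) = vact (x + y) p"
proof (induction p arbitrary: v x y)
  case (Cons a p)
  obtain c e where a: "a = (c, e)" by (cases a)
  have e: "e \<in> garcs \<Gamma>" and p: "valid (ghead \<Gamma> e) p" using Cons.prems by (simp_all add: a)
  interpret additive_subgroup_Zn "Bsub e" by (rule additive_Bsub[OF e])
  define d where "d = rep e (y + c)"
  have 1: "rep e (x + d) = rep e (x + y + c)"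
    unfolding d_def rep_eq_iff using rep_diff[of "y + c"] by (simp add: algebra_simps)
  have "theta e (x + d - rep e (x + d)) + theta e (y + c - d) = theta e (x + y + c - rep e (x + y + c))"
  proof -
    have "(x + d - rep e (x + d)) + (y + c - d) = x + y + c - rep e (x + y + c)" by (simp add: 1)
    moreover have "y + c - d \<in> Bsub e" unfolding d_def by (rule diff_rep_in[OF e])
    ultimately show ?thesis
      using theta_add[OF e diff_rep_in[OF e, of "x + d"], of "y + c - d"] by (simp only:)
  qed
  then show ?case using Cons.IH[OF p] 1 by (simp add: a d_def)
qed simp

lemma valid_eact:
  assumes e: "e \<in> garcs \<Gamma>" and p: "valid (ghead \<Gamma> e) p"
  shows "valid (gtail \<Gamma> e) (eact e p)"
proof -
  interpret additive_subgroup_Zn "Bsub e" by (rule additive_Bsub[OF e])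
  show ?thesis using e p by (auto simp: eact_def)
qed

lemma eact_eact:
  assumes e: "e \<in> garcs \<Gamma>" and p: "valid (gtail \<Gamma> e) p"
  shows "eact e (eact (rev_arc \<Gamma> e) p) = p"
proof (cases "\<exists>p'. p = (0, e) # p'")
  case True
  then obtain p' where p': "p = (0, e) # p'" by blast
  then show ?thesis using p eact_cancel[of "rev_arc \<Gamma> e" p'] by (simp add: eact_push)
next
  case False
  then show ?thesis by (simp add: eact_push)
qed

text \<open>The edge relation, checked on normal forms. If the arc cancels, applying \<theta> in
  both directions returns \<open>b\<close>; otherwise \<open>b\<close> leaves the new head
  representative 0 alone and only \<open>theta e b\<close> is passed on.\<close>

lemma eact_vact:
  assumes e: "e \<in> garcs \<Gamma>" and b: "b \<in> Bsub e" and p: "valid (ghead \<Gamma> e) p"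
  shows "eact e (vact (theta e b) p) = vact b (eact e p)"
proof (cases "\<exists>p'. p = (0, rev_arc \<Gamma> e) # p'")
  case True
  then obtain p' where p': "p = (0, rev_arc \<Gamma> e) # p'" by blast
  have r: "rev_arc \<Gamma> e \<in> garcs \<Gamma>" using e by simp
  interpret r: additive_subgroup_Zn "Bsub (rev_arc \<Gamma> e)" by (rule additive_Bsub[OF r])
  have "rep (rev_arc \<Gamma> e) (theta e b) = 0" using theta_in[OF e b] by (simp add: r.rep_eq_0_iff)
  then show ?thesis by (simp add: p' theta_theta[OF e b])
next
  case False
  interpret additive_subgroup_Zn "Bsub e" by (rule additive_Bsub[OF e])
  have "rep e b = 0" using b by (simp add: rep_eq_0_iff)
  then show ?thesis using False vact_head_zero[OF e b p] by (simp add: eact_push)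
qed

lemma length_vact [simp]: "length (vact x p) = length p"
  by (induction x p rule: vact.induct) auto

text \<open>Adding \<open>x\<close> to two head entries with the same arc keeps them equal or
  distinct; if they are equal, so are the remainders passed on to the tails.\<close>

lemma lcp_vact: "valid v p \<Longrightarrow> valid v q \<Longrightarrow> lcp (vact x p) (vact x q) = lcp p q"
proof (induction p q arbitrary: v x rule: lcp.induct)
  case (1 a p a' q)
  obtain c e c' e' where a: "a = (c, e)" "a' = (c', e')" by (cases a; cases a')
  have e: "e \<in> garcs \<Gamma>" using 1 by (simp add: a)
  interpret additive_subgroup_Zn "Bsub e" by (rule additive_Bsub[OF e])
  show ?case
  proof (cases "e = e'")
    case True
    have "rep e (x + c) = rep e (x + c') \<longleftrightarrow> rep e c = rep e c'"
      by (simp add: rep_eq_iff)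
    then have "rep e (x + c) = rep e (x + c') \<longleftrightarrow> c = c'" using 1 True by (simp add: a)
    then show ?thesis using 1 True by (auto simp: a)
  qed (simp add: a)
qed auto

lemma vdist_vact: "valid v p \<Longrightarrow> valid v q \<Longrightarrow> vdist (vact x p) (vact x q) = vdist p q"
  by (simp add: vdist_def lcp_vact)

lemma lcp_Cons_neq: "(\<And>p'. q \<noteq> a # p') \<Longrightarrow> lcp (a # p) q = 0"
  by (cases q) auto

text \<open>If both forms gain a head or both lose one, lengths and common prefix change together.
  In the mixed case one length drops, the other grows, and the common prefix is empty before and
  after.\<close>

lemma vdist_eact:
  assumes e: "e \<in> garcs \<Gamma>" and p: "valid (ghead \<Gamma> e) p" and q: "valid (ghead \<Gamma> e) q"
  shows "vdist (eact e p) (eact e q) = vdist p q"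
proof -
  have key: "vdist (eact e p) (eact e q) = vdist p q"
    if pp: "p = (0, rev_arc \<Gamma> e) # p'" and qq: "\<And>q'. q \<noteq> (0, rev_arc \<Gamma> e) # q'"
      and p: "valid (ghead \<Gamma> e) p" for p q p'
  proof -
    have "lcp p q = 0" using lcp_Cons_neq[OF qq, of p'] by (simp add: pp)
    \<comment> \<open>Reducedness of \<open>p\<close> prevents \<open>p'\<close> from beginning with
      (0, e).\<close>
    moreover have "lcp p' ((0, e) # q) = 0"
      using p lcp_Cons_neq[of p' "(0, e)" q] by (simp add: pp lcp_commute[of p'])
    ultimately show ?thesis unfolding eact_push[OF qq] by (simp add: vdist_def pp)
  qed
  show ?thesis
  proof (cases "\<exists>p'. p = (0, rev_arc \<Gamma> e) # p'"; cases "\<exists>q'. q = (0, rev_arc \<Gamma> e) # q'")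
    assume "\<exists>p'. p = (0, rev_arc \<Gamma> e) # p'" "\<exists>q'. q = (0, rev_arc \<Gamma> e) # q'"
    then show ?thesis by (auto simp: vdist_def)
  next
    assume "\<exists>p'. p = (0, rev_arc \<Gamma> e) # p'" "\<not> (\<exists>q'. q = (0, rev_arc \<Gamma> e) # q')"
    then show ?thesis using key[of p _ q] p by blast
  next
    assume "\<not> (\<exists>p'. p = (0, rev_arc \<Gamma> e) # p')" "\<exists>q'. q = (0, rev_arc \<Gamma> e) # q'"
    then have "vdist (eact e q) (eact e p) = vdist q p" using key[of q _ p] q by blast
    then show ?thesis by (simp add: vdist_def lcp_commute add.commute)
  next
    assume "\<not> (\<exists>p'. p = (0, rev_arc \<Gamma> e) # p')" "\<not> (\<exists>q'. q = (0, rev_arc \<Gamma> e) # q')"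
    then show ?thesis by (simp add: eact_push vdist_def)
  qed
qed

text \<open>The letters have to act on all normal forms at once; an arc, which matters only on
  the normal forms at its head, is made to swap those at its two ends.\<close>

definition letter_act :: "('v, 'e, 'g) letter \<Rightarrow> 'v \<times> ((int ^ 'n) \<times> 'e) list \<Rightarrow> 'v \<times> ((int ^ 'n) \<times> 'e) list" where
  "letter_act l y = (case l of
     Vtx v x \<Rightarrow> if fst y = v then (v, vact (vcoord v x) (snd y)) else y
   | Edg e \<Rightarrow> if fst y = ghead \<Gamma> e then (gtail \<Gamma> e, eact e (snd y))
       else if fst y = gtail \<Gamma> e then (ghead \<Gamma> e, eact (rev_arc \<Gamma> e) (snd y)) else y)"

definition forms :: "('v \<times> ((int ^ 'n) \<times> 'e) list) set" where
  "forms = {(v, p). valid v p}"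

lemma letter_act_vletter [simp]:
  "v \<in> gverts \<Gamma> \<Longrightarrow> letter_act (vletter v k) (u, p) = (if u = v then (v, vact k p) else (u, p))"
  by (simp add: letter_act_def vletter_def)

lemma letter_act_Edg [simp]:
  "letter_act (Edg e) (u, p) = (if u = ghead \<Gamma> e then (gtail \<Gamma> e, eact e p)
     else if u = gtail \<Gamma> e then (ghead \<Gamma> e, eact (rev_arc \<Gamma> e) p) else (u, p))"
  by (simp add: letter_act_def)

lemma forms_iff [simp]: "(v, p) \<in> forms \<longleftrightarrow> valid v p"
  by (simp add: forms_def)

lemma letter_act_forms:
  assumes "l \<in> letters \<Gamma>" "y \<in> forms"
  shows "letter_act l y \<in> forms"
proof -
  obtain u p where y: "y = (u, p)" by (cases y)
  show ?thesis
    using assms(1)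
  proof (cases rule: letter_cases)
    case (1 v k)
    then show ?thesis using assms(2) valid_vact[of v p k] by (auto simp: y)
  next
    case (2 e)
    then show ?thesis using assms(2) valid_eact[of e p] valid_eact[of "rev_arc \<Gamma> e" p] by (auto simp: y)
  qed
qed

lemma foldr_letter_act_word_eq:
  assumes "word_eq \<Gamma> w w'" "y \<in> forms"
  shows "foldr letter_act w y = foldr letter_act w' y"
  using assms(1)
proof (rule foldr_word_eq[OF _ _ _ _ _ _ assms(2)])
  fix v k l and y assume v: "v \<in> gverts \<Gamma>" and y: "y \<in> forms"
  then show "letter_act (vletter v k) (letter_act (vletter v l) y) = letter_act (vletter v (k + l)) y"
    by (cases y) (auto simp: vact_vact)
  show "letter_act (vletter v 0) y = y" using v y by (cases y) (auto simp: vact_zero)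
next
  fix e and y assume e: "e \<in> garcs \<Gamma>" and y: "y \<in> forms"
  then show "letter_act (Edg e) (letter_act (Edg (rev_arc \<Gamma> e)) y) = y"
    using eact_eact[of e] eact_eact[of "rev_arc \<Gamma> e"] by (cases y) auto
next
  fix e x and y assume e: "e \<in> garcs \<Gamma>" and y: "y \<in> forms"
  obtain u p where up: "y = (u, p)" by (cases y)
  have r: "rev_arc \<Gamma> e \<in> garcs \<Gamma>" using e by simp
  have b: "incl (rev_arc \<Gamma> e) x \<in> Bsub e" by (simp add: Bsub_def)
  have main: "eact e (vact (incl e x) (eact (rev_arc \<Gamma> e) p)) = vact (incl (rev_arc \<Gamma> e) x) p" if "u = gtail \<Gamma> e"
  proof -
    have p: "valid (gtail \<Gamma> e) p" using y up that by simp
    have "valid (ghead \<Gamma> e) (eact (rev_arc \<Gamma> e) p)" using valid_eact[OF r] p e by simp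
    from eact_vact[OF e b this] show ?thesis using e eact_eact[OF e p] by simp
  qed
  show "letter_act (Edg e) (letter_act (vletter (ghead \<Gamma> e) (incl e x)) (letter_act (Edg (rev_arc \<Gamma> e)) y))
        = letter_act (vletter (gtail \<Gamma> e) (incl (rev_arc \<Gamma> e) x)) y"
    using e y main eact_eact[OF r, of p] by (auto simp: up)
qed (rule letter_act_forms)

definition cact :: "('v, 'e, 'g) letter list set \<Rightarrow> 'v \<times> ((int ^ 'n) \<times> 'e) list \<Rightarrow> 'v \<times> ((int ^ 'n) \<times> 'e) list" where
  "cact X = foldr letter_act (SOME w. w \<in> X)"

lemma cact_class:
  assumes "w \<in> lists (letters \<Gamma>)" "y \<in> forms"
  shows "cact (word_class \<Gamma> w) y = foldr letter_act w y"
  unfolding cact_def using foldr_letter_act_word_eq[OF word_eq_some[OF assms(1)] assms(2)] by simp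

lemma foldr_letter_act_forms: "w \<in> lists (letters \<Gamma>) \<Longrightarrow> y \<in> forms \<Longrightarrow> foldr letter_act w y \<in> forms"
  by (induction w) (auto simp: letter_act_forms)

lemma cact_forms: "X \<in> carrier F \<Longrightarrow> y \<in> forms \<Longrightarrow> cact X y \<in> forms"
  by (erule F_cases) (simp add: cact_class foldr_letter_act_forms)

lemma cact_mult: "X \<in> carrier F \<Longrightarrow> Z \<in> carrier F \<Longrightarrow> y \<in> forms \<Longrightarrow> cact (X \<cdot> Z) y = cact X (cact Z y)"
  by (elim F_cases) (simp add: path_group_mult cact_class foldr_letter_act_forms)

lemma cact_one: "y \<in> forms \<Longrightarrow> cact \<one>\<^bsub>F\<^esub> y = y"
  by (simp add: one_F cact_class)

lemma foldr_letter_act_path: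
  "path_word \<Gamma> u w v \<Longrightarrow> valid v p \<Longrightarrow> fst (foldr letter_act w (v, p)) = u"
proof (induction rule: path_word_induct)
  case (vletter u k w)
  then show ?case by (cases "foldr letter_act w (v, p)") simp
next
  case (Edg e w)
  then show ?case by (cases "foldr letter_act w (v, p)") simp
qed simp

lemma foldr_letter_act_vdist:
  "path_word \<Gamma> u w v \<Longrightarrow> valid v p \<Longrightarrow> valid v q \<Longrightarrow>
    vdist (snd (foldr letter_act w (v, p))) (snd (foldr letter_act w (v, q))) = vdist p q"
proof (induction rule: path_word_induct)
  case (vletter u k w)
  obtain p' q' where e: "foldr letter_act w (v, p) = (u, p')" "foldr letter_act w (v, q) = (u, q')"
    using foldr_letter_act_path[OF vletter(2)] vletter.prems by (metis prod.collapse)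
  moreover have "valid u p'" "valid u q'"
    using foldr_letter_act_forms[OF path_word_lists[OF vletter(2)]] vletter.prems e by (metis forms_iff)+
  ultimately show ?case using vletter by (simp add: vdist_vact)
next
  case (Edg e w)
  obtain p' q' where eq: "foldr letter_act w (v, p) = (ghead \<Gamma> e, p')" "foldr letter_act w (v, q) = (ghead \<Gamma> e, q')"
    using foldr_letter_act_path[OF Edg(2)] Edg.prems by (metis prod.collapse)
  moreover have "valid (ghead \<Gamma> e) p'" "valid (ghead \<Gamma> e) q'"
    using foldr_letter_act_forms[OF path_word_lists[OF Edg(2)]] Edg.prems eq by (metis forms_iff)+
  ultimately show ?case using Edg by (simp add: vdist_eact)
qed simp

lemma cact_path:
  assumes "X \<in> path_classes \<Gamma> u v" "valid v p"
  shows "cact X (v, p) = (u, snd (cact X (v, p)))" "valid u (snd (cact X (v, p)))"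
    "valid v q \<Longrightarrow> vdist (snd (cact X (v, p))) (snd (cact X (v, q))) = vdist p q"
proof -
  obtain w where w: "path_word \<Gamma> u w v" "X = word_class \<Gamma> w" "w \<in> lists (letters \<Gamma>)"
    using assms(1) by (rule path_classes_cases)
  have c: "cact X (v, p) = foldr letter_act w (v, p)" if "valid v p" for p using w that by (simp add: cact_class)
  show 1: "cact X (v, p) = (u, snd (cact X (v, p)))"
    using foldr_letter_act_path[OF w(1) assms(2)] c[OF assms(2)] by (metis prod.collapse)
  have "cact X (v, p) \<in> forms" using w assms(2) by (intro cact_forms) auto
  then show "valid u (snd (cact X (v, p)))" using 1 by (metis forms_iff)
  show "valid v q \<Longrightarrow> vdist (snd (cact X (v, p))) (snd (cact X (v, q))) = vdist p q"
    using foldr_letter_act_vdist[OF w(1) assms(2)] c assms(2) by simp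
qed

section \<open>Normal forms as elements of F(\<Gamma>)\<close>

fun form_word :: "((int ^ 'n) \<times> 'e) list \<Rightarrow> ('v, 'e, 'g) letter list" where
  "form_word [] = []"
| "form_word ((c, e) # p) = vletter (gtail \<Gamma> e) c # Edg e # form_word p"

fun form_end :: "'v \<Rightarrow> ((int ^ 'n) \<times> 'e) list \<Rightarrow> 'v" where
  "form_end v [] = v"
| "form_end v ((c, e) # p) = form_end (ghead \<Gamma> e) p"

lemma form_word_path: "valid v p \<Longrightarrow> path_word \<Gamma> v (form_word p) (form_end v p)"
  by (induction v p rule: valid.induct) auto

text \<open>By reducedness no arc cancels while the word is read, so a normal form is recovered from
  the action of its word on the base vertex. In particular normal forms are unique.\<close>

lemma foldr_form_word: "valid v p \<Longrightarrow> foldr letter_act (form_word p) (form_end v p, []) = (v, p)"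
proof (induction v p rule: valid.induct)
  case (2 v c e p)
  have e: "e \<in> garcs \<Gamma>" using 2 by simp
  interpret additive_subgroup_Zn "Bsub e" by (rule additive_Bsub[OF e])
  have "theta e 0 = 0" using theta_add[OF e zero zero] by simp
  then show ?case using 2 vact_zero by (auto simp: eact_push)
qed simp

abbreviation form_class where "form_class p \<equiv> word_class \<Gamma> (form_word p)"

lemma form_class_path: "valid v p \<Longrightarrow> form_class p \<in> path_classes \<Gamma> v (form_end v p)"
  using form_word_path path_classesI by blast

lemma cact_form_class: "valid v p \<Longrightarrow> cact (form_class p) (form_end v p, []) = (v, p)"
  using form_word_path[of v p] path_word_lists path_word_verts foldr_form_word
  by (subst cact_class) auto

definition eclass :: "'e \<Rightarrow> ('v, 'e, 'g) letter list set" where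
  "eclass e = word_class \<Gamma> [Edg e]"

lemma eclass_in [simp]: "e \<in> garcs \<Gamma> \<Longrightarrow> eclass e \<in> carrier F"
  by (simp add: eclass_def)

lemma eclass_rev: "e \<in> garcs \<Gamma> \<Longrightarrow> eclass e \<cdot> eclass (rev_arc \<Gamma> e) = \<one>\<^bsub>F\<^esub>"
  using class_eqI[OF word_eq.edge_inv[of e \<Gamma>]] by (simp add: eclass_def path_group_mult one_F)

lemma vclass_eclass:
  assumes e: "e \<in> garcs \<Gamma>"
  shows "vclass (gtail \<Gamma> e) (incl (rev_arc \<Gamma> e) y) \<cdot> eclass e = eclass e \<cdot> vclass (ghead \<Gamma> e) (incl e y)"
proof -
  have i: "eclass (rev_arc \<Gamma> e) = inv\<^bsub>F\<^esub> (eclass e)"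
    using eclass_rev[of "rev_arc \<Gamma> e"] e by (intro F.inv_equality[symmetric]) auto
  have "eclass e \<cdot> vclass (ghead \<Gamma> e) (incl e y) \<cdot> eclass (rev_arc \<Gamma> e) = vclass (gtail \<Gamma> e) (incl (rev_arc \<Gamma> e) y)"
    using class_eqI[OF word_eq_edge[OF e, of y]] e by (simp add: eclass_def vclass_def path_group_mult)
  then have "vclass (gtail \<Gamma> e) (incl (rev_arc \<Gamma> e) y) \<cdot> eclass e =
      (eclass e \<cdot> vclass (ghead \<Gamma> e) (incl e y) \<cdot> inv\<^bsub>F\<^esub> (eclass e)) \<cdot> eclass e"
    by (simp only: i)
  also have "\<dots> = eclass e \<cdot> vclass (ghead \<Gamma> e) (incl e y)" using e by (simp add: F.m_assoc)
  finally show ?thesis .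
qed

lemma form_class_Nil: "form_class [] = \<one>\<^bsub>F\<^esub>"
  by (simp add: one_F)

lemma form_class_Cons:
  assumes "valid v ((c, e) # p)"
  shows "form_class ((c, e) # p) = vclass (gtail \<Gamma> e) c \<cdot> (eclass e \<cdot> form_class p)"
proof -
  have e: "e \<in> garcs \<Gamma>" and p: "form_word p \<in> lists (letters \<Gamma>)"
    using assms form_word_path[of "ghead \<Gamma> e" p] path_word_lists by auto
  then show ?thesis by (simp add: vclass_def eclass_def path_group_mult)
qed

lemma form_class_F [simp]: "valid v p \<Longrightarrow> form_class p \<in> carrier F"
  using form_class_path path_classes_F by blast

text \<open>The vertex element travels through the word, changing the representatives as
  \<open>vact\<close> does; \<open>y\<close> is what emerges at the far end.\<close>

lemma vclass_form_class:
  "valid v p \<Longrightarrow> \<exists>y. vclass v x \<cdot> form_class p = form_class (vact x p) \<cdot> vclass (form_end v p) y"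
proof (induction p arbitrary: v x)
  case Nil
  then show ?case using form_class_Nil by (intro exI[of _ x]) simp
next
  case (Cons a p)
  obtain c e where a: "a = (c, e)" by (cases a)
  have e: "e \<in> garcs \<Gamma>" and v: "v = gtail \<Gamma> e" and p: "valid (ghead \<Gamma> e) p" using Cons.prems by (auto simp: a)
  define c' where "c' = rep e (x + c)"
  define b where "b = x + c - c'"
  have b: "b \<in> Bsub e" unfolding b_def c'_def by (rule diff_rep_in[OF e])
  obtain y where y: "b = incl (rev_arc \<Gamma> e) y" "theta e b = incl e y" by (rule Bsub_cases[OF e b])
  obtain z where z: "vclass (ghead \<Gamma> e) (incl e y) \<cdot> form_class p =
      form_class (vact (incl e y) p) \<cdot> vclass (form_end (ghead \<Gamma> e) p) z"
    using Cons.IH[OF p] by blast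
  have va: "vact x (a # p) = (c', e) # vact (incl e y) p" by (simp add: a c'_def y(2)[symmetric] b_def)
  have val: "valid v ((c', e) # vact (incl e y) p)" using valid_vact[OF Cons.prems, of x] unfolding va .
  have en: "form_end (ghead \<Gamma> e) p \<in> gverts \<Gamma>" using form_word_path[OF p] path_word_verts by blast
  have in_F: "form_class p \<in> carrier F" "form_class (vact (incl e y) p) \<in> carrier F"
    using p valid_vact by (auto intro: form_class_F)
  have "vclass v x \<cdot> form_class (a # p) = vclass v (x + c) \<cdot> (eclass e \<cdot> form_class p)"
    using Cons.prems e in_F unfolding a by (simp add: form_class_Cons[OF Cons.prems[unfolded a]] v vclass_add F.m_assoc del: form_word.simps)
  also have "x + c = c' + b" by (simp add: b_def)
  also have "vclass v (c' + b) \<cdot> (eclass e \<cdot> form_class p) = vclass v c' \<cdot> ((vclass v b \<cdot> eclass e) \<cdot> form_class p)"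
    using e in_F by (simp add: v vclass_add F.m_assoc)
  also have "vclass v b \<cdot> eclass e = eclass e \<cdot> vclass (ghead \<Gamma> e) (incl e y)" unfolding y(1) v by (rule vclass_eclass[OF e])
  also have "vclass v c' \<cdot> (eclass e \<cdot> vclass (ghead \<Gamma> e) (incl e y) \<cdot> form_class p) =
      vclass v c' \<cdot> (eclass e \<cdot> (vclass (ghead \<Gamma> e) (incl e y) \<cdot> form_class p))"
    using e in_F by (simp add: v F.m_assoc)
  also have "\<dots> = (vclass v c' \<cdot> (eclass e \<cdot> form_class (vact (incl e y) p))) \<cdot> vclass (form_end (ghead \<Gamma> e) p) z"
    unfolding z using e in_F en by (simp add: v F.m_assoc)
  also have "vclass v c' \<cdot> (eclass e \<cdot> form_class (vact (incl e y) p)) = form_class (vact x (a # p))"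
    unfolding va form_class_Cons[OF val] v ..
  finally show ?case by (auto simp: a)
qed

lemma eact_form_class:
  assumes e: "e \<in> garcs \<Gamma>" and p: "valid (ghead \<Gamma> e) p"
  shows "eclass e \<cdot> form_class p = form_class (eact e p)"
proof (cases "\<exists>p'. p = (0, rev_arc \<Gamma> e) # p'")
  case True
  then obtain p' where p': "p = (0, rev_arc \<Gamma> e) # p'" by blast
  have "form_class p' \<in> carrier F" using p e unfolding p' by (intro form_class_F[of "gtail \<Gamma> e"]) simp
  moreover have "form_class p = eclass (rev_arc \<Gamma> e) \<cdot> form_class p'"
    using form_class_Cons[OF p[unfolded p']] e \<open>form_class p' \<in> carrier F\<close>
    by (simp add: p' vclass_zero del: form_word.simps)
  ultimately show ?thesis using e eclass_rev[OF e] by (simp add: p' F.m_assoc[symmetric] del: form_word.simps)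
next
  case False
  have v: "valid (gtail \<Gamma> e) ((0, e) # p)" using valid_eact[OF e p] False by (simp add: eact_push)
  show ?thesis using False form_class_Cons[OF v] e form_class_F[OF p]
    by (simp add: eact_push vclass_zero del: form_word.simps)
qed

text \<open>The rules by which letters act on normal forms are the rules for rewriting words, up to
  a vertex element at the far end. So the image of the base vertex is the normal form of the
  class.\<close>

lemma path_class_eq_form_class:
  assumes "X \<in> path_classes \<Gamma> u v"
  shows "\<exists>x. X = form_class (snd (cact X (v, []))) \<cdot> vclass v x"
proof -
  obtain w where w: "path_word \<Gamma> u w v" "X = word_class \<Gamma> w" "w \<in> lists (letters \<Gamma>)"
    using assms by (rule path_classes_cases)
  have v: "v \<in> gverts \<Gamma>" using path_word_verts[OF w(1)] by simp
  have "\<exists>x. word_class \<Gamma> w = form_class (snd (foldr letter_act w (v, []))) \<cdot> vclass v x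
      \<and> form_end u (snd (foldr letter_act w (v, []))) = v"
    using w(1)
  proof (induction rule: path_word_induct)
    case Nil
    then show ?case by (intro exI[of _ 0]) (simp add: vclass_zero flip: one_F)
  next
    case (vletter u k w)
    obtain q where q: "foldr letter_act w (v, []) = (u, q)"
      using foldr_letter_act_path[OF vletter(2)] v by (metis prod.collapse valid.simps(1))
    have vq: "valid u q"
      using foldr_letter_act_forms[OF path_word_lists[OF vletter(2)], of "(v, [])"] v by (simp add: q)
    obtain x where x: "word_class \<Gamma> w = form_class q \<cdot> vclass v x" "form_end u q = v" using vletter.IH by (auto simp: q)
    obtain y where y: "vclass u k \<cdot> form_class q = form_class (vact k q) \<cdot> vclass v y"
      using vclass_form_class[OF vq] x(2) by auto
    have "word_class \<Gamma> (vletter u k # w) = vclass u k \<cdot> word_class \<Gamma> w"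
      using vletter path_word_lists[OF vletter(2)] by (simp add: vclass_def path_group_mult)
    also have "\<dots> = (vclass u k \<cdot> form_class q) \<cdot> vclass v x"
      using vletter(1) v form_class_F[OF vq] by (simp add: x F.m_assoc)
    also have "\<dots> = form_class (vact k q) \<cdot> vclass v (y + x)"
      unfolding y using v form_class_F[OF valid_vact[OF vq]] by (simp add: F.m_assoc vclass_add)
    finally have "word_class \<Gamma> (vletter u k # w) = form_class (vact k q) \<cdot> vclass v (y + x)" .
    moreover have "form_end u (vact k q) = form_end u q" for k
      by (induction k q arbitrary: u rule: vact.induct) auto
    ultimately show ?case using vletter(1) x(2) by (auto simp: q)
  next
    case (Edg e w)
    obtain q where q: "foldr letter_act w (v, []) = (ghead \<Gamma> e, q)"
      using foldr_letter_act_path[OF Edg(2)] v by (metis prod.collapse valid.simps(1))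
    have vq: "valid (ghead \<Gamma> e) q"
      using foldr_letter_act_forms[OF path_word_lists[OF Edg(2)], of "(v, [])"] v by (simp add: q)
    obtain x where x: "word_class \<Gamma> w = form_class q \<cdot> vclass v x" "form_end (ghead \<Gamma> e) q = v"
      using Edg.IH by (auto simp: q)
    have "word_class \<Gamma> (Edg e # w) = eclass e \<cdot> word_class \<Gamma> w"
      using Edg path_word_lists[OF Edg(2)] by (simp add: eclass_def path_group_mult)
    also have "\<dots> = form_class (eact e q) \<cdot> vclass v x"
      using Edg(1) v form_class_F[OF vq] eact_form_class[OF Edg(1) vq] by (simp add: x F.m_assoc[symmetric])
    finally have "word_class \<Gamma> (Edg e # w) = form_class (eact e q) \<cdot> vclass v x" .
    moreover have "form_end (gtail \<Gamma> e) (eact e q) = form_end (ghead \<Gamma> e) q"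
      using Edg(1) by (auto simp: eact_def)
    ultimately show ?case using x(2) by (auto simp: q)
  qed
  then show ?thesis using w v by (simp add: cact_class)
qed

lemma valid_take: "valid v p \<Longrightarrow> valid v (take k p)"
proof (induction v p arbitrary: k rule: valid.induct)
  case (2 v c e p)
  then show ?case by (cases k; cases p) (auto simp: take_Cons split: nat.splits)
qed simp

text \<open>Edge groups have finite index in vertex groups, so there are finitely many coset
  representatives: the tree is locally finite.\<close>

lemma finite_form_letters: "finite {(c, e). e \<in> garcs \<Gamma> \<and> rep e c = c}"
proof -
  have "finite (range (rep e))" if e: "e \<in> garcs \<Gamma>" for e
  proof -
    interpret additive_subgroup_Zn "Bsub e" by (rule additive_Bsub[OF e])
    have r: "rev_arc \<Gamma> e \<in> garcs \<Gamma>" using e by simp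
    obtain m :: nat where m: "m > 0" "\<And>x. \<exists>y. incl (rev_arc \<Gamma> e) y = int m *s x"
      using inj_additive_image_contains_multiples[OF incl_add[OF r] inj_incl[OF r]] by blast
    have "int m *s x \<in> Bsub e" for x using m(2)[of x] unfolding Bsub_def by (metis rangeI)
    then show ?thesis by (rule finite_range_rep[OF m(1)])
  qed
  then have "finite (\<Union>e\<in>garcs \<Gamma>. range (rep e) \<times> {e})" using finite_graph by blast
  moreover have "{(c, e). e \<in> garcs \<Gamma> \<and> rep e c = c} \<subseteq> (\<Union>e\<in>garcs \<Gamma>. range (rep e) \<times> {e})"
    by auto (metis rangeI)
  ultimately show ?thesis by (rule finite_subset[rotated])
qed

lemma valid_form_letters: "valid v p \<Longrightarrow> set p \<subseteq> {(c, e). e \<in> garcs \<Gamma> \<and> rep e c = c}"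
  by (induction v p rule: valid.induct) auto

lemma finite_forms: "finite {p. valid v p \<and> length p \<le> n}"
  by (rule finite_subset[OF _ finite_lists_length_le[OF finite_form_letters, of n]])
    (use valid_form_letters in blast)

lemma countable_forms: "countable {p. valid v p}"
  by (rule countable_subset[OF _ countable_lists[OF countable_finite[OF finite_form_letters]]])
    (use valid_form_letters in auto)

end

section \<open>Product actions\<close>

lemma (in isom_action) restrict_in_Isom:
  assumes g: "g \<in> carrier G"
  shows "restrict (\<psi> g) (mspace X) \<in> Isom X"
proof -
  have "bij_betw (\<psi> g) (mspace X) (mspace X)"
    by (rule bij_betw_byWitness[of _ "\<psi> (inv g)"]) (use g in \<open>auto simp: act_closed act_one simp flip: act_mult\<close>)
  then have "bij_betw (restrict (\<psi> g) (mspace X)) (mspace X) (mspace X)"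
    by (subst bij_betw_restrict_eq)
  then show ?thesis using g by (auto simp: Isom_def Bij_def act_isom)
qed

lemma isometric_action_restrict:
  fixes K :: "'a monoid"
  assumes "isom_action K X \<psi>"
  shows "isometric_action K X (\<lambda>g. restrict (\<psi> g) (mspace X))"
proof -
  interpret isom_action K X \<psi> by fact
  let ?\<phi> = "\<lambda>g. restrict (\<psi> g) (mspace X)"
  have B: "?\<phi> g \<in> Bij (mspace X)" if "g \<in> carrier K" for g
    using restrict_in_Isom[OF that] by (simp add: Isom_def)
  have "?\<phi> \<in> hom K (BijGroup (mspace X))"
  proof (rule homI)
    show "?\<phi> g \<in> carrier (BijGroup (mspace X))" if "g \<in> carrier K" for g
      using B[OF that] by (simp add: BijGroup_def)
    show "?\<phi> (g \<otimes>\<^bsub>K\<^esub> h) = ?\<phi> g \<otimes>\<^bsub>BijGroup (mspace X)\<^esub> ?\<phi> h" if "g \<in> carrier K" "h \<in> carrier K" for g h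
    proof
      fix x show "?\<phi> (g \<otimes>\<^bsub>K\<^esub> h) x = (?\<phi> g \<otimes>\<^bsub>BijGroup (mspace X)\<^esub> ?\<phi> h) x"
        using B that by (simp add: BijGroup_def compose_def act_mult act_closed)
    qed
  qed
  then have "group_action K (mspace X) ?\<phi>"
    by (intro group_action.intro group_hom.intro group_hom_axioms.intro is_group group_BijGroup)
  then show ?thesis unfolding isometric_action_def using restrict_in_Isom by auto
qed

lemma isom_action_l1_product:
  assumes r: "0 < r" and act: "\<And>i. i < r \<Longrightarrow> isom_action K (X i) (\<psi> i)"
  shows "isom_action K (l1_product r X) (\<lambda>h x. \<lambda>i\<in>{..<r}. \<psi> i h (x i))"
proof -
  interpret group K using act[OF r] by (rule isom_action.axioms)
  note rules = isom_action.act_closed[OF act] isom_action.act_mult[OF act] isom_action.act_one[OF act]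
    isom_action.act_isom[OF act] isom_action.nonempty[OF act]
  show ?thesis
  proof
    fix g h x assume "g \<in> carrier K" "h \<in> carrier K" "x \<in> mspace (l1_product r X)"
    then show "(\<lambda>i\<in>{..<r}. \<psi> i (g \<otimes>\<^bsub>K\<^esub> h) (x i)) = (\<lambda>i\<in>{..<r}. \<psi> i g ((\<lambda>i\<in>{..<r}. \<psi> i h (x i)) i))"
      by (auto simp: rules PiE_iff)
  next
    fix x assume x: "x \<in> mspace (l1_product r X)"
    show "(\<lambda>i\<in>{..<r}. \<psi> i \<one>\<^bsub>K\<^esub> (x i)) = x"
    proof
      fix i show "(\<lambda>i\<in>{..<r}. \<psi> i \<one>\<^bsub>K\<^esub> (x i)) i = x i"
        using x by (cases "i < r") (auto simp: rules PiE_iff extensional_def)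
    qed
  next
    show "mspace (l1_product r X) \<noteq> {}" using rules(5) by (auto simp: PiE_eq_empty_iff)
  qed (auto simp: rules PiE_iff intro!: sum.cong)
qed

text \<open>The l1 distance dominates every coordinate distance, so the set in the definition of
  \<open>acylindrical\<close> is contained in the set bounded by \<open>proper\<close> at the first
  of the two points.\<close>

lemma product_acylindrical_actionI:
  fixes K :: "'a monoid"
  assumes r: "0 < r" and act: "\<And>i. i < r \<Longrightarrow> isom_action K (X i) (\<psi> i)"
    and hyp: "\<And>i. i < r \<Longrightarrow> hyperbolic_space (X i)"
    and lox: "h \<in> carrier K" "i < r" "loxodromic (X i) (restrict (\<psi> i h) (mspace (X i)))"
    and proper: "\<And>\<epsilon>. 0 \<le> \<epsilon> \<Longrightarrow> \<exists>N. \<forall>x. (\<forall>i<r. x i \<in> mspace (X i)) \<longrightarrow>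
      finite {h \<in> carrier K. \<forall>i<r. mdist (X i) (x i) (\<psi> i h (x i)) \<le> \<epsilon>} \<and>
      card {h \<in> carrier K. \<forall>i<r. mdist (X i) (x i) (\<psi> i h (x i)) \<le> \<epsilon>} \<le> N"
  shows "\<exists>\<phi>. product_acylindrical_action K r X \<phi>"
proof
  let ?P = "l1_product r X"
  let ?\<phi> = "\<lambda>h. restrict (\<lambda>x. \<lambda>i\<in>{..<r}. \<psi> i h (x i)) (mspace ?P)"
  have as: "acts_as r X (?\<phi> h) (\<lambda>i. restrict (\<psi> i h) (mspace (X i)))" if "h \<in> carrier K" for h
    unfolding acts_as_def using isom_action.restrict_in_Isom[OF act that] by (auto simp: PiE_iff)
  have "acylindrical K ?P ?\<phi>"
    unfolding acylindrical_def
  proof (intro allI impI)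
    fix \<epsilon> :: real assume "0 \<le> \<epsilon>"
    then obtain N where N: "\<And>x. (\<And>i. i < r \<Longrightarrow> x i \<in> mspace (X i)) \<Longrightarrow>
      finite {h \<in> carrier K. \<forall>i<r. mdist (X i) (x i) (\<psi> i h (x i)) \<le> \<epsilon>} \<and>
      card {h \<in> carrier K. \<forall>i<r. mdist (X i) (x i) (\<psi> i h (x i)) \<le> \<epsilon>} \<le> N"
      using proper[OF \<open>0 \<le> \<epsilon>\<close>] by blast
    show "\<exists>(N::nat) (R::real). \<forall>x\<in>mspace ?P. \<forall>y\<in>mspace ?P. R \<le> mdist ?P x y \<longrightarrow>
        finite {h \<in> carrier K. mdist ?P x (?\<phi> h x) \<le> \<epsilon> \<and> mdist ?P y (?\<phi> h y) \<le> \<epsilon>} \<and>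
        card {h \<in> carrier K. mdist ?P x (?\<phi> h x) \<le> \<epsilon> \<and> mdist ?P y (?\<phi> h y) \<le> \<epsilon>} \<le> N"
    proof (intro exI[of _ N] exI ballI impI)
      fix x y assume x: "x \<in> mspace ?P"
      let ?S = "{h \<in> carrier K. mdist ?P x (?\<phi> h x) \<le> \<epsilon> \<and> mdist ?P y (?\<phi> h y) \<le> \<epsilon>}"
      let ?T = "{h \<in> carrier K. \<forall>i<r. mdist (X i) (x i) (\<psi> i h (x i)) \<le> \<epsilon>}"
      have "?S \<subseteq> ?T"
      proof
        fix h assume h: "h \<in> ?S"
        have "mdist (X i) (x i) (\<psi> i h (x i)) \<le> \<epsilon>" if i: "i < r" for i
        proof -
          have "mdist (X i) (x i) (?\<phi> h x i) \<le> mdist ?P x (?\<phi> h x)"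
            unfolding mdist_l1_product by (rule member_le_sum) (use i in auto)
          then show ?thesis using h x i by simp
        qed
        then show "h \<in> ?T" using h by blast
      qed
      moreover have T: "finite ?T \<and> card ?T \<le> N" using N x by (auto simp: PiE_iff)
      ultimately show "finite ?S \<and> card ?S \<le> N"
        using card_mono[of ?T ?S] finite_subset[of ?S ?T] by linarith
    qed
  qed
  then show "product_acylindrical_action K r X ?\<phi>"
    unfolding product_acylindrical_action_def preserves_factors_def
  proof (intro conjI allI impI ballI)
    show "1 \<le> r" using r by simp
    show "isometric_action K ?P ?\<phi>"
      by (rule isometric_action_restrict[OF isom_action_l1_product[of r K X \<psi>, OF r act]])
    show "\<exists>fs. acts_as r X (?\<phi> h) fs" if "h \<in> carrier K" for h using as[OF that] by blast
    show "\<exists>h\<in>carrier K. \<exists>fs. acts_as r X (?\<phi> h) fs \<and> (\<exists>i<r. loxodromic (X i) (fs i))"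
      using as[OF lox(1)] lox by blast
  qed (rule hyp)
qed

section \<open>The real line and its translations\<close>

lemma Metric_space_abs: "Metric_space (UNIV :: real set) (\<lambda>x y. \<bar>x - y\<bar>)"
  by standard auto

definition real_line :: "('x + real) metric" where
  "real_line = push_metric Inr UNIV (\<lambda>x y. \<bar>x - y\<bar>)"

lemma real_line_simps [simp]:
  "mspace real_line = range Inr" "mdist real_line (Inr s) (Inr t) = \<bar>s - t\<bar>"
  unfolding real_line_def
  by (simp_all add: mspace_push_metric[OF Metric_space_abs] mdist_push_metric[OF Metric_space_abs])

lemma hyperbolic_real_line: "hyperbolic_space real_line"
  unfolding real_line_def
proof (rule hyperbolic_space_push_metric[OF Metric_space_abs])
  fix x y :: real
  show "\<exists>\<gamma>. \<gamma> ` {0..\<bar>x - y\<bar>} \<subseteq> UNIV \<and> \<gamma> 0 = x \<and> \<gamma> \<bar>x - y\<bar> = y \<and>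
      (\<forall>s\<in>{0..\<bar>x - y\<bar>}. \<forall>t\<in>{0..\<bar>x - y\<bar>}. \<bar>\<gamma> s - \<gamma> t\<bar> = \<bar>s - t\<bar>)"
    by (rule exI[of _ "\<lambda>s. if x \<le> y then x + s else x - s"]) auto
next
  fix w x y z :: real
  show "\<bar>x - z\<bar> + \<bar>w - y\<bar> \<le> max (\<bar>x - y\<bar> + \<bar>z - w\<bar>) (\<bar>y - z\<bar> + \<bar>x - w\<bar>)"
    by linarith
qed auto

lemma isom_action_translations:
  fixes c :: "'a \<Rightarrow> real" and K :: "('a, 'b) monoid_scheme"
  assumes "group K" and c: "\<And>g h. g \<in> carrier K \<Longrightarrow> h \<in> carrier K \<Longrightarrow> c (g \<otimes>\<^bsub>K\<^esub> h) = c g + c h"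
  shows "isom_action K real_line (\<lambda>g z. Inr (projr z + c g))"
proof -
  interpret group K by fact
  have "c \<one>\<^bsub>K\<^esub> = 0" using c[of "\<one>\<^bsub>K\<^esub>" "\<one>\<^bsub>K\<^esub>"] by simp
  then show ?thesis by unfold_locales (auto simp: c)
qed

lemma loxodromic_translation:
  fixes c :: real
  assumes "c \<noteq> 0"
  shows "loxodromic real_line (restrict (\<lambda>z. Inr (projr z + c)) (mspace (real_line :: ('x + real) metric)))"
proof -
  let ?R = "real_line :: ('x + real) metric"
  let ?S = "range Inr :: ('x + real) set"
  define T where "T c = restrict (\<lambda>z. Inr (projr z + c) :: 'x + real) ?S" for c
  let ?B = "BijGroup ?S"
  interpret B: group ?B by (rule group_BijGroup)
  have T_Isom: "T c \<in> Isom ?R" for c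
  proof -
    have "bij_betw (\<lambda>z. Inr (projr z + c)) (range Inr) (range (Inr :: real \<Rightarrow> 'x + real))"
      by (rule bij_betw_byWitness[of _ "\<lambda>z. Inr (projr z - c)"]) auto
    then have "bij_betw (T c) ?S ?S" unfolding T_def by (subst bij_betw_restrict_eq)
    then show ?thesis by (auto simp: Isom_def Bij_def T_def)
  qed
  then have T_B: "T c \<in> carrier ?B" for c by (simp add: BijGroup_def Isom_def)
  have T_mult: "T c \<otimes>\<^bsub>?B\<^esub> T d = T (c + d)" for c d
  proof
    fix z show "(T c \<otimes>\<^bsub>?B\<^esub> T d) z = T (c + d) z"
      using T_B[of c] T_B[of d] by (auto simp: BijGroup_def compose_def T_def)
  qed
  have T_zero: "T 0 = \<one>\<^bsub>?B\<^esub>"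
    by (auto simp: BijGroup_def T_def restrict_def fun_eq_iff)
  have nat_pow: "T c [^]\<^bsub>?B\<^esub> n = T (real n * c)" for n :: nat
    by (induction n) (simp_all add: T_zero T_mult algebra_simps)
  have "T c [^]\<^bsub>?B\<^esub> k = T (of_int k * c)" for k :: int
  proof (cases k)
    case (nonneg n)
    then show ?thesis by (simp add: int_pow_int nat_pow)
  next
    case (neg n)
    have "inv\<^bsub>?B\<^esub> (T (real (Suc n) * c)) = T (- (real (Suc n) * c))"
      by (rule B.inv_equality) (auto simp: T_B T_mult T_zero simp del: of_nat_Suc)
    then have "T c [^]\<^bsub>?B\<^esub> (- int (Suc n)) = T (- (real (Suc n) * c))"
      using B.int_pow_neg_int[OF T_B, of c "Suc n"] by (simp only: nat_pow)
    moreover have "of_int (- int (Suc n)) * c = - (real (Suc n) * c)" by (simp add: algebra_simps)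
    ultimately show ?thesis by (simp only: neg)
  qed
  then have pow: "(T c [^]\<^bsub>?B\<^esub> k) (Inr 0) = Inr (of_int k * c)" for k :: int
    by (simp add: T_def)
  \<comment> \<open>With this constant the distance \<open>\<bar>c\<bar>\<close> per step lies
    between 1 / L and L, and the additive constant can be 0.\<close>
  define L where "L = max \<bar>c\<bar> (1 / \<bar>c\<bar>)"
  have "L \<ge> 1" using assms by (auto simp: L_def le_max_iff_disj field_simps)
  moreover have "1 / L \<le> \<bar>c\<bar>" using assms by (auto simp: L_def field_simps le_max_iff_disj max_def)
  ultimately have bounds: "\<bar>real_of_int (k - l)\<bar> / L - 0 \<le> \<bar>of_int k * c - of_int l * c\<bar>"
    "\<bar>of_int k * c - of_int l * c\<bar> \<le> L * \<bar>real_of_int (k - l)\<bar> + 0" for k l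
  proof -
    have e: "\<bar>of_int k * c - of_int l * c\<bar> = \<bar>c\<bar> * \<bar>real_of_int (k - l)\<bar>"
      by (simp add: abs_mult[symmetric] algebra_simps)
    show "\<bar>of_int k * c - of_int l * c\<bar> \<le> L * \<bar>real_of_int (k - l)\<bar> + 0"
      unfolding e add_0_right by (rule mult_right_mono) (auto simp: L_def)
    have "(1 / L) * \<bar>real_of_int (k - l)\<bar> \<le> \<bar>c\<bar> * \<bar>real_of_int (k - l)\<bar>"
      using \<open>1 / L \<le> \<bar>c\<bar>\<close> by (rule mult_right_mono) auto
    then show "\<bar>real_of_int (k - l)\<bar> / L - 0 \<le> \<bar>of_int k * c - of_int l * c\<bar>"
      unfolding e by simp
  qed
  have dist: "mdist ?R ((T c [^]\<^bsub>?B\<^esub> k) (Inr 0)) ((T c [^]\<^bsub>?B\<^esub> l) (Inr 0)) = \<bar>of_int k * c - of_int l * c\<bar>" for k l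
    unfolding pow by (rule real_line_simps(2))
  have "loxodromic ?R (T c)"
    unfolding loxodromic_def real_line_simps(1)
  proof (intro conjI T_Isom)
    show "\<exists>x\<in>?S. \<exists>L\<ge>1. \<exists>C\<ge>0. \<forall>k l :: int.
        \<bar>real_of_int (k - l)\<bar> / L - C \<le> mdist ?R ((T c [^]\<^bsub>?B\<^esub> k) x) ((T c [^]\<^bsub>?B\<^esub> l) x) \<and>
        mdist ?R ((T c [^]\<^bsub>?B\<^esub> k) x) ((T c [^]\<^bsub>?B\<^esub> l) x) \<le> L * \<bar>real_of_int (k - l)\<bar> + C"
      by (rule bexI[of _ "Inr 0"], rule exI[of _ L], rule conjI[OF \<open>L \<ge> 1\<close>], rule exI[of _ 0])
        (unfold dist, use bounds in auto)
  qed
  then show ?thesis by (simp only: T_def real_line_simps)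
qed

text \<open>A point of the realization is determined by its distances to the vertices, so the
  isometry \<alpha> g of the vertex set has exactly one extension \<open>ext g\<close>: it exists by
  \<open>tree_isometry_extends\<close> and is unique since \<alpha> g is onto \<open>V\<close>.
  Uniqueness also gives the action laws.\<close>

lemma isom_action_tree:
  fixes K :: "('a, 'b) monoid_scheme" and j :: "'c list \<times> real \<Rightarrow> 'y"
  assumes K: "group K" and V: "V \<noteq> {}" "\<And>k p. p \<in> V \<Longrightarrow> take k p \<in> V"
    and \<alpha>: "\<And>g p. g \<in> carrier K \<Longrightarrow> p \<in> V \<Longrightarrow> \<alpha> g p \<in> V"
      "\<And>g h p. g \<in> carrier K \<Longrightarrow> h \<in> carrier K \<Longrightarrow> p \<in> V \<Longrightarrow> \<alpha> (g \<otimes>\<^bsub>K\<^esub> h) p = \<alpha> g (\<alpha> h p)"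
      "\<And>p. p \<in> V \<Longrightarrow> \<alpha> \<one>\<^bsub>K\<^esub> p = p"
      "\<And>g p q. g \<in> carrier K \<Longrightarrow> p \<in> V \<Longrightarrow> q \<in> V \<Longrightarrow> vdist (\<alpha> g p) (\<alpha> g q) = vdist p q"
    and j: "inj_on j (tree_points V)"
  shows "\<exists>\<psi>. isom_action K (push_metric j (tree_points V) tdist) \<psi> \<and>
    (\<forall>g\<in>carrier K. \<forall>p\<in>V. \<psi> g (j (vpoint p)) = j (vpoint (\<alpha> g p)))"
proof -
  interpret group K by fact
  interpret M: Metric_space "tree_points V" tdist by (rule Metric_space_tree)
  let ?M = "tree_points V"
  define ext where "ext g x = (THE y. y \<in> ?M \<and> (\<forall>v\<in>V. tdist y (vpoint (\<alpha> g v)) = tdist x (vpoint v)))" for g x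
  have surj: "\<exists>v\<in>V. w = \<alpha> g v" if "g \<in> carrier K" "w \<in> V" for g w
    using that \<alpha>(1)[of "inv\<^bsub>K\<^esub> g" w] \<alpha>(2)[of g "inv\<^bsub>K\<^esub> g" w] \<alpha>(3)[of w] by (intro bexI[of _ "\<alpha> (inv\<^bsub>K\<^esub> g) w"]) auto
  have unique: "y = z" if yz: "g \<in> carrier K" "y \<in> ?M" "z \<in> ?M"
    and eq: "\<And>v. v \<in> V \<Longrightarrow> tdist y (vpoint (\<alpha> g v)) = tdist z (vpoint (\<alpha> g v))" for g y z
  proof -
    obtain w where w: "w \<in> V" "tdist y z \<le> \<bar>tdist y (vpoint w) - tdist z (vpoint w)\<bar>"
      using tdist_attained_at_vertex[OF yz(2,3)] by blast
    obtain v where "v \<in> V" "w = \<alpha> g v" using surj[OF yz(1) w(1)] by blast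
    then have "tdist y z \<le> 0" using w eq by simp
    then show ?thesis using M.nonneg[of y z] tdist_eq_0[OF yz(2,3)] by simp
  qed
  have ext: "ext g x \<in> ?M \<and> (\<forall>v\<in>V. tdist (ext g x) (vpoint (\<alpha> g v)) = tdist x (vpoint v))"
    if g: "g \<in> carrier K" and x: "x \<in> ?M" for g x
    unfolding ext_def
  proof (rule theI')
    obtain y where y: "y \<in> ?M" "\<forall>v\<in>V. tdist y (vpoint (\<alpha> g v)) = tdist x (vpoint v)"
      using tree_isometry_extends[of V "\<alpha> g", OF V(2) \<alpha>(1)[OF g] \<alpha>(4)[OF g] x] by auto
    then show "\<exists>!y. y \<in> ?M \<and> (\<forall>v\<in>V. tdist y (vpoint (\<alpha> g v)) = tdist x (vpoint v))"
      using unique[OF g] by (intro ex1I[of _ y]) auto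
  qed
  have ext_eq: "ext g x = y" if "g \<in> carrier K" "x \<in> ?M" "y \<in> ?M"
    "\<And>v. v \<in> V \<Longrightarrow> tdist y (vpoint (\<alpha> g v)) = tdist x (vpoint v)" for g x y
    using unique[OF that(1), of "ext g x" y] ext[OF that(1,2)] that by simp
  \<comment> \<open>The distance of two points is the largest difference of their distances to a
    vertex, and these distances are preserved.\<close>
  have isom: "tdist (ext g x) (ext g y) = tdist x y" if g: "g \<in> carrier K" and x: "x \<in> ?M" and y: "y \<in> ?M" for g x y
  proof (rule antisym)
    obtain w where w: "w \<in> V" "tdist (ext g x) (ext g y) \<le> \<bar>tdist (ext g x) (vpoint w) - tdist (ext g y) (vpoint w)\<bar>"
      using tdist_attained_at_vertex[of "ext g x" V "ext g y"] ext[OF g x] ext[OF g y] by blast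
    obtain v where v: "v \<in> V" "w = \<alpha> g v" using surj[OF g w(1)] by blast
    have "tdist (ext g x) (ext g y) \<le> \<bar>tdist x (vpoint v) - tdist y (vpoint v)\<bar>"
      using w(2) ext[OF g x] ext[OF g y] v by auto
    also have "\<dots> \<le> tdist x y"
      using tdist_triangle[of x "vpoint v" y] tdist_triangle[of y "vpoint v" x] M.commute[of x y] by simp
    finally show "tdist (ext g x) (ext g y) \<le> tdist x y" .
    obtain u where u: "u \<in> V" "tdist x y \<le> \<bar>tdist x (vpoint u) - tdist y (vpoint u)\<bar>"
      using tdist_attained_at_vertex[OF x y] by blast
    have "tdist x y \<le> \<bar>tdist (ext g x) (vpoint (\<alpha> g u)) - tdist (ext g y) (vpoint (\<alpha> g u))\<bar>"
      using u ext[OF g x] ext[OF g y] by auto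
    also have "\<dots> \<le> tdist (ext g x) (ext g y)"
      using tdist_triangle[of "ext g x" "vpoint (\<alpha> g u)" "ext g y"]
        tdist_triangle[of "ext g y" "vpoint (\<alpha> g u)" "ext g x"] M.commute[of "ext g x" "ext g y"] by simp
    finally show "tdist x y \<le> tdist (ext g x) (ext g y)" .
  qed
  have ext_vpoint: "ext g (vpoint p) = vpoint (\<alpha> g p)" if "g \<in> carrier K" "p \<in> V" for g p
    using that \<alpha> by (intro ext_eq) (auto simp: tdist_vpoint)
  define \<psi> where "\<psi> g z = j (ext g (inv_into ?M j z))" for g z
  have \<psi>: "\<psi> g (j x) = j (ext g x)" if "x \<in> ?M" for g x using that j by (simp add: \<psi>_def)
  note ms = mspace_push_metric[OF Metric_space_tree j] and md = mdist_push_metric[OF Metric_space_tree j]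
  have "isom_action K (push_metric j ?M tdist) \<psi>"
  proof
    fix g x assume "g \<in> carrier K" "x \<in> mspace (push_metric j ?M tdist)"
    then show "\<psi> g x \<in> mspace (push_metric j ?M tdist)" using ext by (auto simp: ms \<psi>)
  next
    fix g h z assume g: "g \<in> carrier K" and h: "h \<in> carrier K" and "z \<in> mspace (push_metric j ?M tdist)"
    then obtain x where x: "x \<in> ?M" "z = j x" by (auto simp: ms)
    have "ext (g \<otimes>\<^bsub>K\<^esub> h) x = ext g (ext h x)"
      using g h x ext \<alpha> by (intro ext_eq) auto
    then show "\<psi> (g \<otimes>\<^bsub>K\<^esub> h) z = \<psi> g (\<psi> h z)" using x ext[OF h x(1)] by (simp add: \<psi>)
  next
    fix z assume "z \<in> mspace (push_metric j ?M tdist)"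
    then obtain x where x: "x \<in> ?M" "z = j x" by (auto simp: ms)
    have "ext \<one>\<^bsub>K\<^esub> x = x" using x \<alpha> by (intro ext_eq) auto
    then show "\<psi> \<one>\<^bsub>K\<^esub> z = z" using x by (simp add: \<psi>)
  next
    fix g z z' assume g: "g \<in> carrier K" and "z \<in> mspace (push_metric j ?M tdist)" "z' \<in> mspace (push_metric j ?M tdist)"
    then obtain x y where xy: "x \<in> ?M" "z = j x" "y \<in> ?M" "z' = j y" by (auto simp: ms)
    then show "mdist (push_metric j ?M tdist) (\<psi> g z) (\<psi> g z') = mdist (push_metric j ?M tdist) z z'"
      using isom[OF g] ext[OF g] by (simp add: \<psi> md)
  next
    obtain p where "p \<in> V" using V(1) by blast
    then have "vpoint p \<in> ?M" by simp
    then show "mspace (push_metric j ?M tdist) \<noteq> {}" by (auto simp: ms simp del: vpoint_in)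
  qed
  moreover have "\<psi> g (j (vpoint p)) = j (vpoint (\<alpha> g p))" if "g \<in> carrier K" "p \<in> V" for g p
    using \<psi>[of "vpoint p"] ext_vpoint[OF that] that by simp
  ultimately show ?thesis by blast
qed

lemma tree_point_near_vertex:
  assumes "x \<in> tree_points V"
  shows "\<exists>p\<in>V. tdist x (vpoint p) \<le> 1"
proof -
  obtain p r where x: "x = (p, r)" by (cases x)
  have "p \<in> V" "0 \<le> r" "length p = nat \<lceil>r\<rceil>" using assms by (auto simp: x tree_points_def)
  moreover have "real_of_int \<lceil>r\<rceil> - r \<le> 1" by linarith
  ultimately show ?thesis
    by (intro bexI[of _ p]) (auto simp: x tdist_def meet_def vpoint_def)
qed

text \<open>The vertex is encoded in an even integer and the height in a fractional part, by the
  injection of the nonnegative reals into [0, 1) given by r / (1 + r).\<close>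

lemma tree_points_into_reals:
  assumes "countable V"
  shows "\<exists>j :: 'c list \<times> real \<Rightarrow> 'x + real. inj_on j (tree_points V)"
proof
  let ?n = "to_nat_on V"
  show "inj_on (\<lambda>(p, r). Inr (real (2 * ?n p) + r / (1 + r)) :: 'x + real) (tree_points V)"
  proof (rule inj_onI)
    fix x y
    assume x: "x \<in> tree_points V" and y: "y \<in> tree_points V"
      and xy: "(\<lambda>(p, r). Inr (real (2 * ?n p) + r / (1 + r)) :: 'x + real) x =
        (\<lambda>(p, r). Inr (real (2 * ?n p) + r / (1 + r))) y"
    obtain p r q s where x': "x = (p, r)" "y = (q, s)" by (cases x; cases y)
    have p: "(p, r) \<in> tree_points V" and q: "(q, s) \<in> tree_points V"
      and eq: "Inr (real (2 * ?n p) + r / (1 + r)) = (Inr (real (2 * ?n q) + s / (1 + s)) :: 'x + real)"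
      using x y xy by (simp_all add: x')
    have r: "0 \<le> r" "0 \<le> s" "p \<in> V" "q \<in> V" using p q by (auto simp: tree_points_def)
    have b: "0 \<le> r / (1 + r)" "r / (1 + r) < 1" "0 \<le> s / (1 + s)" "s / (1 + s) < 1" using r by auto
    have e: "real (2 * ?n p) + r / (1 + r) = real (2 * ?n q) + s / (1 + s)" using eq by simp
    then have "\<bar>real (2 * ?n p) - real (2 * ?n q)\<bar> < 1" using b by linarith
    then have n: "?n p = ?n q" by linarith
    then have "r / (1 + r) = s / (1 + s)" using e by simp
    then have "r = s" using r by (simp add: field_simps)
    moreover have "p = q" using n r assms inj_on_to_nat_on by (metis inj_onD)
    ultimately show "x = y" by (simp add: x')
  qed
qed

section \<open>The kernel of the monodromy\<close>

lemma matrices_bounded: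
  fixes S :: "(rat ^ 'n ^ 'm) set"
  assumes "finite S"
  shows "\<exists>c'. \<forall>C\<in>S. \<forall>y. (\<forall>i. \<bar>y $ i\<bar> \<le> c) \<longrightarrow> (\<forall>i. \<bar>(C *v y) $ i\<bar> \<le> c')"
  using assms
proof (induction S)
  case (insert C S)
  obtain c1 where c1: "\<forall>y. (\<forall>i. \<bar>y $ i\<bar> \<le> c) \<longrightarrow> (\<forall>i. \<bar>(C *v y) $ i\<bar> \<le> c1)"
    using matrix_bounded[of c C] by blast
  obtain c2 where c2: "\<forall>C\<in>S. \<forall>y. (\<forall>i. \<bar>y $ i\<bar> \<le> c) \<longrightarrow> (\<forall>i. \<bar>(C *v y) $ i\<bar> \<le> c2)"
    using insert.IH by blast
  show ?case
    by (rule exI[of _ "max c1 c2"]) (use c1 c2 in \<open>auto simp: le_max_iff_disj\<close>)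
qed simp

context gbs_basis
begin

text \<open>By \<open>modular_hom_eq\<close> this is the kernel of the modular homomorphism. Its
  elements act on rational vectors by translations.\<close>

definition mkernel :: "('v, 'e, 'g) letter list set set" where
  "mkernel = {g \<in> carrier G. clin g = mat 1}"

lemma subgroup_mkernel: "subgroup mkernel G"
proof (rule G.subgroupI)
  show "mkernel \<noteq> {}" using G.one_closed clin_one by (auto simp: mkernel_def simp del: G_simps(1))
  show "inv\<^bsub>G\<^esub> g \<in> mkernel" if g: "g \<in> mkernel" for g
  proof -
    have "g \<in> carrier G" "clin g = mat 1" using g by (auto simp: mkernel_def)
    then show ?thesis using clin_inv(1)[of g] G_in_F G.inv_closed[of g]
      by (auto simp: mkernel_def inv_G simp del: G_simps(1))
  qed
  show "g \<otimes>\<^bsub>G\<^esub> h \<in> mkernel" if gh: "g \<in> mkernel" "h \<in> mkernel" for g h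
    using gh G_in_F G.m_closed[of g h] by (auto simp: mkernel_def clin_mult simp del: G_simps(1))
qed (auto simp: mkernel_def)

text \<open>The cosets of the kernel are the fibres of the linear part.\<close>

lemma finite_index_mkernel:
  assumes "finite (clin ` carrier G)"
  shows "finite_index_subgroup mkernel G"
  unfolding finite_index_subgroup_def
proof
  show "subgroup mkernel G" by (rule subgroup_mkernel)
  have "rcosets\<^bsub>G\<^esub> mkernel \<subseteq> (\<lambda>M. {g \<in> carrier G. clin g = M}) ` clin ` carrier G"
  proof
    fix Z assume "Z \<in> rcosets\<^bsub>G\<^esub> mkernel"
    then obtain x where x: "x \<in> carrier G" "Z = mkernel #>\<^bsub>G\<^esub> x" by (auto simp: RCOSETS_def)
    have xF: "x \<in> carrier F" using x G_in_F by blast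
    have "Z = {g \<in> carrier G. clin g = clin x}"
    proof
      show "Z \<subseteq> {g \<in> carrier G. clin g = clin x}"
      proof
        fix g assume "g \<in> Z"
        then obtain h where h: "h \<in> mkernel" "g = h \<cdot> x" by (auto simp: x(2) r_coset_def)
        then have hG: "h \<in> carrier G" and "clin h = mat 1" by (auto simp: mkernel_def)
        then have "clin g = clin x" using G_in_F[OF hG] xF by (simp add: h(2) clin_mult)
        moreover have "g \<in> carrier G" using G.m_closed[OF hG x(1)] by (simp add: h(2))
        ultimately show "g \<in> {g \<in> carrier G. clin g = clin x}" by blast
      qed
      show "{g \<in> carrier G. clin g = clin x} \<subseteq> Z"
      proof
        fix g assume g: "g \<in> {g \<in> carrier G. clin g = clin x}"
        then have gF: "g \<in> carrier F" using G_in_F by blast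
        have "clin (g \<cdot> inv\<^bsub>F\<^esub> x) = mat 1"
          using g gF xF clin_inv(2)[OF xF] by (simp add: clin_mult)
        moreover have "g \<cdot> inv\<^bsub>F\<^esub> x \<in> carrier G"
          using g x(1) G.m_closed[of g "inv\<^bsub>G\<^esub> x"] G.inv_closed[OF x(1)] inv_G[OF x(1)] by (simp del: G_simps(1))
        ultimately have "g \<cdot> inv\<^bsub>F\<^esub> x \<in> mkernel" by (simp add: mkernel_def)
        moreover have "g = (g \<cdot> inv\<^bsub>F\<^esub> x) \<otimes>\<^bsub>G\<^esub> x" using gF xF by (simp add: F.m_assoc)
        ultimately show "g \<in> Z" unfolding x(2) r_coset_def by blast
      qed
    qed
    then show "Z \<in> (\<lambda>M. {g \<in> carrier G. clin g = M}) ` clin ` carrier G" using x(1) by blast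
  qed
  then show "finite (rcosets\<^bsub>G\<^esub> mkernel)" using assms finite_subset by blast
qed

lemma mkernel_translation:
  assumes "h \<in> mkernel"
  shows "h \<in> carrier G" "h \<in> carrier F" "caff h z = z + caff h 0"
  using assms G_in_F caff_eq_clin[of h z] by (auto simp: mkernel_def)

text \<open>All paths from \<open>v\<close> to \<open>P\<close> arise from a fixed one by composing
  with loops at \<open>P\<close>, so their linear parts lie in one translate of a finite
  set.\<close>

lemma finite_clin_paths:
  assumes fin: "finite (clin ` carrier G)"
  shows "finite (clin ` path_classes \<Gamma> v P)"
proof (cases "path_classes \<Gamma> v P = {}")
  case False
  then obtain X where X: "X \<in> path_classes \<Gamma> v P" by blast
  have XF: "X \<in> carrier F" using path_classes_F[OF X] .
  have "clin ` path_classes \<Gamma> v P \<subseteq> (\<lambda>M. clin X ** M) ` clin ` carrier G"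
  proof
    fix M assume "M \<in> clin ` path_classes \<Gamma> v P"
    then obtain Y where Y: "Y \<in> path_classes \<Gamma> v P" "M = clin Y" by blast
    have YF: "Y \<in> carrier F" using path_classes_F[OF Y(1)] .
    have G: "inv\<^bsub>F\<^esub> X \<cdot> Y \<in> carrier G"
      using path_classes_mult[OF path_classes_inv[OF X] Y(1)] by simp
    have "X \<cdot> (inv\<^bsub>F\<^esub> X \<cdot> Y) = Y" using XF YF by simp
    then have "M = clin X ** clin (inv\<^bsub>F\<^esub> X \<cdot> Y)"
      using XF YF Y(2) clin_mult[of X "inv\<^bsub>F\<^esub> X \<cdot> Y"] by simp
    then show "M \<in> (\<lambda>M. clin X ** M) ` clin ` carrier G" using G by blast
  qed
  then show ?thesis using fin finite_subset by blast
qed simp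

section \<open>The kernel acting on the tree and on the lines\<close>

definition vertex_act :: "('v, 'e, 'g) letter list set \<Rightarrow> ((int ^ 'n) \<times> 'e) list \<Rightarrow> ((int ^ 'n) \<times> 'e) list" where
  "vertex_act g p = snd (cact g (P, p))"

lemma vertex_act:
  assumes g: "g \<in> carrier G" and p: "valid P p"
  shows "valid P (vertex_act g p)" "cact g (P, p) = (P, vertex_act g p)"
    "valid P q \<Longrightarrow> vdist (vertex_act g p) (vertex_act g q) = vdist p q"
proof -
  have g': "g \<in> path_classes \<Gamma> P P" using g by simp
  show "valid P (vertex_act g p)" "cact g (P, p) = (P, vertex_act g p)"
    "valid P q \<Longrightarrow> vdist (vertex_act g p) (vertex_act g q) = vdist p q"
    unfolding vertex_act_def by (rule cact_path[OF g' p]; assumption?)+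
qed

lemma vertex_act_one: "valid P p \<Longrightarrow> vertex_act \<one>\<^bsub>F\<^esub> p = p"
  by (simp add: vertex_act_def cact_one)

lemma vertex_act_mult:
  assumes g: "g \<in> carrier G" and h: "h \<in> carrier G" and p: "valid P p"
  shows "vertex_act (g \<cdot> h) p = vertex_act g (vertex_act h p)"
proof -
  have "cact (g \<cdot> h) (P, p) = cact g (cact h (P, p))"
    using G_in_F[OF g] G_in_F[OF h] p by (simp add: cact_mult)
  also have "\<dots> = cact g (P, vertex_act h p)" by (simp only: vertex_act(2)[OF h p])
  finally show ?thesis by (simp only: vertex_act_def[of "g \<cdot> h"] vertex_act_def[of g])
qed

text \<open>Conjugating \<open>h\<close> by the path to \<open>p\<close> gives a loop at the end vertex of \<open>p\<close> of length
  \<open>vdist p (h p)\<close>; its normal form takes finitely many values, and so does the remaining vertex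
  group element, since the translation part is bounded.\<close>

lemma mkernel_uniformly_proper:
  assumes fin: "finite (clin ` carrier G)"
  shows "\<exists>N. \<forall>p. valid P p \<longrightarrow>
    finite {h \<in> mkernel. vdist p (vertex_act h p) \<le> \<epsilon> \<and> (\<forall>i. \<bar>caff h 0 $ i\<bar> \<le> c)} \<and>
    card {h \<in> mkernel. vdist p (vertex_act h p) \<le> \<epsilon> \<and> (\<forall>i. \<bar>caff h 0 $ i\<bar> \<le> c)} \<le> N"
proof -
  let ?M = "\<Union>v\<in>gverts \<Gamma>. clin ` path_classes \<Gamma> v P"
  have "finite ?M" using finite_clin_paths[OF fin] finite_graph by blast
  \<comment> \<open>Finiteness of the monodromy gives one bound for all tree vertices at once:
    conjugation by the path to \<open>p\<close> changes a translation vector by one of finitely many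
    matrices.\<close>
  then obtain c' where c': "\<And>C y i. C \<in> ?M \<Longrightarrow> (\<And>i. \<bar>y $ i\<bar> \<le> c) \<Longrightarrow> \<bar>(C *v y) $ i\<bar> \<le> c'"
    using matrices_bounded[of ?M c] by blast
  define Q where "Q v = {q. valid v q \<and> length q \<le> nat \<lfloor>\<epsilon>\<rfloor>}" for v
  \<comment> \<open>For each normal form the affine map is invertible, so only finitely many vertex
    elements keep the translation part within the bound.\<close>
  define Z where "Z q = {x. \<forall>i. \<bar>(clin (form_class q) *v ratvec x + caff (form_class q) 0) $ i\<bar> \<le> c'}" for q
  define QZ where "QZ v = Sigma (Q v) Z" for v
  have fin_QZ: "finite (QZ v)" for v
    unfolding QZ_def
  proof (rule finite_SigmaI)
    show "finite (Q v)" unfolding Q_def by (rule finite_forms)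
    fix q assume "q \<in> Q v"
    then have "form_class q \<in> carrier F" using form_class_F[of v q] by (simp add: Q_def del: form_class_F)
    then show "finite (Z q)" unfolding Z_def by (intro finite_affine_bounded invertible_clin)
  qed
  show ?thesis
  \<comment> \<open>The bound for \<open>p\<close> depends only on its end vertex in the finite
    graph; summing over all of these makes it uniform.\<close>
  proof (intro exI[of _ "\<Sum>v\<in>gverts \<Gamma>. card (QZ v)"] allI impI)
    fix p assume p: "valid P p"
    define v where "v = form_end P p"
    define g where "g = form_class p"
    let ?S = "{h \<in> mkernel. vdist p (vertex_act h p) \<le> \<epsilon> \<and> (\<forall>i. \<bar>caff h 0 $ i\<bar> \<le> c)}"
    have g: "g \<in> path_classes \<Gamma> P v" unfolding g_def v_def by (rule form_class_path[OF p])
    have gF: "g \<in> carrier F" by (rule path_classes_F[OF g])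
    have v: "v \<in> gverts \<Gamma>" using path_classes_verts[OF g] by simp
    have gp: "cact g (v, []) = (P, p)" unfolding g_def v_def by (rule cact_form_class[OF p])
    have sub: "?S \<subseteq> (\<lambda>(q, x). g \<cdot> (form_class q \<cdot> vclass v x) \<cdot> inv\<^bsub>F\<^esub> g) ` QZ v"
    proof
      fix h assume "h \<in> ?S"
      then have h: "h \<in> mkernel" and d: "vdist p (vertex_act h p) \<le> \<epsilon>" and t: "\<And>i. \<bar>caff h 0 $ i\<bar> \<le> c" by auto
      note hG = mkernel_translation(1)[OF h] and hF = mkernel_translation(2)[OF h]
      define w where "w = inv\<^bsub>F\<^esub> g \<cdot> (h \<cdot> g)"
      have w: "w \<in> path_classes \<Gamma> v v"
        unfolding w_def using path_classes_inv[OF g] g hG by (auto intro!: path_classes_mult[of _ _ P])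
      have wF: "w \<in> carrier F" by (rule path_classes_F[OF w])
      have gw: "g \<cdot> w = h \<cdot> g" using gF hF by (simp add: w_def)
      define q where "q = snd (cact w (v, []))"
      have nil: "valid v []" using v by simp
      have wq: "cact w (v, []) = (v, q)" and vq: "valid v q"
        using cact_path[OF w nil] by (simp_all add: q_def)
      have "cact g (v, q) = cact (g \<cdot> w) (v, [])" using gF wF nil by (simp add: cact_mult wq)
      also have "\<dots> = cact h (P, p)" unfolding gw using hF gF nil by (simp add: cact_mult gp)
      finally have "vertex_act h p = snd (cact g (v, q))" by (simp add: vertex_act_def)
      then have "vdist [] q = vdist p (vertex_act h p)"
        using cact_path(3)[OF g nil vq] gp by simp
      then have "real (length q) \<le> \<epsilon>" using d by (simp add: vdist_def)
      then have qQ: "q \<in> Q v" using vq by (simp add: Q_def) linarith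
      obtain x where x: "w = form_class q \<cdot> vclass v x"
        using path_class_eq_form_class[OF w] unfolding q_def by blast
      have fF: "form_class q \<in> carrier F" by (rule form_class_F[OF vq])
      have "caff w 0 = caff (form_class q) (ratvec x)" unfolding x using fF v by (simp add: caff_mult)
      also have "\<dots> = clin (form_class q) *v ratvec x + caff (form_class q) 0" by (rule caff_eq_clin[OF fF])
      finally have 1: "caff w 0 = clin (form_class q) *v ratvec x + caff (form_class q) 0" .
      \<comment> \<open>As \<open>h\<close> is a pure translation, so is its conjugate
        \<open>w\<close>, by the vector of \<open>h\<close> transformed by the linear part of
        g^-1.\<close>
      have "caff w 0 = caff (inv\<^bsub>F\<^esub> g) (caff g 0 + caff h 0)"
        unfolding w_def using gF hF mkernel_translation(3)[OF h, of "caff g 0"] by (simp add: caff_mult)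
      also have "\<dots> = clin (inv\<^bsub>F\<^esub> g) *v caff h 0 + caff (inv\<^bsub>F\<^esub> g) (caff g 0)"
        using caff_eq_clin[of "inv\<^bsub>F\<^esub> g" "caff g 0 + caff h 0"] caff_eq_clin[of "inv\<^bsub>F\<^esub> g" "caff g 0"] gF
        by (simp add: matrix_vector_right_distrib)
      finally have 2: "caff w 0 = clin (inv\<^bsub>F\<^esub> g) *v caff h 0" using gF by (simp add: caff_inv)
      have "clin (inv\<^bsub>F\<^esub> g) \<in> ?M" using path_classes_inv[OF g] v by blast
      then have "\<bar>caff w 0 $ i\<bar> \<le> c'" for i unfolding 2 by (rule c'[OF _ t])
      then have "x \<in> Z q" unfolding Z_def 1 by blast
      moreover have "h = g \<cdot> (form_class q \<cdot> vclass v x) \<cdot> inv\<^bsub>F\<^esub> g"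
        unfolding x[symmetric] gw using gF hF by (simp add: F.m_assoc)
      ultimately show "h \<in> (\<lambda>(q, x). g \<cdot> (form_class q \<cdot> vclass v x) \<cdot> inv\<^bsub>F\<^esub> g) ` QZ v"
        using qQ by (intro image_eqI[of _ _ "(q, x)"]) (auto simp: QZ_def)
    qed
    have "card (QZ v) \<le> (\<Sum>v\<in>gverts \<Gamma>. card (QZ v))"
      by (rule member_le_sum) (use v finite_graph in auto)
    then show "finite ?S \<and> card ?S \<le> (\<Sum>v\<in>gverts \<Gamma>. card (QZ v))"
      by (intro conjI finite_surj[OF fin_QZ sub] order_trans[OF surj_card_le[OF fin_QZ sub]])
  qed
qed

text \<open>The factors with index below \<open>n\<close> are lines, one for each coordinate of the
  translation vector; the last one, with index \<open>n\<close>, is the tree.\<close>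

lemma product_acylindrical_action_mkernel:
  assumes fin: "finite (clin ` carrier G)"
  shows "has_product_acylindrical_action TYPE('x + real) (G\<lparr>carrier := mkernel\<rparr>)"
proof -
  let ?K = "G\<lparr>carrier := mkernel\<rparr>"
  let ?V = "{p. valid P p}"
  have group_K: "group ?K" by (rule G.subgroup_imp_group[OF subgroup_mkernel])
  note kG = mkernel_translation(1) and kF = mkernel_translation(2)
  obtain j :: "((int ^ 'n) \<times> 'e) list \<times> real \<Rightarrow> 'x + real" where j: "inj_on j (tree_points ?V)"
    using tree_points_into_reals[OF countable_forms] by blast
  let ?T = "push_metric j (tree_points ?V) tdist"
  note ms = mspace_push_metric[OF Metric_space_tree j] and md = mdist_push_metric[OF Metric_space_tree j]
  have V: "[] \<in> ?V" using P by simp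
  have closed: "take k p \<in> ?V" if "p \<in> ?V" for k p using that valid_take by simp
  have "\<exists>\<psi>. isom_action ?K ?T \<psi> \<and> (\<forall>g\<in>carrier ?K. \<forall>p\<in>?V. \<psi> g (j (vpoint p)) = j (vpoint (vertex_act g p)))"
    by (rule isom_action_tree[OF group_K _ closed _ _ _ _ j])
      (use V vertex_act(1,3) kG vertex_act_mult vertex_act_one in \<open>auto simp del: G_simps(1) intro: exI[of _ "[]"]\<close>)
  then obtain \<psi>T where T: "isom_action ?K ?T \<psi>T"
    and \<psi>T: "\<And>g p. g \<in> mkernel \<Longrightarrow> valid P p \<Longrightarrow> \<psi>T g (j (vpoint p)) = j (vpoint (vertex_act g p))"
    by auto
  have hyp_T: "hyperbolic_space ?T"
  proof (rule hyperbolic_space_push_metric[OF Metric_space_tree j])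
    have "vpoint [] \<in> tree_points ?V" using V by simp
    then show "tree_points ?V \<noteq> {}" by blast
  qed (use tree_geodesic[OF _ _ closed] tdist_four_point in auto)
  obtain idx :: "nat \<Rightarrow> 'n" where idx: "bij_betw idx {..<CARD('n)} UNIV"
    using ex_bij_betw_nat_finite[of "UNIV :: 'n set"] by (auto simp: atLeast0LessThan)
  define n where "n = CARD('n)"
  define t where "t i h = (of_rat (caff h 0 $ idx i) :: real)" for i and h :: "('v, 'e, 'g) letter list set"
  define X where "X i = (if i < n then real_line else ?T)" for i
  define \<psi> where "\<psi> i = (if i < n then (\<lambda>g z. Inr (projr z + t i g)) else \<psi>T)" for i
  have t_add: "t i (g \<otimes>\<^bsub>?K\<^esub> h) = t i g + t i h" if "g \<in> carrier ?K" "h \<in> carrier ?K" for i g h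
    using that kF mkernel_translation(3)[of g "caff h 0"] by (simp add: t_def caff_mult of_rat_add)
  have act: "isom_action ?K (X i) (\<psi> i)" if "i < Suc n" for i
  proof -
    have "isom_action ?K (real_line :: ('x + real) metric) (\<lambda>g z. Inr (projr z + t i g))"
      by (rule isom_action_translations[OF group_K t_add])
    then show ?thesis using T by (simp add: X_def \<psi>_def)
  qed
  have hyp: "hyperbolic_space (X i)" if "i < Suc n" for i
  proof -
    have "hyperbolic_space (real_line :: ('x + real) metric)" by (rule hyperbolic_real_line)
    then show ?thesis using hyp_T by (simp add: X_def)
  qed
  \<comment> \<open>A basis element of \<open>A\<close> translates by a nonzero vector, as
    \<open>base_matrix\<close> is invertible, and so acts loxodromically on the line of some
    coordinate.\<close>
  define h where "h = comb (axis undefined 1)"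
  have "clin h *v z = mat 1 *v z" for z
    using caff_eq_clin[of h z] caff_comb comb_in(3) by (simp add: h_def)
  then have "clin h = mat 1" by (simp add: matrix_eq)
  then have h: "h \<in> mkernel" using comb_in(2) by (simp add: mkernel_def h_def del: G_simps)
  have "caff h 0 \<noteq> 0"
  proof
    assume "caff h 0 = 0"
    then have "base_matrix *v ratvec (axis undefined 1) = 0" by (simp add: h_def caff_comb)
    then have "ratvec (axis undefined 1 :: int ^ 'n) = 0"
      using invertible_cancel(1)[OF invertible_base_matrix, of "ratvec (axis undefined 1)"] by simp
    then show False by (simp add: vec_eq_iff axis_def split: if_splits)
  qed
  then obtain k where "caff h 0 $ k \<noteq> 0" by (auto simp: vec_eq_iff)
  moreover obtain i where i: "i < n" "idx i = k"
    using idx unfolding bij_betw_def n_def by (metis UNIV_I imageE lessThan_iff)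
  ultimately have ti: "t i h \<noteq> 0" by (simp add: t_def)
  have lox: "loxodromic (X i) (restrict (\<psi> i h) (mspace (X i)))"
    using loxodromic_translation[OF ti] i by (simp add: X_def \<psi>_def)
  have "\<exists>\<phi>. product_acylindrical_action ?K (Suc n) X \<phi>"
  proof (rule product_acylindrical_actionI[OF _ act hyp])
    show "h \<in> carrier ?K" using h by simp
    show "i < Suc n" using i by simp
    show "loxodromic (X i) (restrict (\<psi> i h) (mspace (X i)))" by (rule lox)
    fix \<epsilon> :: real assume "0 \<le> \<epsilon>"
    \<comment> \<open>The tree coordinate is replaced by a vertex at distance at most 1, which
      changes displacements by at most 2. The translation vector is rational, so its bound is
      rounded up to an integer.\<close>
    obtain N where N: "\<And>p. valid P p \<Longrightarrow>
      finite {h \<in> mkernel. vdist p (vertex_act h p) \<le> \<epsilon> + 2 \<and> (\<forall>i. \<bar>caff h 0 $ i\<bar> \<le> of_int \<lceil>\<epsilon>\<rceil>)} \<and>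
      card {h \<in> mkernel. vdist p (vertex_act h p) \<le> \<epsilon> + 2 \<and> (\<forall>i. \<bar>caff h 0 $ i\<bar> \<le> of_int \<lceil>\<epsilon>\<rceil>)} \<le> N"
      using mkernel_uniformly_proper[OF fin, of "\<epsilon> + 2" "of_int \<lceil>\<epsilon>\<rceil>"] by blast
    show "\<exists>N. \<forall>x. (\<forall>i<Suc n. x i \<in> mspace (X i)) \<longrightarrow>
      finite {h \<in> carrier ?K. \<forall>i<Suc n. mdist (X i) (x i) (\<psi> i h (x i)) \<le> \<epsilon>} \<and>
      card {h \<in> carrier ?K. \<forall>i<Suc n. mdist (X i) (x i) (\<psi> i h (x i)) \<le> \<epsilon>} \<le> N"
    proof (intro exI[of _ N] allI impI)
      fix x assume x: "\<forall>i<Suc n. x i \<in> mspace (X i)"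
      let ?S = "{h \<in> carrier ?K. \<forall>i<Suc n. mdist (X i) (x i) (\<psi> i h (x i)) \<le> \<epsilon>}"
      have "x n \<in> mspace ?T" using spec[OF x, of n] by (simp add: X_def)
      then obtain y where y: "y \<in> tree_points ?V" "x n = j y" by (auto simp: ms)
      obtain p where p: "valid P p" "tdist y (vpoint p) \<le> 1" using tree_point_near_vertex[OF y(1)] by auto
      let ?R = "{h \<in> mkernel. vdist p (vertex_act h p) \<le> \<epsilon> + 2 \<and> (\<forall>i. \<bar>caff h 0 $ i\<bar> \<le> of_int \<lceil>\<epsilon>\<rceil>)}"
      have "?S \<subseteq> ?R"
      proof (intro subsetI CollectI conjI allI)
        fix h assume "h \<in> ?S"
        then have h: "h \<in> mkernel" and d: "\<And>i. i < Suc n \<Longrightarrow> mdist (X i) (x i) (\<psi> i h (x i)) \<le> \<epsilon>" by auto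
        show "h \<in> mkernel" by (rule h)
        interpret T: isom_action ?K ?T \<psi>T by (rule T)
        have vp: "vpoint p \<in> tree_points ?V" "vpoint (vertex_act h p) \<in> tree_points ?V"
          using p vertex_act(1)[OF kG[OF h] p(1)] by simp_all
        have "T.disp (j (vpoint p)) h \<le> T.disp (x n) h + 2 * mdist ?T (j (vpoint p)) (x n)"
          using h vp y by (intro T.disp_base_change) (auto simp: ms)
        moreover have "T.disp (x n) h \<le> \<epsilon>" using d[of n] by (simp add: T.disp_def X_def \<psi>_def)
        moreover have "mdist ?T (j (vpoint p)) (x n) \<le> 1"
          using p(2) md[OF y(1) vp(1)] by (simp add: y(2) mdist_commute)
        moreover have "T.disp (j (vpoint p)) h = vdist p (vertex_act h p)"
          using \<psi>T[OF h p(1)] md[OF vp] by (simp add: T.disp_def tdist_vpoint)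
        ultimately show "vdist p (vertex_act h p) \<le> \<epsilon> + 2" by simp
        fix l
        obtain i where i: "i < n" "idx i = l"
          using idx unfolding bij_betw_def n_def by (metis UNIV_I imageE lessThan_iff)
        have "x i \<in> range Inr" using spec[OF x, of i] i by (simp add: X_def)
        then obtain s where s: "x i = Inr s" by blast
        have "\<bar>t i h\<bar> \<le> \<epsilon>" using d[of i] i by (simp add: X_def \<psi>_def s)
        also have "\<epsilon> \<le> of_int \<lceil>\<epsilon>\<rceil>" by simp
        finally have "(of_rat \<bar>caff h 0 $ l\<bar> :: real) \<le> of_rat (of_int \<lceil>\<epsilon>\<rceil>)"
          by (simp add: t_def i(2))
        then show "\<bar>caff h 0 $ l\<bar> \<le> of_int \<lceil>\<epsilon>\<rceil>" by (simp only: of_rat_less_eq)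
      qed
      then show "finite ?S \<and> card ?S \<le> N"
        using N[OF p(1)] card_mono[of ?R ?S] finite_subset[of ?S ?R] by linarith
    qed
  qed simp_all
  then show ?thesis unfolding has_product_acylindrical_action_def by blast
qed

end

text \<open>Both sides are compared with finiteness of the set of linear parts of the fundamental
  group. The implication to finite monodromy works over any point type; the converse uses the
  summand \<open>real\<close> to house the lines and the tree.\<close>

theorem theorem4p4:
  fixes \<Gamma> :: "('v, 'e, 'g, 'h) graph_of_groups"
    and P :: 'v
    and v0 :: "('v, 'e, 'g) tree_vertex"
    and A :: "('v, 'e, 'g) letter list set set"
    and a :: "'n::finite \<Rightarrow> ('v, 'e, 'g) letter list set"
  assumes "gbs_graph TYPE('n) \<Gamma>"
    and "P \<in> gverts \<Gamma>"
    and "base_Zn_subgroup TYPE('n) \<Gamma> P v0 A"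
    and "ordered_basis (fundamental_group \<Gamma> P) A a"
  shows "(\<exists>H. finite_index_subgroup H (fundamental_group \<Gamma> P) \<and>
              has_product_acylindrical_action TYPE('x + real)
                ((fundamental_group \<Gamma> P)\<lparr>carrier := H\<rparr>))
         \<longleftrightarrow> finite (monodromy (fundamental_group \<Gamma> P) A a)"
proof -
  interpret gbs_basis \<Gamma> "TYPE('n)" P v0 A a
    using assms by unfold_locales
  show ?thesis
    unfolding finite_monodromy_iff
  proof
    assume "\<exists>H. finite_index_subgroup H G \<and> has_product_acylindrical_action TYPE('x + real) (G\<lparr>carrier := H\<rparr>)"
    then show "finite (clin ` carrier G)"
      unfolding has_product_acylindrical_action_def using finite_clin_if_product_acylindrical by blast
  next
    assume "finite (clin ` carrier G)"
    then show "\<exists>H. finite_index_subgroup H G \<and> has_product_acylindrical_action TYPE('x + real) (G\<lparr>carrier := H\<rparr>)"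
      using finite_index_mkernel product_acylindrical_action_mkernel by blast
  qed
qed

end
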